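(* Suppose $j : M \to N$ is a nontrivial elementary embedding between transitive models of $\mathrm{ZFC}$ with the same class of ordinals $\Omega$, and let $\kappa = \operatorname{crit}(j)$. Then at least one of the following holds: (1) the critical sequence $\langle j^n(\kappa) : n \in \omega \rangle$ is cofinal in $\Omega$; (2) for some $\alpha \in \Omega$, $j[\alpha] \notin N$; (3) for some $\alpha \in \Omega$, $\alpha$ is regular in $M$ and singular in $N$.
   Context: $\operatorname{crit}(j)$ denotes the least ordinal moved by $j$; $j[\alpha] = \{ j(\beta) : \beta < \alpha\}$. Since $M$ and $N$ have the same ordinals, the iterates $j^n(\kappa)$ are defined. *)

theory Defs
  imports Main
begin

text \<open>
  The ambient universe is a type equipped with an extensional, well-founded membership relation,
  given by the map sending each set to the HOL set of its elements. Classes are HOL sets over this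
  type. No closure conditions are imposed, so the type may be thought of as any transitive class
  containing the models under consideration.
\<close>

class set_universe =
  fixes elts :: "'a \<Rightarrow> 'a set"
  assumes elts_inject: "elts x = elts y \<Longrightarrow> x = y"
    and wf_elts: "wf {(x, y). x \<in> elts y}"

definition transitive_class :: "'v::set_universe set \<Rightarrow> bool" where
  "transitive_class M \<longleftrightarrow> (\<forall>x\<in>M. elts x \<subseteq> M)"

definition Ord :: "'v::set_universe \<Rightarrow> bool" where
  "Ord \<alpha> \<longleftrightarrow> (\<forall>\<beta>\<in>elts \<alpha>. elts \<beta> \<subseteq> elts \<alpha>) \<and> (\<forall>\<beta>\<in>elts \<alpha>. \<forall>\<gamma>\<in>elts \<beta>. elts \<gamma> \<subseteq> elts \<beta>)"

definition Limit :: "'v::set_universe \<Rightarrow> bool" where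
  "Limit \<alpha> \<longleftrightarrow> Ord \<alpha> \<and> elts \<alpha> \<noteq> {} \<and> (\<forall>\<beta>\<in>elts \<alpha>. \<exists>\<gamma>\<in>elts \<alpha>. \<beta> \<in> elts \<gamma>)"

definition ordinals_of :: "'v::set_universe set \<Rightarrow> 'v set" where
  "ordinals_of M = {\<alpha> \<in> M. Ord \<alpha>}"


subsection \<open>First-order formulas of set theory\<close>

datatype fm =
    Mem nat nat
  | Equal nat nat
  | Neg fm
  | Conj fm fm
  | Forall nat fm

primrec sat :: "'v::set_universe set \<Rightarrow> (nat \<Rightarrow> 'v) \<Rightarrow> fm \<Rightarrow> bool" where
  "sat M s (Mem m n) \<longleftrightarrow> s m \<in> elts (s n)"
| "sat M s (Equal m n) \<longleftrightarrow> s m = s n"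
| "sat M s (Neg \<phi>) \<longleftrightarrow> \<not> sat M s \<phi>"
| "sat M s (Conj \<phi> \<psi>) \<longleftrightarrow> sat M s \<phi> \<and> sat M s \<psi>"
| "sat M s (Forall n \<phi>) \<longleftrightarrow> (\<forall>a\<in>M. sat M (s(n := a)) \<phi>)"

definition elementary_embedding ::
    "('v::set_universe \<Rightarrow> 'v) \<Rightarrow> 'v set \<Rightarrow> 'v set \<Rightarrow> bool" where
  "elementary_embedding j M N \<longleftrightarrow> j ` M \<subseteq> N \<and>
     (\<forall>\<phi> s. range s \<subseteq> M \<longrightarrow> (sat M s \<phi> \<longleftrightarrow> sat N (j \<circ> s) \<phi>))"


subsection \<open>Relativized set-theoretic notions\<close>

definition upair_in :: "'v::set_universe set \<Rightarrow> 'v \<Rightarrow> 'v \<Rightarrow> 'v \<Rightarrow> bool" where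
  "upair_in M x y p \<longleftrightarrow> (\<forall>z\<in>M. z \<in> elts p \<longleftrightarrow> z = x \<or> z = y)"

text \<open>Kuratowski pairs: \<open>p = {{x}, {x, y}}\<close>.\<close>

definition pair_in :: "'v::set_universe set \<Rightarrow> 'v \<Rightarrow> 'v \<Rightarrow> 'v \<Rightarrow> bool" where
  "pair_in M x y p \<longleftrightarrow>
     (\<exists>u\<in>M. \<exists>v\<in>M. upair_in M x x u \<and> upair_in M x y v \<and> upair_in M u v p)"

text \<open>\<open>app_in M f x y\<close> says that \<open>f\<close>, viewed as a set of ordered pairs, relates \<open>x\<close> to \<open>y\<close>.\<close>

definition app_in :: "'v::set_universe set \<Rightarrow> 'v \<Rightarrow> 'v \<Rightarrow> 'v \<Rightarrow> bool" where
  "app_in M f x y \<longleftrightarrow> (\<exists>p\<in>M. p \<in> elts f \<and> pair_in M x y p)"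

definition function_in :: "'v::set_universe set \<Rightarrow> 'v \<Rightarrow> 'v \<Rightarrow> 'v \<Rightarrow> bool" where
  "function_in M f a b \<longleftrightarrow>
     (\<forall>p\<in>M. p \<in> elts f \<longrightarrow> (\<exists>x\<in>M. \<exists>y\<in>M. x \<in> elts a \<and> y \<in> elts b \<and> pair_in M x y p)) \<and>
     (\<forall>x\<in>M. x \<in> elts a \<longrightarrow> (\<exists>!y. y \<in> M \<and> app_in M f x y))"


subsection \<open>Models of ZFC\<close>

definition Extensionality_in :: "'v::set_universe set \<Rightarrow> bool" where
  "Extensionality_in M \<longleftrightarrow>
     (\<forall>x\<in>M. \<forall>y\<in>M. (\<forall>z\<in>M. z \<in> elts x \<longleftrightarrow> z \<in> elts y) \<longrightarrow> x = y)"

definition Foundation_in :: "'v::set_universe set \<Rightarrow> bool" where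
  "Foundation_in M \<longleftrightarrow>
     (\<forall>x\<in>M. (\<exists>y\<in>M. y \<in> elts x) \<longrightarrow>
        (\<exists>y\<in>M. y \<in> elts x \<and> \<not> (\<exists>z\<in>M. z \<in> elts x \<and> z \<in> elts y)))"

definition Pairing_in :: "'v::set_universe set \<Rightarrow> bool" where
  "Pairing_in M \<longleftrightarrow> (\<forall>x\<in>M. \<forall>y\<in>M. \<exists>p\<in>M. upair_in M x y p)"

definition Union_in :: "'v::set_universe set \<Rightarrow> bool" where
  "Union_in M \<longleftrightarrow>
     (\<forall>x\<in>M. \<exists>u\<in>M. \<forall>z\<in>M. z \<in> elts u \<longleftrightarrow> (\<exists>y\<in>M. y \<in> elts x \<and> z \<in> elts y))"

definition Power_Set_in :: "'v::set_universe set \<Rightarrow> bool" where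
  "Power_Set_in M \<longleftrightarrow>
     (\<forall>x\<in>M. \<exists>p\<in>M. \<forall>z\<in>M. z \<in> elts p \<longleftrightarrow> (\<forall>w\<in>M. w \<in> elts z \<longrightarrow> w \<in> elts x))"

definition Infinity_in :: "'v::set_universe set \<Rightarrow> bool" where
  "Infinity_in M \<longleftrightarrow>
     (\<exists>x\<in>M. (\<exists>e\<in>M. e \<in> elts x \<and> (\<forall>z\<in>M. z \<notin> elts e)) \<and>
        (\<forall>y\<in>M. y \<in> elts x \<longrightarrow>
           (\<exists>s\<in>M. s \<in> elts x \<and> (\<forall>z\<in>M. z \<in> elts s \<longleftrightarrow> z \<in> elts y \<or> z = y))))"

text \<open>
  In the two schemas the assignment \<open>s\<close> supplies the parameters of \<open>\<phi>\<close>; the variables 0 and 1 are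
  the distinguished ones.
\<close>

definition Separation_in :: "'v::set_universe set \<Rightarrow> bool" where
  "Separation_in M \<longleftrightarrow>
     (\<forall>\<phi> s. range s \<subseteq> M \<longrightarrow>
        (\<forall>a\<in>M. \<exists>b\<in>M. \<forall>x\<in>M. x \<in> elts b \<longleftrightarrow> x \<in> elts a \<and> sat M (s(0 := x)) \<phi>))"

definition Replacement_in :: "'v::set_universe set \<Rightarrow> bool" where
  "Replacement_in M \<longleftrightarrow>
     (\<forall>\<phi> s. range s \<subseteq> M \<longrightarrow>
        (\<forall>a\<in>M. (\<forall>x\<in>M. x \<in> elts a \<longrightarrow> (\<exists>!y. y \<in> M \<and> sat M (s(0 := x, 1 := y)) \<phi>)) \<longrightarrow>
           (\<exists>b\<in>M. \<forall>y\<in>M. y \<in> elts b \<longleftrightarrow>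
              (\<exists>x\<in>M. x \<in> elts a \<and> sat M (s(0 := x, 1 := y)) \<phi>))))"

definition Choice_in :: "'v::set_universe set \<Rightarrow> bool" where
  "Choice_in M \<longleftrightarrow>
     (\<forall>a\<in>M. (\<forall>x\<in>M. x \<in> elts a \<longrightarrow> (\<exists>y\<in>M. y \<in> elts x)) \<longrightarrow>
        (\<exists>f\<in>M. \<exists>b\<in>M. function_in M f a b \<and>
           (\<forall>x\<in>M. x \<in> elts a \<longrightarrow> (\<exists>y\<in>M. y \<in> elts x \<and> app_in M f x y))))"

definition models_ZFC :: "'v::set_universe set \<Rightarrow> bool" where
  "models_ZFC M \<longleftrightarrow>
     Extensionality_in M \<and> Foundation_in M \<and> Pairing_in M \<and> Union_in M \<and> Power_Set_in M \<and>
     Infinity_in M \<and> Separation_in M \<and> Replacement_in M \<and> Choice_in M"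


subsection \<open>Regularity, critical points, cofinality\<close>

text \<open>
  Regularity and singularity are notions for limit ordinals, which in the singular case need not be
  cardinals. Being a limit ordinal is absolute for transitive classes, so only the function
  quantifier has to be relativized in an essential way.
\<close>

definition cofinal_map_in :: "'v::set_universe set \<Rightarrow> 'v \<Rightarrow> 'v \<Rightarrow> 'v \<Rightarrow> bool" where
  "cofinal_map_in M f \<beta> \<alpha> \<longleftrightarrow> function_in M f \<beta> \<alpha> \<and>
     (\<forall>\<gamma>\<in>elts \<alpha>. \<exists>\<xi>\<in>elts \<beta>. \<exists>\<eta>\<in>elts \<alpha>. app_in M f \<xi> \<eta> \<and> (\<gamma> = \<eta> \<or> \<gamma> \<in> elts \<eta>))"

definition regular_in :: "'v::set_universe set \<Rightarrow> 'v \<Rightarrow> bool" where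
  "regular_in M \<alpha> \<longleftrightarrow> \<alpha> \<in> M \<and> Limit \<alpha> \<and> \<not> (\<exists>\<beta>\<in>elts \<alpha>. \<exists>f\<in>M. cofinal_map_in M f \<beta> \<alpha>)"

definition singular_in :: "'v::set_universe set \<Rightarrow> 'v \<Rightarrow> bool" where
  "singular_in M \<alpha> \<longleftrightarrow> \<alpha> \<in> M \<and> Limit \<alpha> \<and> (\<exists>\<beta>\<in>elts \<alpha>. \<exists>f\<in>M. cofinal_map_in M f \<beta> \<alpha>)"

text \<open>An embedding is represented by a total function whose values outside \<open>M\<close> are irrelevant.\<close>

definition nontrivial_on :: "'v set \<Rightarrow> ('v \<Rightarrow> 'v) \<Rightarrow> bool" where
  "nontrivial_on M j \<longleftrightarrow> (\<exists>x\<in>M. j x \<noteq> x)"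

definition crit :: "'v::set_universe set \<Rightarrow> ('v \<Rightarrow> 'v) \<Rightarrow> 'v" where
  "crit M j = (THE \<kappa>. \<kappa> \<in> ordinals_of M \<and> j \<kappa> \<noteq> \<kappa> \<and> (\<forall>\<beta>\<in>elts \<kappa>. j \<beta> = \<beta>))"

definition cofinal_sequence :: "(nat \<Rightarrow> 'v::set_universe) \<Rightarrow> 'v set \<Rightarrow> bool" where
  "cofinal_sequence c \<Omega> \<longleftrightarrow> range c \<subseteq> \<Omega> \<and> (\<forall>\<alpha>\<in>\<Omega>. \<exists>n. \<alpha> = c n \<or> \<alpha> \<in> elts (c n))"

end

theory Submission
  imports Defs
begin

text \<open>
  Woodin's proof of Kunen's theorem, adapted to two models. Suppose that (1), (2) and (3) all fail, and
  let \<open>\<lambda>\<close> be the supremum of the critical sequence. By the failure of (2), \<open>N\<close> contains the restrictions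
  of \<open>j\<close> to ordinals, hence it sees that \<open>\<lambda>\<close> has cofinality \<open>\<omega>\<close>; by the failure of (3) an ordinal of
  cofinality \<open>\<omega>\<close> in \<open>N\<close> has cofinality \<open>\<omega>\<close> in \<open>M\<close>, so that \<open>j\<close> is continuous there. In particular \<open>j\<close>
  fixes \<open>\<lambda>\<close>, and, again by the failure of (3), the least \<open>M\<close>-regular \<open>\<theta> > \<lambda>\<close>. Choose in \<open>M\<close> a ladder
  \<open>a \<xi> : \<omega> \<rightarrow> \<xi>\<close> for all \<open>\<xi> < \<theta>\<close> of cofinality \<open>\<omega>\<close>, and let \<open>S\<close> be the set of those \<open>\<gamma> < \<theta>\<close> that lie on the ladders of
  stationarily many \<open>\<xi>\<close>. A pressing-down argument shows that \<open>S\<close> is unbounded in \<open>\<theta>\<close>, so there is in \<open>M\<close> an injection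
  of \<open>\<kappa>\<close> into \<open>S\<close>. On the other hand, every \<open>\<gamma> \<in> j S\<close> lies on the ladder \<open>j a \<xi>\<close> of some \<open>\<xi>\<close> closed
  under \<open>j\<close>; then \<open>j \<xi> = \<xi>\<close>, and \<open>\<gamma>\<close> is in the range of \<open>j\<close>. Hence \<open>j S = j[S]\<close>, which applied to the value
  at \<open>\<kappa>\<close> of the image of the injection makes \<open>\<kappa>\<close> a value of \<open>j\<close> on \<open>\<kappa>\<close>, where \<open>j\<close> is the identity.
\<close>

section \<open>Definable predicates\<close>

text \<open>The obstacle is that \<open>M\<close> and \<open>N\<close> are only known to share their
  ordinals: neither need contain the other, and \<open>j\<close> need not be definable in either. A
  set of \<open>M\<close> is therefore used in \<open>N\<close> through its image under
  \<open>j\<close>, and a function of \<open>M\<close> between ordinals is rebuilt in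
  \<open>N\<close> from its image and from restrictions of \<open>j\<close>
  (\<open>ordinal_function_in_N\<close>). Cofinality \<omega> lets \<open>j\<close> act on a ladder
  rung by rung: \<open>j\<close> fixes every natural number, so at a fixed point \<xi> the ladder
  \<open>j a \<xi>\<close> consists of the values of \<open>j\<close> on the ladder
  \<open>a \<xi>\<close>. The set \<open>S\<close> takes the place of a partition of a stationary
  set into \<kappa> pieces: it is one set defined from the ladder system, and only its size enters.
  The ordinal \<theta> is a least regular ordinal rather than a successor cardinal, because
  regularity is the property that passes from \<open>M\<close> to \<open>N\<close>; the same
  property that defines \<theta> then shows that \<open>j\<close> fixes it.\<close>

primrec fv :: "fm \<Rightarrow> nat set" where
  "fv (Mem m n) = {m, n}"
| "fv (Equal m n) = {m, n}"
| "fv (Neg \<phi>) = fv \<phi>"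
| "fv (Conj \<phi> \<psi>) = fv \<phi> \<union> fv \<psi>"
| "fv (Forall n \<phi>) = fv \<phi> - {n}"

lemma finite_fv: "finite (fv \<phi>)"
  by (induction \<phi>) auto

lemma sat_cong: "(\<And>n. n \<in> fv \<phi> \<Longrightarrow> s n = t n) \<Longrightarrow> sat M s \<phi> = sat M t \<phi>"
proof (induction \<phi> arbitrary: s t)
  case (Forall n \<phi>)
  have "sat M (s(n := a)) \<phi> = sat M (t(n := a)) \<phi>" for a
    by (rule Forall.IH) (use Forall.prems in auto)
  then show ?case by simp
next
  case (Neg \<phi>)
  have "sat M s \<phi> = sat M t \<phi>" by (rule Neg.IH) (use Neg.prems in auto)
  then show ?case by simp
next
  case (Conj \<phi> \<psi>)
  have "sat M s \<phi> = sat M t \<phi>" "sat M s \<psi> = sat M t \<psi>"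
    by (rule Conj.IH; use Conj.prems in auto)+
  then show ?case by simp
qed auto

text \<open>The index map \<open>f\<close> may identify indices. A quantified index is sent to one
  outside the image of the free variables, so no renamed variable is captured.\<close>

lemma sat_rename: "\<exists>\<psi>. \<forall>(M::'v::set_universe set) s. sat M s \<psi> = sat M (\<lambda>n. s (f n)) \<phi>"
proof (induction \<phi> arbitrary: f)
  case (Mem m n)
  show ?case by (rule exI[of _ "Mem (f m) (f n)"]) simp
next
  case (Equal m n)
  show ?case by (rule exI[of _ "Equal (f m) (f n)"]) simp
next
  case (Neg \<phi>)
  then obtain \<psi> where "\<forall>(M::'v::set_universe set) s. sat M s \<psi> = sat M (\<lambda>n. s (f n)) \<phi>" by blast
  then show ?case by (intro exI[of _ "Neg \<psi>"]) simp
next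
  case (Conj \<phi>1 \<phi>2)
  obtain \<psi>1 where "\<forall>(M::'v::set_universe set) s. sat M s \<psi>1 = sat M (\<lambda>n. s (f n)) \<phi>1"
    using Conj.IH(1)[of f] by blast
  moreover obtain \<psi>2 where "\<forall>(M::'v::set_universe set) s. sat M s \<psi>2 = sat M (\<lambda>n. s (f n)) \<phi>2"
    using Conj.IH(2)[of f] by blast
  ultimately show ?case by (intro exI[of _ "Conj \<psi>1 \<psi>2"]) simp
next
  case (Forall m \<phi>)
  obtain k where k: "k \<notin> f ` fv \<phi>"
    using ex_new_if_finite[of "f ` fv \<phi>"] finite_fv by auto
  obtain \<psi> where \<psi>: "\<forall>(M::'v::set_universe set) s. sat M s \<psi> = sat M (\<lambda>n. s ((f(m := k)) n)) \<phi>"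
    using Forall.IH[of "f(m := k)"] by blast
  have "sat M (s(k := a)) \<psi> = sat M ((\<lambda>n. s (f n))(m := a)) \<phi>" for M :: "'v set" and s a
    unfolding \<psi>[rule_format] by (rule sat_cong) (use k in auto)
  then show ?case by (intro exI[of _ "Forall k \<psi>"]) simp
qed

text \<open>\<open>Forall\<close> binds a named variable. To bind index 0 while the other indices
  are rerouted by \<open>g\<close>, index 0 is sent to a name that no rerouted free variable
  uses.\<close>

lemma sat_quantify:
  "\<exists>\<psi>. \<forall>(M::'v::set_universe set) s. sat M s \<psi> = (\<forall>x\<in>M. sat M (\<lambda>n. if n = 0 then x else s (g n)) \<phi>)"
proof -
  obtain k where k: "k \<notin> g ` fv \<phi>"
    using ex_new_if_finite[of "g ` fv \<phi>"] finite_fv by auto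
  obtain \<psi> where \<psi>: "\<forall>(M::'v::set_universe set) s. sat M s \<psi> = sat M (\<lambda>n. s ((g(0 := k)) n)) \<phi>"
    using sat_rename[of "g(0 := k)" \<phi>] by blast
  have "sat M (s(k := a)) \<psi> = sat M (\<lambda>n. if n = 0 then a else s (g n)) \<phi>" for M :: "'v set" and s a
    unfolding \<psi>[rule_format] by (rule sat_cong) (use k in auto)
  then show ?thesis by (intro exI[of _ "Forall k \<psi>"]) simp
qed

text \<open>Variables occupy the even positions and parameters the odd ones, so a formula may use
  any number of parameters without a bound on its variables being fixed in advance.\<close>

definition mix :: "(nat \<Rightarrow> 'a) \<Rightarrow> (nat \<Rightarrow> 'a) \<Rightarrow> nat \<Rightarrow> 'a" where
  "mix s p n = (if even n then s (n div 2) else p (n div 2))"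

definition transitive_model :: "'v::set_universe set \<Rightarrow> bool" where
  "transitive_model M \<longleftrightarrow> transitive_class M \<and> models_ZFC M"

text \<open>
  Definability is uniform over a family of models: a single formula works for all indices \<open>i\<close>, and a
  constant \<open>c \<in> C\<close> names the parameter \<open>c i\<close> in the model \<open>Mod i\<close>. A one-element family yields the
  instances of separation and replacement, the family \<open>M, N\<close> with the constants \<open>x, j x\<close> yields
  elementarity. Variables are de Bruijn indices.
\<close>

locale models =
  fixes Mod :: "'i \<Rightarrow> 'v::set_universe set" and C :: "('i \<Rightarrow> 'v) set"
  assumes model: "transitive_model (Mod i)"
    and C_in: "c \<in> C \<Longrightarrow> c i \<in> Mod i"
    and C_nonempty: "C \<noteq> {}"
begin

definition dfb :: "('i \<Rightarrow> (nat \<Rightarrow> 'v) \<Rightarrow> bool) \<Rightarrow> bool" where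
  "dfb P \<longleftrightarrow> (\<exists>\<phi> p. (\<forall>n. p n \<in> C) \<and>
     (\<forall>i s. range s \<subseteq> Mod i \<longrightarrow> P i s = sat (Mod i) (mix s (\<lambda>n. p n i)) \<phi>))"

text \<open>The language has no function symbols, so a term is a definable graph. That its values
  stay in the model is what allows \<open>dfb_subst\<close> to eliminate it by an existential
  quantifier over the model.\<close>

definition tm :: "('i \<Rightarrow> (nat \<Rightarrow> 'v) \<Rightarrow> 'v) \<Rightarrow> bool" where
  "tm t \<longleftrightarrow> (\<forall>i s. range s \<subseteq> Mod i \<longrightarrow> t i s \<in> Mod i) \<and> dfb (\<lambda>i s. s 0 = t i (\<lambda>n. s (Suc n)))"

lemma dfb_cong:
  assumes "dfb P" "\<And>i s. range s \<subseteq> Mod i \<Longrightarrow> Q i s = P i s"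
  shows "dfb Q"
proof -
  obtain \<phi> p where p: "\<forall>n. p n \<in> C"
    and \<phi>: "\<And>i s. range s \<subseteq> Mod i \<Longrightarrow> P i s = sat (Mod i) (mix s (\<lambda>n. p n i)) \<phi>"
    using assms(1) unfolding dfb_def by blast
  have "\<forall>i s. range s \<subseteq> Mod i \<longrightarrow> Q i s = sat (Mod i) (mix s (\<lambda>n. p n i)) \<phi>"
    using assms(2) \<phi> by simp
  then show ?thesis unfolding dfb_def using p by blast
qed

lemma dfb_rename:
  assumes "dfb P"
  shows "dfb (\<lambda>i s. P i (\<lambda>n. s (f n)))"
proof -
  obtain \<phi> p where p: "\<forall>n. p n \<in> C"
    and \<phi>: "\<And>i s. range s \<subseteq> Mod i \<Longrightarrow> P i s = sat (Mod i) (mix s (\<lambda>n. p n i)) \<phi>"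
    using assms unfolding dfb_def by blast
  obtain \<psi> where \<psi>: "\<forall>(M::'v set) s. sat M s \<psi> = sat M (\<lambda>n. s (if even n then 2 * f (n div 2) else n)) \<phi>"
    using sat_rename[of "\<lambda>n. if even n then 2 * f (n div 2) else n" \<phi>] by blast
  have "mix (\<lambda>n. s (f n)) q = (\<lambda>n. mix s q (if even n then 2 * f (n div 2) else n))"
    for s q :: "nat \<Rightarrow> 'v"
    by (auto simp: mix_def fun_eq_iff)
  then have "P i (\<lambda>n. s (f n)) = sat (Mod i) (mix s (\<lambda>n. p n i)) \<psi>" if "range s \<subseteq> Mod i" for i s
    using \<phi>[of "\<lambda>n. s (f n)" i] \<psi> that by (simp add: image_subset_iff)
  then show ?thesis unfolding dfb_def using p by blast
qed

lemma dfb_var_mem: "dfb (\<lambda>i s. s m \<in> elts (s n))"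
proof -
  obtain c where "c \<in> C" using C_nonempty by blast
  then show ?thesis
    unfolding dfb_def by (intro exI[of _ "Mem (2 * m) (2 * n)"] exI[of _ "\<lambda>_. c"]) (simp add: mix_def)
qed

lemma dfb_var_eq: "dfb (\<lambda>i s. s m = s n)"
proof -
  obtain c where "c \<in> C" using C_nonempty by blast
  then show ?thesis
    unfolding dfb_def by (intro exI[of _ "Equal (2 * m) (2 * n)"] exI[of _ "\<lambda>_. c"]) (simp add: mix_def)
qed

lemma dfb_const_eq: "c \<in> C \<Longrightarrow> dfb (\<lambda>i s. s 0 = c i)"
  unfolding dfb_def by (intro exI[of _ "Equal 0 1"] exI[of _ "\<lambda>_. c"]) (simp add: mix_def)

lemma dfb_not: "dfb P \<Longrightarrow> dfb (\<lambda>i s. \<not> P i s)"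
  unfolding dfb_def
proof (elim exE conjE)
  fix \<phi> p
  assume "\<forall>n. p n \<in> C"
    and "\<forall>i s. range s \<subseteq> Mod i \<longrightarrow> P i s = sat (Mod i) (mix s (\<lambda>n. p n i)) \<phi>"
  then show "\<exists>\<phi> p. (\<forall>n. p n \<in> C) \<and>
     (\<forall>i s. range s \<subseteq> Mod i \<longrightarrow> (\<not> P i s) = sat (Mod i) (mix s (\<lambda>n. p n i)) \<phi>)"
    by (intro exI[of _ "Neg \<phi>"] exI[of _ p]) simp
qed

lemma dfb_conj:
  fixes P Q :: "'i \<Rightarrow> (nat \<Rightarrow> 'v) \<Rightarrow> bool"
  assumes "dfb P" "dfb Q"
  shows "dfb (\<lambda>i s. P i s \<and> Q i s)"
proof -
  obtain \<phi> p where p: "\<forall>n. p n \<in> C"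
    and \<phi>: "\<And>i s. range s \<subseteq> Mod i \<Longrightarrow> P i s = sat (Mod i) (mix s (\<lambda>n. p n i)) \<phi>"
    using assms(1) unfolding dfb_def by blast
  obtain \<psi> q where q: "\<forall>n. q n \<in> C"
    and \<psi>: "\<And>i s. range s \<subseteq> Mod i \<Longrightarrow> Q i s = sat (Mod i) (mix s (\<lambda>n. q n i)) \<psi>"
    using assms(2) unfolding dfb_def by blast
  \<comment> \<open>The two parameter lists are interleaved into one. Odd position 2k+1 is sent to
    the odd position holding entry 2k of the merged list for \<open>p\<close>, and entry 2k+1 for
    \<open>q\<close>; variables stay put.\<close>
  let ?f = "\<lambda>n::nat. if even n then n else 2 * (2 * (n div 2)) + 1"
  let ?g = "\<lambda>n::nat. if even n then n else 2 * (2 * (n div 2) + 1) + 1"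
  let ?r = "mix p q"
  obtain \<phi>' where \<phi>': "\<forall>(M::'v set) s. sat M s \<phi>' = sat M (\<lambda>n. s (?f n)) \<phi>" using sat_rename[of ?f \<phi>] by blast
  obtain \<psi>' where \<psi>': "\<forall>(M::'v set) s. sat M s \<psi>' = sat M (\<lambda>n. s (?g n)) \<psi>" using sat_rename[of ?g \<psi>] by blast
  have f: "mix s (\<lambda>n. p n i) = (\<lambda>n. mix s (\<lambda>n. ?r n i) (?f n))" for s i
    by (auto simp: mix_def fun_eq_iff elim!: oddE)
  have g: "mix s (\<lambda>n. q n i) = (\<lambda>n. mix s (\<lambda>n. ?r n i) (?g n))" for s i
    by (auto simp: mix_def fun_eq_iff elim!: oddE)
  show ?thesis
    unfolding dfb_def
  proof (intro exI[of _ "Conj \<phi>' \<psi>'"] exI[of _ ?r] conjI allI impI)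
    show "?r n \<in> C" for n using p q by (simp add: mix_def)
    fix i and s :: "nat \<Rightarrow> 'v" assume s: "range s \<subseteq> Mod i"
    show "(P i s \<and> Q i s) = sat (Mod i) (mix s (\<lambda>n. ?r n i)) (Conj \<phi>' \<psi>')"
      unfolding sat.simps \<phi>'[rule_format] \<psi>'[rule_format] f[symmetric] g[symmetric]
      using \<phi>[OF s] \<psi>[OF s] by simp
  qed
qed

lemma dfb_disj:
  assumes "dfb P" "dfb Q"
  shows "dfb (\<lambda>i s. P i s \<or> Q i s)"
  by (rule dfb_cong[OF dfb_not[OF dfb_conj[OF dfb_not[OF assms(1)] dfb_not[OF assms(2)]]]]) simp

lemma dfb_imp:
  assumes "dfb P" "dfb Q"
  shows "dfb (\<lambda>i s. P i s \<longrightarrow> Q i s)"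
  by (rule dfb_cong[OF dfb_disj[OF dfb_not[OF assms(1)] assms(2)]]) blast

lemma dfb_iff:
  assumes "dfb P" "dfb Q"
  shows "dfb (\<lambda>i s. P i s \<longleftrightarrow> Q i s)"
  by (rule dfb_cong[OF dfb_conj[OF dfb_imp[OF assms] dfb_imp[OF assms(2,1)]]]) blast

lemma dfb_ball:
  assumes "dfb (\<lambda>i s. P i (s 0) (\<lambda>n. s (Suc n)))"
  shows "dfb (\<lambda>i s. \<forall>x\<in>Mod i. P i x s)"
proof -
  obtain \<phi> p where p: "\<forall>n. p n \<in> C"
    and \<phi>: "\<And>i s. range s \<subseteq> Mod i \<Longrightarrow>
      P i (s 0) (\<lambda>n. s (Suc n)) = sat (Mod i) (mix s (\<lambda>n. p n i)) \<phi>"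
    using assms unfolding dfb_def by blast
  \<comment> \<open>A new variable at index 0 shifts the others by one, hence by two among the even
    positions. The truncated subtraction at position 0 does no harm, since that position is
    rebound.\<close>
  let ?g = "\<lambda>n::nat. if even n then n - 2 else n"
  obtain \<psi> where \<psi>:
    "\<forall>(M::'v set) s. sat M s \<psi> = (\<forall>x\<in>M. sat M (\<lambda>n. if n = 0 then x else s (?g n)) \<phi>)"
    using sat_quantify[of ?g \<phi>] by blast
  have mix: "mix (case_nat x s) q = (\<lambda>n. if n = 0 then x else mix s q (?g n))"
    for x :: 'v and s q
  proof
    fix n :: nat
    show "mix (case_nat x s) q n = (if n = 0 then x else mix s q (?g n))"
    proof (cases "n = 0 \<or> odd n")
      case True then show ?thesis by (auto simp: mix_def)
    next
      case False
      then obtain k where "n = 2 * Suc k" by (metis evenE not0_implies_Suc mult_0_right)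
      then show ?thesis by (simp add: mix_def)
    qed
  qed
  have "(\<forall>x\<in>Mod i. P i x s) = sat (Mod i) (mix s (\<lambda>n. p n i)) \<psi>" if "range s \<subseteq> Mod i" for i s
  proof -
    have "P i x s = sat (Mod i) (mix (case_nat x s) (\<lambda>n. p n i)) \<phi>" if "x \<in> Mod i" for x
    proof -
      have "range (case_nat x s) \<subseteq> Mod i"
        using \<open>range s \<subseteq> Mod i\<close> \<open>x \<in> Mod i\<close> by (simp add: image_subset_iff split: nat.splits)
      from \<phi>[OF this] show ?thesis by simp
    qed
    then show ?thesis unfolding \<psi>[rule_format] mix by simp
  qed
  then show ?thesis unfolding dfb_def using p by blast
qed

lemma dfb_bex:
  assumes "dfb (\<lambda>i s. P i (s 0) (\<lambda>n. s (Suc n)))"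
  shows "dfb (\<lambda>i s. \<exists>x\<in>Mod i. P i x s)"
  by (rule dfb_cong[OF dfb_not[OF dfb_ball[OF dfb_not[OF assms]]]]) blast

lemma tm_in: "tm t \<Longrightarrow> range s \<subseteq> Mod i \<Longrightarrow> t i s \<in> Mod i"
  by (simp add: tm_def)

lemma dfb_subst:
  assumes "tm t" "dfb (\<lambda>i s. P i (s 0) (\<lambda>n. s (Suc n)))"
  shows "dfb (\<lambda>i s. P i (t i s) s)"
proof (rule dfb_cong[OF dfb_bex])
  show "dfb (\<lambda>i s. s 0 = t i (\<lambda>n. s (Suc n)) \<and> P i (s 0) (\<lambda>n. s (Suc n)))"
    using assms(1) unfolding tm_def by (intro dfb_conj[OF _ assms(2)]) simp
  show "P i (t i s) s \<longleftrightarrow> (\<exists>x\<in>Mod i. x = t i s \<and> P i x s)" if "range s \<subseteq> Mod i" for i s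
    using tm_in[OF assms(1) that] by blast
qed

lemma tm_shift: "tm t \<Longrightarrow> tm (\<lambda>i s. t i (\<lambda>n. s (f n)))"
  unfolding tm_def
proof (intro conjI allI impI; elim conjE)
  fix i and s :: "nat \<Rightarrow> 'v"
  assume "\<forall>i s. range s \<subseteq> Mod i \<longrightarrow> t i s \<in> Mod i" "range s \<subseteq> Mod i"
  then show "t i (\<lambda>n. s (f n)) \<in> Mod i" by (simp add: image_subset_iff)
next
  assume "dfb (\<lambda>i s. s 0 = t i (\<lambda>n. s (Suc n)))"
  from dfb_rename[OF this, of "case_nat 0 (\<lambda>n. Suc (f n))"]
  show "dfb (\<lambda>i s. s 0 = t i (\<lambda>n. s (Suc (f n))))" by simp
qed

lemma dfb_rel1:
  assumes "dfb (\<lambda>i s. P i (s 0))" "tm t"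
  shows "dfb (\<lambda>i s. P i (t i s))"
  by (rule dfb_subst[OF assms(2)]) (fact assms(1))

lemma dfb_rel2:
  assumes "dfb (\<lambda>i s. P i (s 0) (s 1))" "tm t" "tm u"
  shows "dfb (\<lambda>i s. P i (t i s) (u i s))"
proof (rule dfb_subst[OF assms(2)], rule dfb_subst[OF tm_shift[OF assms(3)]])
  show "dfb (\<lambda>i s. P i (s (Suc 0)) (s 0))"
    \<comment> \<open>After both substitutions \<open>u\<close> has index 0 and \<open>t\<close> has
      index 1, so the arguments must be exchanged.\<close>
    using dfb_rename[OF assms(1), of "\<lambda>n. 1 - n"] by simp
qed

lemma dfb_rel3:
  assumes "dfb (\<lambda>i s. P i (s 0) (s 1) (s 2))" "tm t" "tm u" "tm v"
  shows "dfb (\<lambda>i s. P i (t i s) (u i s) (v i s))"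
proof (rule dfb_subst[OF assms(2)], rule dfb_subst[OF tm_shift[OF assms(3)]],
    rule dfb_subst[OF tm_shift[OF tm_shift[OF assms(4)]]])
  show "dfb (\<lambda>i s. P i (s (Suc (Suc 0))) (s (Suc 0)) (s 0))"
    using dfb_rename[OF assms(1), of "\<lambda>n. 2 - n"] by (simp add: numeral_2_eq_2)
qed

lemma tm_var: "tm (\<lambda>i s. s n)"
  by (auto simp: tm_def intro: dfb_var_eq)

lemma tm_const: "c \<in> C \<Longrightarrow> tm (\<lambda>i s. c i)"
  by (auto simp: tm_def C_in intro: dfb_const_eq)

lemma dfb_mem: "tm t \<Longrightarrow> tm u \<Longrightarrow> dfb (\<lambda>i s. t i s \<in> elts (u i s))"
  by (rule dfb_rel2) (rule dfb_var_mem)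

lemma dfb_eq: "tm t \<Longrightarrow> tm u \<Longrightarrow> dfb (\<lambda>i s. t i s = u i s)"
  by (rule dfb_rel2) (rule dfb_var_eq)

lemma Mod_trans: "x \<in> Mod i \<Longrightarrow> y \<in> elts x \<Longrightarrow> y \<in> Mod i"
  using model[of i] by (auto simp: transitive_model_def transitive_class_def)

text \<open>Transitivity of the models turns a quantifier over the members of a set into one
  relativized to the model.\<close>

lemma dfb_ball_elts:
  assumes "tm t" "dfb (\<lambda>i s. P i (s 0) (\<lambda>n. s (Suc n)))"
  shows "dfb (\<lambda>i s. \<forall>x\<in>elts (t i s). P i x s)"
proof (rule dfb_cong[OF dfb_ball])
  show "dfb (\<lambda>i s. s 0 \<in> elts (t i (\<lambda>n. s (Suc n))) \<longrightarrow> P i (s 0) (\<lambda>n. s (Suc n)))"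
    by (rule dfb_imp[OF dfb_mem[OF tm_var tm_shift[OF assms(1)]] assms(2)])
  show "(\<forall>x\<in>elts (t i s). P i x s) \<longleftrightarrow> (\<forall>x\<in>Mod i. x \<in> elts (t i s) \<longrightarrow> P i x s)"
    if "range s \<subseteq> Mod i" for i s
    using tm_in[OF assms(1) that] Mod_trans by blast
qed

lemma dfb_bex_elts:
  assumes "tm t" "dfb (\<lambda>i s. P i (s 0) (\<lambda>n. s (Suc n)))"
  shows "dfb (\<lambda>i s. \<exists>x\<in>elts (t i s). P i x s)"
  by (rule dfb_cong[OF dfb_not[OF dfb_ball_elts[OF assms(1) dfb_not[OF assms(2)]]]]) blast

lemma tm_fun1:
  assumes "\<And>i x. x \<in> Mod i \<Longrightarrow> T x \<in> Mod i" "dfb (\<lambda>i s. s 0 = T (s 1))" "tm t"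
  shows "tm (\<lambda>i s. T (t i s))"
  unfolding tm_def
proof (intro conjI allI impI)
  show "T (t i s) \<in> Mod i" if "range s \<subseteq> Mod i" for i s
    using assms(1) tm_in[OF assms(3) that] by blast
  show "dfb (\<lambda>i s. s 0 = T (t i (\<lambda>n. s (Suc n))))"
    by (rule dfb_rel2[OF assms(2) tm_var tm_shift[OF assms(3)]])
qed

lemma tm_fun2:
  assumes "\<And>i x y. x \<in> Mod i \<Longrightarrow> y \<in> Mod i \<Longrightarrow> T x y \<in> Mod i"
    "dfb (\<lambda>i s. s 0 = T (s 1) (s 2))" "tm t" "tm u"
  shows "tm (\<lambda>i s. T (t i s) (u i s))"
  unfolding tm_def
proof (intro conjI allI impI)
  show "T (t i s) (u i s) \<in> Mod i" if "range s \<subseteq> Mod i" for i s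
    using assms(1) tm_in[OF assms(3) that] tm_in[OF assms(4) that] by blast
  show "dfb (\<lambda>i s. s 0 = T (t i (\<lambda>n. s (Suc n))) (u i (\<lambda>n. s (Suc n))))"
    by (rule dfb_rel3[OF assms(2) tm_var tm_shift[OF assms(3)] tm_shift[OF assms(4)]])
qed

lemmas dfb_intros = dfb_mem dfb_eq dfb_not dfb_conj dfb_disj dfb_imp dfb_iff dfb_ball dfb_bex
  dfb_ball_elts dfb_bex_elts tm_var tm_const

end

section \<open>Sets, ordinals and pairs\<close>

lemma elts_eqI: "(\<And>z. z \<in> elts x \<longleftrightarrow> z \<in> elts y) \<Longrightarrow> x = y" for x y :: "'v::set_universe"
  by (rule elts_inject) blast

lemma elts_eq_iff: "elts x = elts y \<longleftrightarrow> x = y" for x y :: "'v::set_universe"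
  using elts_inject by metis

lemma elts_induct [case_names step]:
  "(\<And>x. (\<And>y. y \<in> elts x \<Longrightarrow> P y) \<Longrightarrow> P x) \<Longrightarrow> P x" for x :: "'v::set_universe"
  by (rule wf_induct_rule[OF wf_elts]) simp

lemma elts_minimal:
  fixes x :: "'v::set_universe"
  assumes "P x"
  obtains y where "P y" "\<And>z. z \<in> elts y \<Longrightarrow> \<not> P z"
  using assms elts_induct[of "\<lambda>x. \<not> P x" x] by blast

lemma mem_irrefl: "x \<notin> elts x" for x :: "'v::set_universe"
  by (induction x rule: elts_induct) blast

lemma mem_asym: "x \<in> elts y \<Longrightarrow> y \<notin> elts x" for x y :: "'v::set_universe"
  by (induction x arbitrary: y rule: elts_induct) blast

lemma Ord_in: "Ord \<alpha> \<Longrightarrow> \<beta> \<in> elts \<alpha> \<Longrightarrow> Ord \<beta>"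
  unfolding Ord_def by blast

lemma Ord_trans: "Ord \<alpha> \<Longrightarrow> \<beta> \<in> elts \<alpha> \<Longrightarrow> \<gamma> \<in> elts \<beta> \<Longrightarrow> \<gamma> \<in> elts \<alpha>"
  unfolding Ord_def by blast

lemma OrdI: "(\<And>\<beta> \<gamma>. \<beta> \<in> elts \<alpha> \<Longrightarrow> \<gamma> \<in> elts \<beta> \<Longrightarrow> \<gamma> \<in> elts \<alpha>) \<Longrightarrow> (\<And>\<beta>. \<beta> \<in> elts \<alpha> \<Longrightarrow> Ord \<beta>) \<Longrightarrow> Ord \<alpha>"
  unfolding Ord_def by blast

text \<open>Nested membership induction: for a pair violating the claim, the induction hypotheses
  and transitivity give both ordinals the same elements.\<close>

lemma Ord_linear: "Ord \<alpha> \<Longrightarrow> Ord \<beta> \<Longrightarrow> \<alpha> \<in> elts \<beta> \<or> \<alpha> = \<beta> \<or> \<beta> \<in> elts \<alpha>"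
proof (induction \<alpha> arbitrary: \<beta> rule: elts_induct)
  case (step \<alpha>)
  note IH\<alpha> = step
  show ?case
    using \<open>Ord \<beta>\<close>
  proof (induction \<beta> rule: elts_induct)
    case (step \<beta>)
    show ?case
    proof (rule ccontr)
      assume neg: "\<not> ?thesis"
      have "\<gamma> \<in> elts \<beta>" if "\<gamma> \<in> elts \<alpha>" for \<gamma>
        using IH\<alpha>(1)[OF that Ord_in[OF IH\<alpha>(2) that] step.prems] neg that Ord_trans[OF IH\<alpha>(2) that]
        by blast
      moreover have "\<gamma> \<in> elts \<alpha>" if "\<gamma> \<in> elts \<beta>" for \<gamma>
        using step.IH[OF that Ord_in[OF step.prems that]] neg that Ord_trans[OF step.prems that]
        by blast
      ultimately have "\<alpha> = \<beta>" by (intro elts_eqI) blast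
      then show False using neg by blast
    qed
  qed
qed

lemma Ord_subset: "Ord \<alpha> \<Longrightarrow> Ord \<beta> \<Longrightarrow> elts \<alpha> \<subseteq> elts \<beta> \<Longrightarrow> \<alpha> \<in> elts \<beta> \<or> \<alpha> = \<beta>"
  using Ord_linear mem_irrefl by blast

text \<open>The last conclusion places the minimum at or below the given ordinal, hence inside every
  transitive class containing that ordinal.\<close>

lemma Ord_least:
  fixes \<alpha> :: "'v::set_universe"
  assumes "Ord \<alpha>" "P \<alpha>"
  obtains \<beta> where "Ord \<beta>" "P \<beta>" "\<And>\<gamma>. \<gamma> \<in> elts \<beta> \<Longrightarrow> \<not> P \<gamma>" "\<beta> = \<alpha> \<or> \<beta> \<in> elts \<alpha>"
proof (rule elts_minimal[of "\<lambda>\<beta>. Ord \<beta> \<and> P \<beta>" \<alpha>])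
  fix y assume y: "Ord y \<and> P y" and min: "\<And>z. z \<in> elts y \<Longrightarrow> \<not> (Ord z \<and> P z)"
  then have "y = \<alpha> \<or> y \<in> elts \<alpha>" using Ord_linear[of y \<alpha>] assms by blast
  then show thesis using that[of y] y min Ord_in by blast
qed (use assms in blast)

text \<open>Kuratowski pairs once more, with every quantifier bounded by a set. Unlike
  \<open>pair_in\<close> the notion mentions no model, so it is absolute between transitive
  ones.\<close>

definition is_pair :: "'v::set_universe \<Rightarrow> 'v \<Rightarrow> 'v \<Rightarrow> bool" where
  "is_pair p x y \<longleftrightarrow> (\<exists>u\<in>elts p. \<exists>v\<in>elts p. (\<forall>w\<in>elts p. w = u \<or> w = v) \<and>
     x \<in> elts u \<and> (\<forall>w\<in>elts u. w = x) \<and> x \<in> elts v \<and> y \<in> elts v \<and> (\<forall>w\<in>elts v. w = x \<or> w = y))"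

lemma is_pair_iff: "is_pair p x y \<longleftrightarrow> (\<exists>u v. elts p = {u, v} \<and> elts u = {x} \<and> elts v = {x, y})"
  (is "?l \<longleftrightarrow> ?r")
proof
  assume ?l
  then obtain u v where "u \<in> elts p" "v \<in> elts p" "\<forall>w\<in>elts p. w = u \<or> w = v"
     "x \<in> elts u" "\<forall>w\<in>elts u. w = x" "x \<in> elts v" "y \<in> elts v" "\<forall>w\<in>elts v. w = x \<or> w = y"
    unfolding is_pair_def by blast
  then have "elts p = {u, v} \<and> elts u = {x} \<and> elts v = {x, y}" by blast
  then show ?r by blast
qed (auto simp: is_pair_def)

lemma is_pair_inj:
  assumes "is_pair p x y" "is_pair p x' y'"
  shows "x = x' \<and> y = y'"
proof -
  have "elts ` elts p = {{x}, {x, y}}" "elts ` elts p = {{x'}, {x', y'}}"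
    using assms unfolding is_pair_iff by (metis image_empty image_insert)+
  then have "{{x}, {x, y}} = {{x'}, {x', y'}}" by simp
  then show ?thesis by (auto simp: doubleton_eq_iff)
qed

lemma is_pair_unique:
  assumes "is_pair p x y" "is_pair q x y"
  shows "p = q"
proof -
  obtain u v where p: "elts p = {u, v}" "elts u = {x}" "elts v = {x, y}"
    using assms unfolding is_pair_iff by blast
  obtain u' v' where q: "elts q = {u', v'}" "elts u' = {x}" "elts v' = {x, y}"
    using assms unfolding is_pair_iff by blast
  have "u = u'" "v = v'" using p q elts_inject by metis+
  then show ?thesis using p q elts_inject by metis
qed

text \<open>Where \<open>f\<close> is not single-valued, \<open>app\<close> takes a value that still lies in every model containing \<open>x\<close>.\<close>

definition app :: "'v::set_universe \<Rightarrow> 'v \<Rightarrow> 'v" where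
  "app f x = (if \<exists>!y. \<exists>p\<in>elts f. is_pair p x y then THE y. \<exists>p\<in>elts f. is_pair p x y else x)"

lemma app_eqI:
  assumes "p \<in> elts f" "is_pair p x y" "\<And>q z. q \<in> elts f \<Longrightarrow> is_pair q x z \<Longrightarrow> z = y"
  shows "app f x = y"
proof -
  have "\<exists>!y. \<exists>p\<in>elts f. is_pair p x y" using assms by blast
  moreover from this have "(THE y. \<exists>p\<in>elts f. is_pair p x y) = y"
    using assms by (intro the1_equality) blast+
  ultimately show ?thesis by (simp add: app_def)
qed

text \<open>The ambient universe has no closure conditions, so there may be no set with elements
  \<open>X\<close>; \<open>mk X\<close> is then arbitrary. It becomes meaningful through
  \<open>mk_eq\<close> once some model provides the set.\<close>

definition mk :: "'v::set_universe set \<Rightarrow> 'v" where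
  "mk X = (SOME x. elts x = X)"

lemma mk_eq: "elts x = X \<Longrightarrow> mk X = x"
  unfolding mk_def by (metis (mono_tags, lifting) elts_inject someI)

primrec nn :: "nat \<Rightarrow> 'v::set_universe" where
  "nn 0 = mk {}"
| "nn (Suc n) = mk (insert (nn n) (elts (nn n)))"

definition omega :: "'v::set_universe" where
  "omega = mk (range nn)"

text \<open>For an ordinal: zero or a successor. Emptiness is written with
  \<open>z \<noteq> z\<close> to stay within the forms covered by the definability rules.\<close>

definition zero_or_max :: "'v::set_universe \<Rightarrow> bool" where
  "zero_or_max n \<longleftrightarrow> (\<forall>z\<in>elts n. z \<noteq> z) \<or> (\<exists>k\<in>elts n. \<forall>z\<in>elts n. z \<in> elts k \<or> z = k)"

definition fin_ord :: "'v::set_universe \<Rightarrow> bool" where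
  "fin_ord n \<longleftrightarrow> Ord n \<and> zero_or_max n \<and> (\<forall>m\<in>elts n. zero_or_max m)"

text \<open>Domination is strict, and \<open>f\<close> enters only through the values of
  \<open>app\<close> on \<beta>; it need not be a function as a set of pairs. For limit ordinals
  \<open>cof_iff\<close> compares this with \<open>cofinal_map_in\<close>.\<close>

definition cof :: "'v::set_universe set \<Rightarrow> 'v \<Rightarrow> 'v \<Rightarrow> bool" where
  "cof M \<beta> \<alpha> \<longleftrightarrow> (\<exists>f\<in>M. (\<forall>x\<in>elts \<beta>. app f x \<in> elts \<alpha>) \<and>
     (\<forall>\<gamma>\<in>elts \<alpha>. \<exists>x\<in>elts \<beta>. \<gamma> \<in> elts (app f x)))"

section \<open>Transitive models of ZFC\<close>

locale tmodel =
  fixes M :: "'v::set_universe set"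
  assumes transitive_model: "transitive_model M"
begin

lemma ZFC: "models_ZFC M"
  using transitive_model by (simp add: transitive_model_def)

lemma M_trans: "x \<in> M \<Longrightarrow> y \<in> elts x \<Longrightarrow> y \<in> M"
  using transitive_model by (auto simp: transitive_model_def transitive_class_def)

lemma upair_in_iff: "p \<in> M \<Longrightarrow> x \<in> M \<Longrightarrow> y \<in> M \<Longrightarrow> upair_in M x y p \<longleftrightarrow> elts p = {x, y}"
  unfolding upair_in_def using M_trans by blast

lemma pairing: "x \<in> M \<Longrightarrow> y \<in> M \<Longrightarrow> \<exists>p\<in>M. elts p = {x, y}"
  using ZFC unfolding models_ZFC_def Pairing_in_def by (metis upair_in_iff)

lemma union:
  assumes "x \<in> M"
  shows "\<exists>u\<in>M. elts u = (\<Union>y\<in>elts x. elts y)"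
proof -
  obtain u where u: "u \<in> M" "\<forall>z\<in>M. z \<in> elts u \<longleftrightarrow> (\<exists>y\<in>M. y \<in> elts x \<and> z \<in> elts y)"
    using ZFC assms unfolding models_ZFC_def Union_in_def by blast
  then have "elts u = (\<Union>y\<in>elts x. elts y)" using M_trans assms by blast
  then show ?thesis using u by blast
qed

lemma power:
  assumes "x \<in> M"
  shows "\<exists>p\<in>M. elts p = {z \<in> M. elts z \<subseteq> elts x}"
proof -
  obtain u where u: "u \<in> M" "\<forall>z\<in>M. z \<in> elts u \<longleftrightarrow> (\<forall>w\<in>M. w \<in> elts z \<longrightarrow> w \<in> elts x)"
    using ZFC assms unfolding models_ZFC_def Power_Set_in_def by blast
  then have "elts u = {z \<in> M. elts z \<subseteq> elts x}" using M_trans assms by blast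
  then show ?thesis using u by blast
qed

lemma union2:
  assumes "x \<in> M" "y \<in> M"
  shows "\<exists>u\<in>M. elts u = elts x \<union> elts y"
proof -
  obtain p where "p \<in> M" "elts p = {x, y}" using pairing[OF assms] by blast
  then show ?thesis using union[of p] by auto
qed

lemma insert_ex:
  assumes "x \<in> M" "y \<in> M"
  shows "\<exists>u\<in>M. elts u = insert x (elts y)"
proof -
  obtain p where "p \<in> M" "elts p = {x, x}" using pairing[OF assms(1) assms(1)] by blast
  then show ?thesis using union2[of p y] assms by auto
qed

lemma infinity:
  obtains x e where "x \<in> M" "e \<in> elts x" "elts e = {}"
    "\<And>y. y \<in> elts x \<Longrightarrow> \<exists>s\<in>elts x. elts s = insert y (elts y)"
proof -
  have "Infinity_in M" using ZFC by (simp add: models_ZFC_def)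
  then obtain x where x: "x \<in> M" and inf: "(\<exists>e\<in>M. e \<in> elts x \<and> (\<forall>z\<in>M. z \<notin> elts e)) \<and>
    (\<forall>y\<in>M. y \<in> elts x \<longrightarrow> (\<exists>s\<in>M. s \<in> elts x \<and> (\<forall>z\<in>M. z \<in> elts s \<longleftrightarrow> z \<in> elts y \<or> z = y)))"
    unfolding Infinity_in_def by (rule bexE)
  from inf obtain e where e: "e \<in> M" "e \<in> elts x" "\<forall>z\<in>M. z \<notin> elts e" by blast
  have "elts e = {}" using e M_trans by blast
  moreover have "\<exists>s\<in>elts x. elts s = insert y (elts y)" if y: "y \<in> elts x" for y
  proof -
    have "y \<in> M" using M_trans[OF x y] .
    with inf y obtain s where s: "s \<in> M" "s \<in> elts x" "\<forall>z\<in>M. z \<in> elts s \<longleftrightarrow> z \<in> elts y \<or> z = y"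
      by blast
    have "z \<in> elts s \<longleftrightarrow> z \<in> insert y (elts y)" for z
      using s(3) M_trans[OF s(1)] M_trans[OF \<open>y \<in> M\<close>] \<open>y \<in> M\<close> by blast
    then show ?thesis using s(2) by blast
  qed
  ultimately show thesis by (rule that[OF x e(2)])
qed

lemma is_pair_ex:
  assumes "x \<in> M" "y \<in> M"
  shows "\<exists>p\<in>M. is_pair p x y"
proof -
  obtain u where u: "u \<in> M" "elts u = {x, x}" using pairing[OF assms(1) assms(1)] by blast
  obtain v where v: "v \<in> M" "elts v = {x, y}" using pairing[OF assms] by blast
  obtain p where p: "p \<in> M" "elts p = {u, v}" using pairing[OF u(1) v(1)] by blast
  have "is_pair p x y" using u(2) v(2) p(2) unfolding is_pair_iff by (intro exI[of _ u] exI[of _ v]) simp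
  then show ?thesis using p(1) by blast
qed

lemma is_pair_closed:
  assumes "p \<in> M" "is_pair p x y"
  shows "x \<in> M \<and> y \<in> M"
proof -
  obtain v where "v \<in> elts p" "x \<in> elts v" "y \<in> elts v"
    using assms(2) unfolding is_pair_def by blast
  then show ?thesis using M_trans[OF M_trans[OF assms(1)]] by blast
qed

lemma pair_in_iff:
  assumes "p \<in> M" "x \<in> M" "y \<in> M"
  shows "pair_in M x y p \<longleftrightarrow> is_pair p x y"
proof
  assume "pair_in M x y p"
  then obtain u v where uv: "u \<in> M" "v \<in> M" "upair_in M x x u" "upair_in M x y v" "upair_in M u v p"
    unfolding pair_in_def by blast
  then have "elts p = {u, v}" "elts u = {x, x}" "elts v = {x, y}"
    using upair_in_iff assms by simp_all
  then show "is_pair p x y" unfolding is_pair_iff by (intro exI[of _ u] exI[of _ v]) simp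
next
  assume "is_pair p x y"
  then obtain u v where uv: "elts p = {u, v}" "elts u = {x}" "elts v = {x, y}"
    unfolding is_pair_iff by blast
  have "u \<in> M" "v \<in> M" using M_trans[OF assms(1)] uv(1) by simp_all
  with uv assms show "pair_in M x y p"
    unfolding pair_in_def by (intro bexI[of _ u] bexI[of _ v]) (simp_all add: upair_in_iff)
qed

lemma app_in_iff:
  assumes "f \<in> M" "x \<in> M" "y \<in> M"
  shows "app_in M f x y \<longleftrightarrow> (\<exists>p\<in>elts f. is_pair p x y)"
  unfolding app_in_def using pair_in_iff[OF _ assms(2,3)] M_trans[OF assms(1)] by blast

lemma app_closed:
  assumes "f \<in> M" "x \<in> M"
  shows "app f x \<in> M"
proof (cases "\<exists>!y. \<exists>p\<in>elts f. is_pair p x y")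
  case True
  then obtain y p where y: "p \<in> elts f" "is_pair p x y" by blast
  then have "y \<in> M" using is_pair_closed[OF M_trans[OF assms(1)]] by blast
  moreover have "app f x = y" using y True by (intro app_eqI) auto
  ultimately show ?thesis by simp
qed (simp add: app_def assms)

end

section \<open>Definability of the basic absolute notions\<close>

named_theorems dfb_rules

context models
begin

lemma Mod_tmodel: "tmodel (Mod i)"
  by unfold_locales (rule model)

lemma dfb_Ord: "tm t \<Longrightarrow> dfb (\<lambda>i s. Ord (t i s))"
proof (rule dfb_rel1[where P = "\<lambda>_. Ord"])
  show "dfb (\<lambda>i s. Ord (s 0))"
    unfolding Ord_def subset_eq by (intro dfb_intros)
qed

lemma dfb_is_pair: "tm t \<Longrightarrow> tm u \<Longrightarrow> tm v \<Longrightarrow> dfb (\<lambda>i s. is_pair (t i s) (u i s) (v i s))"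
proof (rule dfb_rel3[where P = "\<lambda>_. is_pair"])
  show "dfb (\<lambda>i s. is_pair (s 0) (s 1) (s 2))"
    unfolding is_pair_def by (intro dfb_intros)
qed

lemma tm_app: "tm t \<Longrightarrow> tm u \<Longrightarrow> tm (\<lambda>i s. app (t i s) (u i s))"
proof (rule tm_fun2[where T = app])
  show "x \<in> Mod i \<Longrightarrow> y \<in> Mod i \<Longrightarrow> app x y \<in> Mod i" for i x y
    by (rule tmodel.app_closed[OF Mod_tmodel])
  let ?R = "\<lambda>f x y. \<exists>p\<in>elts f. is_pair p x y"
  let ?E = "\<lambda>i s. \<exists>y\<in>Mod i. ?R (s 1) (s 2) y \<and> (\<forall>y'\<in>Mod i. ?R (s 1) (s 2) y' \<longrightarrow> y' = y)"
  show "dfb (\<lambda>i s. s 0 = app (s 1) (s 2))"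
  proof (rule dfb_cong)
    show "dfb (\<lambda>i s. (\<exists>y\<in>Mod i. ?R (s 1) (s 2) y \<and> (\<forall>y'\<in>Mod i. ?R (s 1) (s 2) y' \<longrightarrow> y' = y) \<and> s 0 = y)
      \<or> (\<not> ?E i s \<and> s 0 = s 2))"
      by (intro dfb_intros dfb_is_pair)
    fix i and s :: "nat \<Rightarrow> 'v"
    assume s: "range s \<subseteq> Mod i"
    interpret T: tmodel "Mod i" by (rule Mod_tmodel)
    \<comment> \<open>Coordinates of a pair belong to the transitive closure of the pair, so
      quantifying over \<open>Mod i\<close> instead of the universe changes neither existence nor
      uniqueness of the value.\<close>
    have in_Mod: "y \<in> Mod i" if "?R (s 1) (s 2) y" for y
    proof -
      have "s 1 \<in> Mod i" using s by blast
      then show ?thesis using that T.is_pair_closed[OF T.M_trans] by blast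
    qed
    show "(s 0 = app (s 1) (s 2)) \<longleftrightarrow>
      (\<exists>y\<in>Mod i. ?R (s 1) (s 2) y \<and> (\<forall>y'\<in>Mod i. ?R (s 1) (s 2) y' \<longrightarrow> y' = y) \<and> s 0 = y)
      \<or> (\<not> ?E i s \<and> s 0 = s 2)"
    proof (cases "\<exists>!y. ?R (s 1) (s 2) y")
      case True
      then obtain y where y: "?R (s 1) (s 2) y" "\<And>y'. ?R (s 1) (s 2) y' \<Longrightarrow> y' = y" by blast
      then have "app (s 1) (s 2) = y" using app_eqI by blast
      then show ?thesis using y in_Mod by blast
    next
      case False
      then have "app (s 1) (s 2) = s 2" by (auto simp: app_def)
      moreover have "\<not> ?E i s" using False in_Mod by blast
      ultimately show ?thesis by auto
    qed
  qed
qed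

lemma dfb_fin_ord: "tm t \<Longrightarrow> dfb (\<lambda>i s. fin_ord (t i s))"
proof (rule dfb_rel1[where P = "\<lambda>_. fin_ord"])
  show "dfb (\<lambda>i s. fin_ord (s 0))"
    unfolding fin_ord_def zero_or_max_def by (intro dfb_intros dfb_Ord)
qed

lemmas [dfb_rules] = dfb_intros dfb_Ord dfb_is_pair dfb_fin_ord tm_app

end

section \<open>Separation, replacement, functions and natural numbers inside a single model\<close>

sublocale tmodel \<subseteq> models "\<lambda>_::unit. M" "{c. c () \<in> M}"
proof
  obtain x where "x \<in> M" by (rule infinity)
  then have "(\<lambda>_. x) \<in> {c. c () \<in> M}" by simp
  then show "{c. c () \<in> M} \<noteq> {}" by (metis empty_iff)
qed (auto simp: transitive_model)

context tmodel
begin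

lemma separation:
  assumes "dfb (\<lambda>_ s. P (s 0))" "a \<in> M"
  shows "\<exists>b\<in>M. elts b = {x \<in> elts a. P x}"
proof -
  obtain \<phi> p where p: "\<forall>n. p n () \<in> M"
    and \<phi>: "\<And>s. range s \<subseteq> M \<Longrightarrow> P (s 0) = sat M (mix s (\<lambda>n. p n ())) \<phi>"
    using assms(1) unfolding dfb_def mem_Collect_eq by blast
  \<comment> \<open>Only variable 0 matters to the predicate; \<open>a\<close> just fills the
    remaining variables with an element of \<open>M\<close>.\<close>
  let ?s = "mix (\<lambda>_. a) (\<lambda>n. p n ())"
  have "range ?s \<subseteq> M" using p assms(2) by (simp add: mix_def image_subset_iff)
  obtain b where b: "b \<in> M" "\<And>x. x \<in> M \<Longrightarrow> x \<in> elts b \<longleftrightarrow> x \<in> elts a \<and> sat M (?s(0 := x)) \<phi>"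
  proof -
    have "Separation_in M" using ZFC by (simp add: models_ZFC_def)
    then have "\<forall>a\<in>M. \<exists>b\<in>M. \<forall>x\<in>M. x \<in> elts b \<longleftrightarrow> x \<in> elts a \<and> sat M (?s(0 := x)) \<phi>"
      unfolding Separation_in_def using \<open>range ?s \<subseteq> M\<close> by simp
    then show thesis using assms(2) that by blast
  qed
  have "sat M (?s(0 := x)) \<phi> = P x" if "x \<in> M" for x
  proof -
    have "?s(0 := x) = mix ((\<lambda>_. a)(0 := x)) (\<lambda>n. p n ())"
      by (auto simp: mix_def fun_eq_iff elim!: evenE)
    then show ?thesis using \<phi>[of "(\<lambda>_. a)(0 := x)"] that assms(2) by (simp add: image_subset_iff del: fun_upd_apply) (simp add: fun_upd_apply)
  qed
  then have "elts b = {x \<in> elts a. P x}" using b(2) M_trans[OF assms(2)] M_trans[OF b(1)] by blast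
  then show ?thesis using b by blast
qed

lemma replacement:
  assumes "dfb (\<lambda>_ s. P (s 0) (s 1))" "a \<in> M" "\<And>x. x \<in> elts a \<Longrightarrow> \<exists>!y. y \<in> M \<and> P x y"
  shows "\<exists>b\<in>M. elts b = {y \<in> M. \<exists>x\<in>elts a. P x y}"
proof -
  obtain \<phi> p where p: "\<forall>n. p n () \<in> M"
    and \<phi>: "\<And>s. range s \<subseteq> M \<Longrightarrow> P (s 0) (s 1) = sat M (mix s (\<lambda>n. p n ())) \<phi>"
    using assms(1) unfolding dfb_def mem_Collect_eq by blast
  \<comment> \<open>The schema reads its second distinguished variable at position 1, whereas
    \<open>mix\<close> keeps variable 1 at position 2 and a parameter at position 1; the two
    positions are swapped.\<close>
  let ?f = "\<lambda>n::nat. if n = 1 then 2 else if n = 2 then 1 else n"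
  obtain \<psi> where \<psi>: "\<forall>(M::'v set) s. sat M s \<psi> = sat M (\<lambda>n. s (?f n)) \<phi>"
    using sat_rename[of ?f \<phi>] by blast
  let ?s = "\<lambda>n. mix (\<lambda>_. a) (\<lambda>n. p n ()) (?f n)"
  have s: "range ?s \<subseteq> M" using p assms(2) by (simp add: mix_def image_subset_iff)
  have eq: "sat M (?s(0 := x, 1 := y)) \<psi> = P x y" if "x \<in> M" "y \<in> M" for x y
  proof -
    have "(\<lambda>n. (?s(0 := x, 1 := y)) (?f n)) = mix ((\<lambda>_. a)(0 := x, 1 := y)) (\<lambda>n. p n ())"
      by (auto simp: mix_def fun_eq_iff elim!: evenE)
    then show ?thesis using \<psi> \<phi>[of "(\<lambda>_. a)(0 := x, 1 := y)"] that assms(2) by (simp add: image_subset_iff)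
  qed
  have "\<exists>!y. y \<in> M \<and> sat M (?s(0 := x, 1 := y)) \<psi>" if "x \<in> M" "x \<in> elts a" for x
    using assms(3)[OF that(2)] eq[OF that(1)] by (metis (no_types, lifting))
  then have ex: "\<forall>x\<in>M. x \<in> elts a \<longrightarrow> (\<exists>!y. y \<in> M \<and> sat M (?s(0 := x, 1 := y)) \<psi>)" by blast
  obtain b where b: "b \<in> M" "\<And>y. y \<in> M \<Longrightarrow> y \<in> elts b \<longleftrightarrow>
      (\<exists>x\<in>M. x \<in> elts a \<and> sat M (?s(0 := x, 1 := y)) \<psi>)"
  proof -
    have R: "Replacement_in M" using ZFC by (simp add: models_ZFC_def)
    have "\<forall>a\<in>M. (\<forall>x\<in>M. x \<in> elts a \<longrightarrow> (\<exists>!y. y \<in> M \<and> sat M (?s(0 := x, 1 := y)) \<psi>)) \<longrightarrow>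
      (\<exists>b\<in>M. \<forall>y\<in>M. y \<in> elts b \<longleftrightarrow> (\<exists>x\<in>M. x \<in> elts a \<and> sat M (?s(0 := x, 1 := y)) \<psi>))"
      using mp[OF spec[OF spec[OF R[unfolded Replacement_in_def], of \<psi>], of ?s] s] .
    from mp[OF bspec[OF this assms(2)] ex] that show thesis by blast
  qed
  have "elts b = {y \<in> M. \<exists>x\<in>elts a. P x y}"
    using b(2) eq M_trans[OF assms(2)] M_trans[OF b(1)] by blast
  then show ?thesis using b by blast
qed

text \<open>Every such pair is an element of the double power set of the union of \<open>a\<close>
  and \<open>b\<close>, so separation suffices.\<close>

lemma product:
  assumes a: "a \<in> M" and b: "b \<in> M"
  obtains c where "c \<in> M" "\<And>p. p \<in> elts c \<longleftrightarrow> (\<exists>x\<in>elts a. \<exists>y\<in>elts b. is_pair p x y)"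
proof -
  obtain w where w: "w \<in> M" "elts w = elts a \<union> elts b" using union2[OF a b] by blast
  obtain p1 where p1: "p1 \<in> M" "elts p1 = {z \<in> M. elts z \<subseteq> elts w}" using power[OF w(1)] by blast
  obtain p2 where p2: "p2 \<in> M" "elts p2 = {z \<in> M. elts z \<subseteq> elts p1}" using power[OF p1(1)] by blast
  have "dfb (\<lambda>_ s. \<exists>x\<in>elts a. \<exists>y\<in>elts b. is_pair (s 0) x y)"
    by (intro dfb_rules) (simp_all add: a b)
  from separation[OF this p2(1)] obtain c where
    c: "c \<in> M" "elts c = {p \<in> elts p2. \<exists>x\<in>elts a. \<exists>y\<in>elts b. is_pair p x y}" by blast
  have "p \<in> elts p2" if x: "x \<in> elts a" and y: "y \<in> elts b" and p: "is_pair p x y" for p x y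
  proof -
    have "x \<in> M" "y \<in> M" using M_trans[OF a x] M_trans[OF b y] .
    then have "p \<in> M" using is_pair_ex is_pair_unique[OF p] by blast
    obtain u v where uv: "elts p = {u, v}" "elts u = {x}" "elts v = {x, y}"
      using p unfolding is_pair_iff by blast
    then have "u \<in> M" "v \<in> M" using M_trans[OF \<open>p \<in> M\<close>] by simp_all
    with uv x y w(2) p1(2) have "elts p \<subseteq> elts p1" by simp
    then show ?thesis using p2(2) \<open>p \<in> M\<close> by simp
  qed
  then have "p \<in> elts c \<longleftrightarrow> (\<exists>x\<in>elts a. \<exists>y\<in>elts b. is_pair p x y)" for p
    using c(2) by blast
  then show thesis using c(1) that by blast
qed

lemma graph:
  assumes P: "dfb (\<lambda>_ s. P (s 0) (s 1))" and a: "a \<in> M" and b: "b \<in> M"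
  obtains f where "f \<in> M"
    "\<And>p. p \<in> elts f \<longleftrightarrow> (\<exists>x\<in>elts a. \<exists>y\<in>elts b. is_pair p x y \<and> P x y)"
proof -
  obtain c where c: "c \<in> M" "\<And>p. p \<in> elts c \<longleftrightarrow> (\<exists>x\<in>elts a. \<exists>y\<in>elts b. is_pair p x y)"
    using product[OF a b] by blast
  have "dfb (\<lambda>_ s. \<exists>x\<in>elts a. \<exists>y\<in>elts b. is_pair (s 0) x y \<and> P x y)"
    by (intro dfb_rules dfb_rel2[where P = "\<lambda>_. P", OF P]) (simp_all add: a b)
  from separation[OF this c(1)] obtain f where
    f: "f \<in> M" "elts f = {p \<in> elts c. \<exists>x\<in>elts a. \<exists>y\<in>elts b. is_pair p x y \<and> P x y}" by blast
  have "p \<in> elts f \<longleftrightarrow> (\<exists>x\<in>elts a. \<exists>y\<in>elts b. is_pair p x y \<and> P x y)" for p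
    using f(2) c(2) by blast
  then show thesis using f(1) that by blast
qed

lemma graph_app:
  assumes f: "\<And>p. p \<in> elts f \<longleftrightarrow> (\<exists>x\<in>elts a. \<exists>y\<in>elts b. is_pair p x y \<and> P x y)"
    and xy: "x \<in> elts a" "y \<in> elts b" "P x y" "x \<in> M" "y \<in> M"
    and single: "\<And>y'. y' \<in> elts b \<Longrightarrow> P x y' \<Longrightarrow> y' = y"
  shows "app f x = y"
proof -
  obtain p where p: "is_pair p x y" using is_pair_ex xy by blast
  show ?thesis
  proof (rule app_eqI)
    show "p \<in> elts f" using f p xy by blast
    show "is_pair p x y" by (fact p)
    fix q z assume "q \<in> elts f" "is_pair q x z"
    then obtain x' y' where "y' \<in> elts b" "is_pair q x' y'" "P x' y'" using f by blast
    then show "z = y" using is_pair_inj \<open>is_pair q x z\<close> single by blast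
  qed
qed

lemma function_ex:
  assumes P: "dfb (\<lambda>_ s. P (s 0) (s 1))" and a: "a \<in> M" and b: "b \<in> M"
    and single: "\<forall>x\<in>elts a. \<forall>y\<in>elts b. \<forall>y'\<in>elts b. P x y \<longrightarrow> P x y' \<longrightarrow> y' = y"
  shows "\<exists>f\<in>M. \<forall>x\<in>elts a. \<forall>y\<in>elts b. P x y \<longrightarrow> app f x = y"
proof -
  obtain f where f: "f \<in> M"
    "\<And>p. p \<in> elts f \<longleftrightarrow> (\<exists>x\<in>elts a. \<exists>y\<in>elts b. is_pair p x y \<and> P x y)"
    using graph[OF P a b] by blast
  have "app f x = y" if "x \<in> elts a" "y \<in> elts b" "P x y" for x y
    using graph_app[where P = P, OF f(2) that M_trans[OF a that(1)] M_trans[OF b that(2)]] single that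
    by blast
  then show ?thesis using f(1) by blast
qed

text \<open>\<open>F\<close> lives in the metatheory. It is enough that its values lie in
  \<open>M\<close> and that a definable \<open>P\<close> singles them out there; replacement
  provides the codomain.\<close>

lemma function_replacement:
  assumes P: "dfb (\<lambda>_ s. P (s 0) (s 1))" and a: "a \<in> M"
    and F: "\<And>x. x \<in> elts a \<Longrightarrow> F x \<in> M"
    and PF: "\<And>x y. x \<in> elts a \<Longrightarrow> y \<in> M \<Longrightarrow> P x y \<longleftrightarrow> y = F x"
  shows "\<exists>f\<in>M. \<forall>x\<in>elts a. app f x = F x"
proof -
  obtain b where b: "b \<in> M" "elts b = {y \<in> M. \<exists>x\<in>elts a. P x y}"
    using replacement[OF P a] F PF by (metis (no_types, lifting))
  have "\<forall>x\<in>elts a. \<forall>y\<in>elts b. \<forall>y'\<in>elts b. P x y \<longrightarrow> P x y' \<longrightarrow> y' = y"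
    using PF b(2) by simp
  from function_ex[OF P a b(1) this]
  obtain f where f: "f \<in> M" "\<And>x y. x \<in> elts a \<Longrightarrow> y \<in> elts b \<Longrightarrow> P x y \<Longrightarrow> app f x = y"
    by blast
  have "app f x = F x" if "x \<in> elts a" for x
    using f(2)[OF that, of "F x"] PF[OF that F[OF that]] b(2) F[OF that] that by blast
  then show ?thesis using f(1) by blast
qed

text \<open>Since \<open>app\<close> ignores everything but the relevant pairs, the sets of
  \<open>M\<close> acting as functions from \<open>a\<close> to \<open>b\<close> are not bounded by
  a set. Up to agreement on \<open>a\<close> they are, by subsets of the product; this is the
  codomain from which \<open>choice\<close> can pick functions.\<close>

lemma function_space:
  assumes a: "a \<in> M" and b: "b \<in> M"
  shows "\<exists>F\<in>M. \<forall>f\<in>M. (\<forall>x\<in>elts a. app f x \<in> elts b) \<longrightarrow> (\<exists>f'\<in>elts F. \<forall>x\<in>elts a. app f' x = app f x)"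
proof -
  obtain c where c: "c \<in> M" "\<And>p. p \<in> elts c \<longleftrightarrow> (\<exists>x\<in>elts a. \<exists>y\<in>elts b. is_pair p x y)"
    using product[OF a b] by blast
  obtain F where F: "F \<in> M" "elts F = {z \<in> M. elts z \<subseteq> elts c}" using power[OF c(1)] by blast
  have "\<exists>f'\<in>elts F. \<forall>x\<in>elts a. app f' x = app f x"
    if f: "f \<in> M" and fab: "\<And>x. x \<in> elts a \<Longrightarrow> app f x \<in> elts b" for f
  proof -
    have "dfb (\<lambda>_ s. s 1 = app f (s 0))" by (intro dfb_rules) (simp add: f)
    from graph[where P = "\<lambda>x y. y = app f x", OF this a b] obtain g where g: "g \<in> M"
      "\<And>p. p \<in> elts g \<longleftrightarrow> (\<exists>x\<in>elts a. \<exists>y\<in>elts b. is_pair p x y \<and> y = app f x)" by blast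
    have "app g x = app f x" if "x \<in> elts a" for x
      using graph_app[where P = "\<lambda>x y. y = app f x", OF g(2) that fab[OF that]]
        M_trans[OF a that] M_trans[OF b fab[OF that]] by blast
    moreover have "elts g \<subseteq> elts c" using g(2) c(2) by blast
    ultimately show ?thesis using g(1) F(2) by blast
  qed
  then show ?thesis using F(1) by blast
qed

lemma nn_facts: "nn n \<in> M \<and> elts (nn n :: 'v) = nn ` {..<n}"
proof (induction n)
  case 0
  obtain x e where "x \<in> M" "e \<in> elts x" "elts e = {}" by (rule infinity)
  then show ?case using M_trans[of x e] mk_eq[of e "{}"] by simp
next
  case (Suc n)
  obtain u where u: "u \<in> M" "elts u = insert (nn n) (elts (nn n))"
    using insert_ex[of "nn n" "nn n"] Suc by blast
  then have "nn (Suc n) = u" using mk_eq[OF u(2)] by simp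
  then show ?case using u Suc by (auto simp: lessThan_Suc)
qed

lemmas nn_in = nn_facts[THEN conjunct1]
  and elts_nn = nn_facts[THEN conjunct2]

lemma elts_nn_Suc: "elts (nn (Suc n) :: 'v) = insert (nn n) (elts (nn n))"
  unfolding elts_nn by (simp add: lessThan_Suc)

lemma Ord_nn: "Ord (nn n :: 'v)"
proof (induction n rule: less_induct)
  case (less n)
  show ?case by (rule OrdI) (use less in \<open>auto simp: elts_nn\<close>)
qed

lemma nn_mem_iff: "(nn m :: 'v) \<in> elts (nn n) \<longleftrightarrow> m < n"
proof
  assume "(nn m :: 'v) \<in> elts (nn n)"
  show "m < n"
  proof (rule ccontr)
    assume "\<not> m < n"
    then have "(nn n :: 'v) \<in> elts (nn m) \<or> (nn n :: 'v) = nn m" by (cases "m = n") (auto simp: elts_nn)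
    then show False using mem_asym mem_irrefl \<open>nn m \<in> elts (nn n)\<close> by metis
  qed
qed (simp add: elts_nn)

lemma nn_inj: "(nn m :: 'v) = nn n \<Longrightarrow> m = n"
  using nn_mem_iff mem_irrefl by (metis linorder_neqE_nat)

text \<open>The membership relation is truly well-founded, so the model has no nonstandard natural
  numbers: descending along the maximum ends at zero after finitely many steps.\<close>

lemma fin_ord_iff: "fin_ord (n :: 'v) \<longleftrightarrow> n \<in> range nn"
proof
  assume "fin_ord n"
  then show "n \<in> range nn"
  proof (induction n rule: elts_induct)
    case (step n)
    then have "Ord n" by (simp add: fin_ord_def)
    show ?case
    proof (cases "elts n = {}")
      case True
      then have "n = nn 0" using mk_eq[OF True] by simp
      then show ?thesis by blast
    next
      case False
      have n: "zero_or_max n" "\<forall>m\<in>elts n. zero_or_max m"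
        using step.prems by (simp_all add: fin_ord_def)
      obtain k where k: "k \<in> elts n" "\<forall>z\<in>elts n. z \<in> elts k \<or> z = k"
        using n(1) False unfolding zero_or_max_def by blast
      have sub: "elts k \<subseteq> elts n" using Ord_trans[OF \<open>Ord n\<close> k(1)] by blast
      then have "fin_ord k"
        using n(2) k(1) Ord_in[OF \<open>Ord n\<close> k(1)] unfolding fin_ord_def by (simp add: subset_eq)
      then obtain l where l: "k = nn l" using step.IH k by blast
      have "elts n = elts (nn (Suc l))" unfolding elts_nn_Suc l[symmetric] using k sub by blast
      then have "n = nn (Suc l)" by (rule elts_inject)
      then show ?thesis by blast
    qed
  qed
next
  assume "n \<in> range nn"
  then obtain k where k: "n = nn k" by blast
  have max: "zero_or_max (nn m :: 'v)" for m
  proof (cases m)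
    case 0
    then show ?thesis by (simp add: zero_or_max_def elts_nn del: nn.simps)
  next
    case (Suc l)
    show ?thesis unfolding zero_or_max_def Suc elts_nn_Suc by blast
  qed
  have "elts (nn k :: 'v) \<subseteq> range nn" by (auto simp: elts_nn)
  then show "fin_ord n" unfolding fin_ord_def k using Ord_nn max by auto
qed

lemma omega_facts: "omega \<in> M \<and> elts (omega :: 'v) = range nn"
proof -
  obtain x e where x: "x \<in> M" "e \<in> elts x" "elts e = {}"
    "\<And>y. y \<in> elts x \<Longrightarrow> \<exists>s\<in>elts x. elts s = insert y (elts y)" by (rule infinity) blast
  have nx: "nn n \<in> elts x" for n
  proof (induction n)
    case 0
    then show ?case using mk_eq[OF x(3)] x(2) by simp
  next
    case (Suc n)
    from x(4)[OF this] obtain s where "s \<in> elts x" "elts s = elts (nn (Suc n))"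
      using elts_nn_Suc by metis
    then show ?case using elts_inject by metis
  qed
  have "dfb (\<lambda>_ s. fin_ord (s 0))" by (intro dfb_rules)
  from separation[OF this x(1)] obtain w where w: "w \<in> M" "elts w = {n \<in> elts x. fin_ord n}" by blast
  then have "elts w = range nn" using nx fin_ord_iff by blast
  moreover from mk_eq[OF this] have "omega = w" by (simp add: omega_def)
  ultimately show ?thesis using w(1) by simp
qed

lemmas omega_in = omega_facts[THEN conjunct1]
  and elts_omega = omega_facts[THEN conjunct2]

lemma nn_in_omega: "(nn n :: 'v) \<in> elts omega"
  by (simp add: elts_omega)

lemma Ord_omega: "Ord (omega :: 'v)"
  by (rule OrdI) (auto simp: elts_omega Ord_nn elts_nn)

end

context models
begin

text \<open>All models have the same \<open>omega\<close>, which each of them identifies as its set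
  of all \<open>x\<close> with the absolute property \<open>fin_ord\<close>.\<close>

lemma tm_omega: "tm (\<lambda>i s. omega :: 'v)"
proof (rule tm_fun1[where T = "\<lambda>_. omega :: 'v" and t = "\<lambda>i s. s 0"])
  show "(omega :: 'v) \<in> Mod i" for i by (rule tmodel.omega_in[OF Mod_tmodel])
  show "dfb (\<lambda>i s. s 0 = omega)"
  proof (rule dfb_cong)
    show "dfb (\<lambda>i s. \<forall>x\<in>Mod i. x \<in> elts (s 0) \<longleftrightarrow> fin_ord x)" by (intro dfb_rules)
    fix i and s :: "nat \<Rightarrow> 'v" assume s: "range s \<subseteq> Mod i"
    interpret T: tmodel "Mod i" by (rule Mod_tmodel)
    have s0: "s 0 \<in> Mod i" using s by blast
    have "(\<forall>x\<in>Mod i. x \<in> elts (s 0) \<longleftrightarrow> fin_ord x) \<longleftrightarrow> elts (s 0) = elts omega"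
      using T.M_trans[OF s0] T.M_trans[OF T.omega_in] unfolding T.fin_ord_iff T.elts_omega by blast
    then show "s 0 = omega \<longleftrightarrow> (\<forall>x\<in>Mod i. x \<in> elts (s 0) \<longleftrightarrow> fin_ord x)"
      by (simp add: elts_eq_iff)
  qed
qed (rule tm_var)

lemma dfb_Limit: "tm t \<Longrightarrow> dfb (\<lambda>i s. Limit (t i s))"
proof (rule dfb_rel1[where P = "\<lambda>_. Limit"])
  have "dfb (\<lambda>i s. Ord (s 0) \<and> \<not> (\<forall>x\<in>elts (s 0). x \<noteq> x) \<and> (\<forall>\<beta>\<in>elts (s 0). \<exists>\<gamma>\<in>elts (s 0). \<beta> \<in> elts \<gamma>))"
    by (intro dfb_rules)
  then show "dfb (\<lambda>i s. Limit (s 0))" by (rule dfb_cong) (auto simp: Limit_def)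
qed

lemma dfb_cof: "tm t \<Longrightarrow> tm u \<Longrightarrow> dfb (\<lambda>i s. cof (Mod i) (t i s) (u i s))"
proof (rule dfb_rel2[where P = "\<lambda>i. cof (Mod i)"])
  show "dfb (\<lambda>i s. cof (Mod i) (s 0) (s 1))" unfolding cof_def by (intro dfb_rules)
qed

lemmas [dfb_rules] = tm_omega dfb_Limit dfb_cof

end

section \<open>Transfinite recursion and choice inside a model\<close>

context tmodel
begin

text \<open>The usual definition of a recursive sequence by attempts: any \<open>f\<close> obeying
  \<open>R\<close> at all stages below \<delta> agrees with \<open>I\<close> there by induction, and
  \<open>f0\<close> shows that an attempt exists. This makes the graph of the external
  \<open>I\<close> definable in \<open>M\<close>.\<close>

lemma recursion_graph:
  assumes \<delta>: "\<delta> \<in> M" "Ord \<delta>"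
    and I: "\<And>\<epsilon>. \<epsilon> \<in> elts \<delta> \<Longrightarrow> I \<epsilon> \<in> M"
    and step: "\<And>\<epsilon> f y. \<epsilon> = \<delta> \<or> \<epsilon> \<in> elts \<delta> \<Longrightarrow> f \<in> M \<Longrightarrow> \<forall>\<gamma>\<in>elts \<epsilon>. app f \<gamma> = I \<gamma> \<Longrightarrow>
      y \<in> M \<Longrightarrow> R \<epsilon> f y \<longleftrightarrow> y = I \<epsilon>"
    and f0: "f0 \<in> M" "\<forall>\<gamma>\<in>elts \<delta>. app f0 \<gamma> = I \<gamma>" and y: "y \<in> M"
  shows "(\<exists>f\<in>M. (\<forall>\<epsilon>\<in>elts \<delta>. R \<epsilon> f (app f \<epsilon>)) \<and> R \<delta> f y) \<longleftrightarrow> y = I \<delta>" (is "?Q \<longleftrightarrow> _")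
proof
  assume ?Q
  then obtain f where f: "f \<in> M" "\<And>\<epsilon>. \<epsilon> \<in> elts \<delta> \<Longrightarrow> R \<epsilon> f (app f \<epsilon>)" "R \<delta> f y" by blast
  have "\<epsilon> \<in> elts \<delta> \<Longrightarrow> app f \<epsilon> = I \<epsilon>" for \<epsilon>
  proof (induction \<epsilon> rule: elts_induct)
    case (step \<epsilon>)
    then have "\<forall>\<zeta>\<in>elts \<epsilon>. app f \<zeta> = I \<zeta>" using Ord_trans[OF \<delta>(2)] by blast
    then show ?case
      using assms(4)[of \<epsilon> f "app f \<epsilon>"] f(1) f(2)[OF step.prems] step.prems
        app_closed[OF f(1) M_trans[OF \<delta>(1) step.prems]] by blast
  qed
  then show "y = I \<delta>" using step[of \<delta> f y] f(1,3) y by blast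
next
  assume yI: "y = I \<delta>"
  have "R \<epsilon> f0 (app f0 \<epsilon>)" if \<epsilon>: "\<epsilon> \<in> elts \<delta>" for \<epsilon>
  proof -
    have "\<forall>\<zeta>\<in>elts \<epsilon>. app f0 \<zeta> = I \<zeta>" using f0(2) Ord_trans[OF \<delta>(2) \<epsilon>] by blast
    then show ?thesis using step[of \<epsilon> f0 "app f0 \<epsilon>"] \<epsilon> f0 I[OF \<epsilon>] by simp
  qed
  moreover have "R \<delta> f0 y" using step[of \<delta> f0 y] f0 y yI by simp
  ultimately show ?Q using f0(1) by blast
qed

text \<open>
  The sequence \<open>I\<close> is given outside of the model; it suffices that the model can identify \<open>I \<delta>\<close> from
  any of its functions that agrees with \<open>I\<close> below \<open>\<delta>\<close>.
\<close>

lemma recursion: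
  assumes R: "dfb (\<lambda>_ s. R (s 0) (s 1) (s 2))" and \<alpha>: "\<alpha> \<in> M" "Ord \<alpha>"
    and I: "\<And>\<delta>. \<delta> \<in> elts \<alpha> \<Longrightarrow> I \<delta> \<in> M"
    and step: "\<And>\<delta> f y. \<delta> \<in> elts \<alpha> \<Longrightarrow> f \<in> M \<Longrightarrow> \<forall>\<gamma>\<in>elts \<delta>. app f \<gamma> = I \<gamma> \<Longrightarrow> y \<in> M \<Longrightarrow>
      R \<delta> f y \<longleftrightarrow> y = I \<delta>"
  shows "\<exists>f\<in>M. \<forall>\<delta>\<in>elts \<alpha>. app f \<delta> = I \<delta>"
proof -
  have "\<delta> = \<alpha> \<or> \<delta> \<in> elts \<alpha> \<Longrightarrow> \<exists>f\<in>M. \<forall>\<gamma>\<in>elts \<delta>. app f \<gamma> = I \<gamma>" for \<delta>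
  proof (induction \<delta> rule: elts_induct)
    case (step \<delta>)
    then have \<delta>: "\<delta> \<in> M" and sub: "elts \<delta> \<subseteq> elts \<alpha>"
      using \<alpha>(1) M_trans[OF \<alpha>(1)] Ord_trans[OF \<alpha>(2)] by blast+
    let ?Q = "\<lambda>\<gamma> y. \<exists>f\<in>M. (\<forall>\<epsilon>\<in>elts \<gamma>. R \<epsilon> f (app f \<epsilon>)) \<and> R \<gamma> f y"
    have Q: "dfb (\<lambda>_ s. ?Q (s 0) (s 1))"
      by (intro dfb_rules dfb_rel3[where P = "\<lambda>_. R", OF R])
    have I\<delta>: "I \<gamma> \<in> M" if "\<gamma> \<in> elts \<delta>" for \<gamma> using I sub that by blast
    have QI: "?Q \<gamma> y \<longleftrightarrow> y = I \<gamma>" if \<gamma>: "\<gamma> \<in> elts \<delta>" and y: "y \<in> M" for \<gamma> y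
    proof -
      have \<gamma>\<alpha>: "\<gamma> \<in> elts \<alpha>" using \<gamma> sub by blast
      have \<gamma>sub: "\<epsilon> \<in> elts \<alpha>" if "\<epsilon> = \<gamma> \<or> \<epsilon> \<in> elts \<gamma>" for \<epsilon>
        using Ord_trans[OF \<alpha>(2) \<gamma>\<alpha>] \<gamma>\<alpha> that by blast
      obtain f where f: "f \<in> M" "\<forall>\<epsilon>\<in>elts \<gamma>. app f \<epsilon> = I \<epsilon>"
        using step.IH[OF \<gamma>] \<gamma>\<alpha> by blast
      show ?thesis
      proof (rule recursion_graph[OF M_trans[OF \<delta> \<gamma>] Ord_in[OF \<alpha>(2) \<gamma>\<alpha>] _ _ f y])
        show "I \<epsilon> \<in> M" if "\<epsilon> \<in> elts \<gamma>" for \<epsilon> using I[OF \<gamma>sub] that by simp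
        show "R \<epsilon> f y \<longleftrightarrow> y = I \<epsilon>"
          if "\<epsilon> = \<gamma> \<or> \<epsilon> \<in> elts \<gamma>" "f \<in> M" "\<forall>\<gamma>\<in>elts \<epsilon>. app f \<gamma> = I \<gamma>" "y \<in> M" for \<epsilon> f y
          using assms(5)[OF \<gamma>sub[OF that(1)] that(2,3,4)] .
      qed
    qed
    show ?case by (rule function_replacement[where P = ?Q and F = I, OF Q \<delta> I\<delta> QI])
  qed
  then show ?thesis by blast
qed

text \<open>The axiom selects from nonempty sets, so it is applied to the family of the fibres of
  \<open>P\<close>, as subsets of \<open>b\<close>. The selector is then composed with the map from
  \<open>x\<close> to its fibre, which is unique by extensionality.\<close>

lemma choice:
  assumes P: "dfb (\<lambda>_ s. P (s 0) (s 1))" and a: "a \<in> M" and b: "b \<in> M"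
    and ex: "\<And>x. x \<in> elts a \<Longrightarrow> \<exists>y\<in>elts b. P x y"
  shows "\<exists>f\<in>M. \<forall>x\<in>elts a. app f x \<in> elts b \<and> P x (app f x)"
proof -
  obtain pb where pb: "pb \<in> M" "elts pb = {z \<in> M. elts z \<subseteq> elts b}" using power[OF b] by blast
  let ?fib = "\<lambda>x B. \<forall>y\<in>elts b. y \<in> elts B \<longleftrightarrow> P x y"
  have "dfb (\<lambda>_ s. \<exists>x\<in>elts a. ?fib x (s 0))"
    by (intro dfb_rules dfb_rel2[where P = "\<lambda>_. P", OF P]) (simp_all add: a b)
  from separation[OF this pb(1)] obtain fam where
    fam: "fam \<in> M" "elts fam = {B \<in> elts pb. \<exists>x\<in>elts a. ?fib x B}" by blast
  have ne: "\<forall>B\<in>M. B \<in> elts fam \<longrightarrow> (\<exists>y\<in>M. y \<in> elts B)"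
  proof (intro ballI impI)
    fix B assume "B \<in> M" "B \<in> elts fam"
    then obtain x where "x \<in> elts a" "?fib x B" using fam(2) by blast
    then obtain y where "y \<in> elts B" using ex by blast
    then show "\<exists>y\<in>M. y \<in> elts B" using M_trans[OF \<open>B \<in> M\<close>] by blast
  qed
  have AC: "Choice_in M" using ZFC by (simp add: models_ZFC_def)
  obtain f c where f: "f \<in> M" "c \<in> M" "function_in M f fam c"
    "\<forall>B\<in>M. B \<in> elts fam \<longrightarrow> (\<exists>y\<in>M. y \<in> elts B \<and> app_in M f B y)"
    using mp[OF bspec[OF AC[unfolded Choice_in_def] fam(1)] ne] by blast
  have app_f: "app f B \<in> elts B" if B: "B \<in> elts fam" for B
  proof -
    have "B \<in> M" using M_trans[OF fam(1) B] .
    then obtain y where y: "y \<in> M" "y \<in> elts B" "app_in M f B y" using f(4) B by blast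
    have "\<exists>!y. y \<in> M \<and> app_in M f B y" using f(3) \<open>B \<in> M\<close> B unfolding function_in_def by blast
    then have unique: "z = y" if "z \<in> M" "app_in M f B z" for z using y that by blast
    obtain p where p: "p \<in> elts f" "is_pair p B y" using y app_in_iff[OF f(1) \<open>B \<in> M\<close>] by blast
    have "app f B = y"
    proof (rule app_eqI[OF p])
      fix q z assume q: "q \<in> elts f" "is_pair q B z"
      then have "z \<in> M" using is_pair_closed[OF M_trans[OF f(1)]] by blast
      then show "z = y" using unique app_in_iff[OF f(1) \<open>B \<in> M\<close>] q by blast
    qed
    then show ?thesis using y by simp
  qed
  let ?Q = "\<lambda>x y. \<exists>B\<in>elts fam. ?fib x B \<and> y = app f B"
  have Q: "dfb (\<lambda>_ s. ?Q (s 0) (s 1))"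
    by (intro dfb_rules dfb_rel2[where P = "\<lambda>_. P", OF P]) (simp_all add: b fam f)
  have fib_unique: "B = B'" if "B \<in> elts fam" "B' \<in> elts fam" "?fib x B" "?fib x B'" for x B B'
  proof (rule elts_eqI)
    show "z \<in> elts B \<longleftrightarrow> z \<in> elts B'" for z using that fam(2) pb(2) by blast
  qed
  have "\<forall>x\<in>elts a. \<forall>y\<in>elts b. \<forall>y'\<in>elts b. ?Q x y \<longrightarrow> ?Q x y' \<longrightarrow> y' = y"
    using fib_unique by blast
  from function_ex[where P = ?Q, OF Q a b this]
  obtain g where g: "g \<in> M" "\<And>x y. x \<in> elts a \<Longrightarrow> y \<in> elts b \<Longrightarrow> ?Q x y \<Longrightarrow> app g x = y"
    by blast
  have "app g x \<in> elts b \<and> P x (app g x)" if x: "x \<in> elts a" for x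
  proof -
    have "dfb (\<lambda>_ s. P x (s 0))"
      by (intro dfb_rel2[where P = "\<lambda>_. P", OF P] dfb_rules) (simp add: M_trans[OF a x])
    from separation[OF this b] obtain B where B: "B \<in> M" "elts B = {y \<in> elts b. P x y}" by blast
    then have "B \<in> elts fam" using fam(2) pb(2) x by blast
    from app_f[OF this] have y: "app f B \<in> elts b" "P x (app f B)" using B(2) by auto
    have "?fib x B" using B(2) by blast
    then have "app g x = app f B" using g(2)[OF x y(1)] \<open>B \<in> elts fam\<close> by blast
    then show ?thesis using y by simp
  qed
  then show ?thesis using g(1) by blast
qed

end

section \<open>Cofinality, regularity and well-orderings in a model\<close>

definition reg :: "'v::set_universe set \<Rightarrow> 'v \<Rightarrow> bool" where
  "reg M \<alpha> \<longleftrightarrow> Limit \<alpha> \<and> (\<forall>\<beta>\<in>elts \<alpha>. \<not> cof M \<beta> \<alpha>)"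

text \<open>Comparison of sizes inside \<open>M\<close>: the values of one function on
  \<open>a\<close> cover \<open>b\<close>. Values outside \<open>b\<close> are allowed.\<close>

definition onto :: "'v::set_universe set \<Rightarrow> 'v \<Rightarrow> 'v \<Rightarrow> bool" where
  "onto M a b \<longleftrightarrow> (\<exists>e\<in>M. \<forall>y\<in>elts b. \<exists>x\<in>elts a. app e x = y)"

lemma Limit_Ord: "Limit \<alpha> \<Longrightarrow> Ord \<alpha>"
  by (simp add: Limit_def)

lemma Limit_next: "Limit \<alpha> \<Longrightarrow> \<beta> \<in> elts \<alpha> \<Longrightarrow> \<exists>\<gamma>\<in>elts \<alpha>. \<beta> \<in> elts \<gamma>"
  by (simp add: Limit_def)

lemma Limit_upper:
  assumes "Limit \<alpha>" "x \<in> elts \<alpha>" "y \<in> elts \<alpha>"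
  shows "\<exists>z\<in>elts \<alpha>. x \<in> elts z \<and> y \<in> elts z"
proof -
  note ord = Limit_Ord[OF assms(1)]
  obtain a where a: "a \<in> elts \<alpha>" "x \<in> elts a" using Limit_next[OF assms(1,2)] by blast
  obtain b where b: "b \<in> elts \<alpha>" "y \<in> elts b" using Limit_next[OF assms(1,3)] by blast
  consider "a \<in> elts b" | "a = b" | "b \<in> elts a"
    using Ord_linear[OF Ord_in[OF ord a(1)] Ord_in[OF ord b(1)]] by blast
  then show ?thesis
  proof cases
    case 1
    then show ?thesis using b a Ord_trans[OF Ord_in[OF ord b(1)] 1] by blast
  next
    case 2
    then show ?thesis using a b by blast
  next
    case 3
    then show ?thesis using b a Ord_trans[OF Ord_in[OF ord a(1)] 3] by blast
  qed
qed

lemma (in models) dfb_reg [dfb_rules]: "tm t \<Longrightarrow> dfb (\<lambda>i s. reg (Mod i) (t i s))"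
proof (rule dfb_rel1[where P = "\<lambda>i. reg (Mod i)"])
  show "dfb (\<lambda>i s. reg (Mod i) (s 0))"
    unfolding reg_def by (intro dfb_rules)
qed

context tmodel
begin

text \<open>Two discrepancies are bridged. Weak domination becomes strict by first moving up inside
  the limit ordinal; conversely, the graph of \<open>app f\<close> replaces an \<open>f\<close> that
  may contain irrelevant elements.\<close>

lemma cof_iff:
  assumes \<alpha>: "\<alpha> \<in> M" "Limit \<alpha>" and \<beta>: "\<beta> \<in> M"
  shows "(\<exists>f\<in>M. cofinal_map_in M f \<beta> \<alpha>) \<longleftrightarrow> cof M \<beta> \<alpha>"
proof
  assume "\<exists>f\<in>M. cofinal_map_in M f \<beta> \<alpha>"
  then obtain f where f: "f \<in> M" "function_in M f \<beta> \<alpha>"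
    "\<forall>\<gamma>\<in>elts \<alpha>. \<exists>\<xi>\<in>elts \<beta>. \<exists>\<eta>\<in>elts \<alpha>. app_in M f \<xi> \<eta> \<and> (\<gamma> = \<eta> \<or> \<gamma> \<in> elts \<eta>)"
    unfolding cofinal_map_in_def by blast
  have unique: "\<exists>!y. y \<in> M \<and> app_in M f x y" if "x \<in> elts \<beta>" for x
    using f(2) M_trans[OF \<beta> that] that unfolding function_in_def by blast
  have app_f: "app f x = y" if x: "x \<in> elts \<beta>" and y: "y \<in> M" "app_in M f x y" for x y
  proof -
    have xM: "x \<in> M" using M_trans[OF \<beta> x] .
    obtain p where p: "p \<in> elts f" "is_pair p x y" using app_in_iff[OF f(1) xM y(1)] y(2) by blast
    show ?thesis
    proof (rule app_eqI[OF p])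
      fix q z assume q: "q \<in> elts f" "is_pair q x z"
      then have "z \<in> M" using is_pair_closed[OF M_trans[OF f(1)]] by blast
      then show "z = y" using unique[OF x] app_in_iff[OF f(1) xM] q y by blast
    qed
  qed
  have range: "app f x \<in> elts \<alpha>" if x: "x \<in> elts \<beta>" for x
  proof -
    obtain y where y: "y \<in> M" "app_in M f x y" using unique[OF x] by blast
    then obtain p where p: "p \<in> M" "p \<in> elts f" "pair_in M x y p" unfolding app_in_def by blast
    then obtain x' y' where "x' \<in> M" "y' \<in> M" "y' \<in> elts \<alpha>" "pair_in M x' y' p"
      using f(2) unfolding function_in_def by blast
    then have "y \<in> elts \<alpha>"
      using pair_in_iff[OF p(1)] p(3) is_pair_inj M_trans[OF \<beta> x] y(1) by blast
    then show ?thesis using app_f[OF x y] by simp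
  qed
  have "\<exists>x\<in>elts \<beta>. \<gamma> \<in> elts (app f x)" if \<gamma>: "\<gamma> \<in> elts \<alpha>" for \<gamma>
  proof -
    obtain \<gamma>' where \<gamma>': "\<gamma>' \<in> elts \<alpha>" "\<gamma> \<in> elts \<gamma>'" using Limit_next[OF \<alpha>(2) \<gamma>] by blast
    then obtain \<xi> \<eta> where \<eta>: "\<xi> \<in> elts \<beta>" "\<eta> \<in> elts \<alpha>" "app_in M f \<xi> \<eta>" "\<gamma>' = \<eta> \<or> \<gamma>' \<in> elts \<eta>"
      using f(3) by blast
    have "\<gamma> \<in> elts \<eta>" using \<gamma>'(2) \<eta>(4) Ord_trans[OF Ord_in[OF Limit_Ord[OF \<alpha>(2)] \<eta>(2)]] by blast
    moreover have "app f \<xi> = \<eta>" using app_f[OF \<eta>(1) M_trans[OF \<alpha>(1) \<eta>(2)] \<eta>(3)] .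
    ultimately show ?thesis using \<eta>(1) by blast
  qed
  then show "cof M \<beta> \<alpha>" unfolding cof_def using f(1) range by blast
next
  assume "cof M \<beta> \<alpha>"
  then obtain f where f: "f \<in> M" "\<forall>x\<in>elts \<beta>. app f x \<in> elts \<alpha>"
    "\<forall>\<gamma>\<in>elts \<alpha>. \<exists>x\<in>elts \<beta>. \<gamma> \<in> elts (app f x)" unfolding cof_def by blast
  have "dfb (\<lambda>_ s. s 1 = app f (s 0))" by (intro dfb_rules) (simp add: f)
  from graph[where P = "\<lambda>x y. y = app f x", OF this \<beta> \<alpha>(1)] obtain g where g: "g \<in> M"
    "\<And>p. p \<in> elts g \<longleftrightarrow> (\<exists>x\<in>elts \<beta>. \<exists>y\<in>elts \<alpha>. is_pair p x y \<and> y = app f x)" by blast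
  have app_g: "app_in M g x y \<longleftrightarrow> y = app f x" if x: "x \<in> elts \<beta>" and y: "y \<in> M" for x y
  proof -
    have "x \<in> M" using M_trans[OF \<beta> x] .
    obtain p where "is_pair p x (app f x)" using is_pair_ex[OF \<open>x \<in> M\<close> app_closed[OF f(1) \<open>x \<in> M\<close>]] by blast
    then have "app f x = y \<Longrightarrow> p \<in> elts g \<and> is_pair p x y" using x f(2) g(2) by blast
    moreover have "y = app f x" if "q \<in> elts g" "is_pair q x y" for q
      using that g(2) is_pair_inj by blast
    ultimately show ?thesis unfolding app_in_iff[OF g(1) \<open>x \<in> M\<close> y] by blast
  qed
  have "function_in M g \<beta> \<alpha>"
    unfolding function_in_def
  proof (intro conjI ballI impI)
    fix p assume "p \<in> M" "p \<in> elts g"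
    then obtain x y where xy: "x \<in> elts \<beta>" "y \<in> elts \<alpha>" "is_pair p x y" using g(2) by blast
    have "x \<in> M" "y \<in> M" using M_trans[OF \<beta> xy(1)] M_trans[OF \<alpha>(1) xy(2)] .
    with xy show "\<exists>x\<in>M. \<exists>y\<in>M. x \<in> elts \<beta> \<and> y \<in> elts \<alpha> \<and> pair_in M x y p"
      using pair_in_iff[OF \<open>p \<in> M\<close>] by blast
  next
    fix x assume "x \<in> M" "x \<in> elts \<beta>"
    have "app_in M g x (app f x)"
      using app_g[OF \<open>x \<in> elts \<beta>\<close> app_closed[OF f(1) \<open>x \<in> M\<close>]] by simp
    moreover have "y = app f x" if "y \<in> M" "app_in M g x y" for y
      using app_g[OF \<open>x \<in> elts \<beta>\<close> that(1)] that(2) by simp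
    ultimately show "\<exists>!y. y \<in> M \<and> app_in M g x y"
      using app_closed[OF f(1) \<open>x \<in> M\<close>] by blast
  qed
  moreover have "\<exists>\<xi>\<in>elts \<beta>. \<exists>\<eta>\<in>elts \<alpha>. app_in M g \<xi> \<eta> \<and> (\<gamma> = \<eta> \<or> \<gamma> \<in> elts \<eta>)" if \<gamma>: "\<gamma> \<in> elts \<alpha>" for \<gamma>
  proof -
    obtain x where x: "x \<in> elts \<beta>" "\<gamma> \<in> elts (app f x)" using bspec[OF f(3) \<gamma>] by (rule bexE)
    have "app_in M g x (app f x)"
      using app_g[OF x(1) app_closed[OF f(1) M_trans[OF \<beta> x(1)]]] by simp
    moreover have "app f x \<in> elts \<alpha>" using f(2) x(1) by simp
    ultimately show ?thesis using x by (intro bexI[of _ x] bexI[of _ "app f x"]) simp_all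
  qed
  ultimately have "cofinal_map_in M g \<beta> \<alpha>" by (simp add: cofinal_map_in_def)
  then show "\<exists>f\<in>M. cofinal_map_in M f \<beta> \<alpha>" using g(1) by blast
qed

lemma regular_in_iff: "regular_in M \<alpha> \<longleftrightarrow> \<alpha> \<in> M \<and> reg M \<alpha>"
proof (cases "\<alpha> \<in> M \<and> Limit \<alpha>")
  case True
  then have "(\<exists>f\<in>M. cofinal_map_in M f \<beta> \<alpha>) \<longleftrightarrow> cof M \<beta> \<alpha>" if "\<beta> \<in> elts \<alpha>" for \<beta>
    using cof_iff[OF _ _ M_trans[OF _ that]] by blast
  then show ?thesis unfolding regular_in_def reg_def by simp
qed (auto simp: regular_in_def reg_def)

lemma singular_in_iff: "singular_in M \<alpha> \<longleftrightarrow> \<alpha> \<in> M \<and> Limit \<alpha> \<and> \<not> reg M \<alpha>"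
proof (cases "\<alpha> \<in> M \<and> Limit \<alpha>")
  case True
  then have "(\<exists>f\<in>M. cofinal_map_in M f \<beta> \<alpha>) \<longleftrightarrow> cof M \<beta> \<alpha>" if "\<beta> \<in> elts \<alpha>" for \<beta>
    using cof_iff[OF _ _ M_trans[OF _ that]] by blast
  then show ?thesis unfolding singular_in_def reg_def by auto
qed (auto simp: singular_in_def reg_def)

lemma cof_Limit:
  assumes "cof M \<beta> \<alpha>" "Ord \<alpha>" "elts \<beta> \<noteq> {}"
  shows "Limit \<alpha>"
  using assms unfolding cof_def Limit_def by blast

text \<open>Some \<gamma> lies strictly below no value of \<open>f\<close>; all values are then at
  most \<gamma>, and any \<nu> above \<gamma> in \<theta> is a strict bound.\<close>

lemma not_cof_bounded:
  assumes \<theta>: "Ord \<theta>" and "\<not> cof M \<beta> \<theta>" "f \<in> M" "\<forall>x\<in>elts \<beta>. app f x \<in> elts \<theta>" "Limit \<theta>"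
  shows "\<exists>\<nu>\<in>elts \<theta>. \<forall>x\<in>elts \<beta>. app f x \<in> elts \<nu>"
proof -
  obtain \<gamma> where \<gamma>: "\<gamma> \<in> elts \<theta>" "\<forall>x\<in>elts \<beta>. \<gamma> \<notin> elts (app f x)"
    using assms(2-4) unfolding cof_def by blast
  obtain \<nu> where \<nu>: "\<nu> \<in> elts \<theta>" "\<gamma> \<in> elts \<nu>" using Limit_next[OF assms(5) \<gamma>(1)] by blast
  have "app f x \<in> elts \<nu>" if x: "x \<in> elts \<beta>" for x
  proof -
    have x': "app f x \<in> elts \<theta>" using assms(4) x by blast
    then have "app f x \<in> elts \<gamma> \<or> app f x = \<gamma>"
      using Ord_linear[OF Ord_in[OF \<theta> x'] Ord_in[OF \<theta> \<gamma>(1)]] \<gamma>(2) x by blast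
    then show ?thesis using \<nu>(2) Ord_trans[OF Ord_in[OF \<theta> \<nu>(1)] \<nu>(2)] by blast
  qed
  then show ?thesis using \<nu>(1) by blast
qed

lemma image_ex:
  assumes f: "f \<in> M" and a: "a \<in> M"
  shows "\<exists>b\<in>M. elts b = app f ` elts a"
proof -
  have "dfb (\<lambda>_ s. s 1 = app f (s 0))" by (intro dfb_rules) (simp add: f)
  from replacement[where P = "\<lambda>x y. y = app f x", OF this a] obtain b where
    b: "b \<in> M" "elts b = {y \<in> M. \<exists>x\<in>elts a. y = app f x}"
    using app_closed[OF f M_trans[OF a]] by blast
  have "elts b = app f ` elts a" using b(2) app_closed[OF f M_trans[OF a]] by blast
  then show ?thesis using b(1) by blast
qed

text \<open>Recursion along \<open>omega\<close>, with the predecessor of a stage recognized as its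
  maximal element. The sequence may be defined outside the model, as long as \<open>R\<close> is
  definable and determines each next term.\<close>

lemma iteration:
  assumes R: "dfb (\<lambda>_ s. R (s 0) (s 1))" and i: "\<And>n. i n \<in> M"
    and step: "\<And>n y. y \<in> M \<Longrightarrow> R (i n) y \<longleftrightarrow> y = i (Suc n)"
  shows "\<exists>f\<in>M. \<forall>n. app f (nn n) = i n"
proof -
  let ?I = "\<lambda>\<delta> :: 'v. i (THE n. nn n = \<delta>)"
  have I: "?I (nn n) = i n" for n
  proof -
    have "(THE m. (nn m :: 'v) = nn n) = n" by (rule the_equality) (auto dest: nn_inj)
    then show ?thesis by simp
  qed
  let ?R = "\<lambda>\<delta> f y. ((\<forall>z\<in>elts \<delta>. z \<noteq> z) \<and> y = i 0) \<or>
    (\<exists>m\<in>elts \<delta>. (\<forall>z\<in>elts \<delta>. z \<in> elts m \<or> z = m) \<and> R (app f m) y)"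
  have dR: "dfb (\<lambda>_ s. ?R (s 0) (s 1) (s 2))"
    by (intro dfb_rules dfb_rel2[where P = "\<lambda>_. R", OF R]) (simp add: i)
  have "\<exists>f\<in>M. \<forall>\<delta>\<in>elts omega. app f \<delta> = ?I \<delta>"
  proof (rule recursion[where R = ?R and I = ?I, OF dR omega_in Ord_omega])
    show "?I \<delta> \<in> M" for \<delta> by (rule i)
    fix \<delta> f y
    assume "\<delta> \<in> elts omega" and f: "\<forall>\<gamma>\<in>elts \<delta>. app f \<gamma> = ?I \<gamma>" and y: "y \<in> M"
    then obtain n where n: "\<delta> = nn n" by (auto simp: elts_omega)
    show "?R \<delta> f y \<longleftrightarrow> y = ?I \<delta>"
    proof (cases n)
      case 0
      have "elts \<delta> = {}" unfolding n 0 elts_nn by simp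
      moreover have "?I \<delta> = i 0" unfolding n 0 by (rule I)
      ultimately show ?thesis by simp
    next
      case (Suc k)
      have \<delta>: "elts \<delta> = insert (nn k) (elts (nn k))" unfolding n Suc by (rule elts_nn_Suc)
      have "m = nn k" if "m \<in> elts \<delta>" "\<forall>z\<in>elts \<delta>. z \<in> elts m \<or> z = m" for m
      proof -
        have "nn k \<in> elts m \<or> nn k = m" using that(2) \<delta> by simp
        then show ?thesis using that(1) mem_asym[of m "nn k"] unfolding \<delta> by blast
      qed
      moreover have "\<forall>z\<in>elts \<delta>. z \<in> elts (nn k) \<or> z = nn k" "nn k \<in> elts \<delta>" unfolding \<delta> by simp_all
      moreover have "app f (nn k) = i k"
        using bspec[OF f \<open>nn k \<in> elts \<delta>\<close>] I[of k] by simp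
      ultimately have "?R \<delta> f y \<longleftrightarrow> R (i k) y" by metis
      then show ?thesis using step[OF y, of k] I[of "Suc k"] unfolding n Suc by simp
    qed
  qed
  then show ?thesis using I nn_in_omega by metis
qed

text \<open>Zermelo's argument: keep choosing from the part of \<open>x\<close> not yet listed. The
  enumeration must stop, since otherwise the ordinals of \<open>M\<close> would form a set of
  \<open>M\<close>.\<close>

lemma well_ordering:
  assumes x: "x \<in> M"
  shows "\<exists>\<alpha>\<in>M. Ord \<alpha> \<and> (\<exists>h\<in>M. app h ` elts \<alpha> = elts x \<and> inj_on (app h) (elts \<alpha>))"
proof -
  obtain px where px: "px \<in> M" "elts px = {z \<in> M. elts z \<subseteq> elts x}" using power[OF x] by blast
  have "dfb (\<lambda>_ s. \<not> (\<forall>z\<in>elts (s 0). z \<noteq> z))" by (intro dfb_rules)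
  from separation[OF this px(1)] obtain nx where
    nx: "nx \<in> M" "elts nx = {B \<in> elts px. \<not> (\<forall>z\<in>elts B. z \<noteq> z)}" by blast
  have "dfb (\<lambda>_ s. s 1 \<in> elts (s 0))" by (intro dfb_rules)
  moreover have "\<exists>y\<in>elts x. y \<in> elts B" if "B \<in> elts nx" for B using that nx(2) px(2) by blast
  ultimately have "\<exists>f\<in>M. \<forall>B\<in>elts nx. app f B \<in> elts x \<and> app f B \<in> elts B"
    using choice[where P = "\<lambda>B y. y \<in> elts B", OF _ nx(1) x] by blast
  then obtain ch where ch: "ch \<in> M" "\<And>B. B \<in> M \<Longrightarrow> elts B \<subseteq> elts x \<Longrightarrow> elts B \<noteq> {} \<Longrightarrow> app ch B \<in> elts B"
    using nx(2) px(2) by auto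
  \<comment> \<open>The enumeration is defined on the whole universe and outside \<open>M\<close>;
    \<open>approx\<close> later puts its restriction to each ordinal of \<open>M\<close> into
    \<open>M\<close>. Once \<open>x\<close> is exhausted its values carry no meaning.\<close>
  define I where "I = wfrec {(y, z::'v). y \<in> elts z} (\<lambda>I \<delta>. app ch (mk (elts x - I ` elts \<delta>)))"
  have I: "I \<delta> = app ch (mk (elts x - I ` elts \<delta>))" for \<delta>
  proof -
    have "cut I {(y, z). y \<in> elts z} \<delta> ` elts \<delta> = I ` elts \<delta>" by (auto simp: cut_def)
    then show ?thesis unfolding I_def by (subst wfrec[OF wf_elts]) simp
  qed
  let ?R = "\<lambda>\<delta> f y. \<exists>B\<in>M. (\<forall>z\<in>M. z \<in> elts B \<longleftrightarrow> z \<in> elts x \<and> (\<forall>\<gamma>\<in>elts \<delta>. app f \<gamma> \<noteq> z)) \<and> y = app ch B"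
  have R: "dfb (\<lambda>_ s. ?R (s 0) (s 1) (s 2))" by (intro dfb_rules) (simp_all add: x ch)
  have rest: "\<exists>B\<in>M. elts B = elts x - I ` elts \<delta>"
    if "\<delta> \<in> M" "f \<in> M" "\<forall>\<gamma>\<in>elts \<delta>. app f \<gamma> = I \<gamma>" for \<delta> f
  proof -
    have "dfb (\<lambda>_ s. \<forall>\<gamma>\<in>elts \<delta>. app f \<gamma> \<noteq> s 0)" by (intro dfb_rules) (simp_all add: that)
    from separation[OF this x] obtain B where "B \<in> M" "elts B = {z \<in> elts x. \<forall>\<gamma>\<in>elts \<delta>. app f \<gamma> \<noteq> z}" by blast
    moreover have "{z \<in> elts x. \<forall>\<gamma>\<in>elts \<delta>. app f \<gamma> \<noteq> z} = elts x - I ` elts \<delta>" using that(3) by auto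
    ultimately show ?thesis by auto
  qed
  have RI: "?R \<delta> f y \<longleftrightarrow> y = I \<delta>"
    if \<delta>: "\<delta> \<in> M" and f: "f \<in> M" and agree: "\<forall>\<gamma>\<in>elts \<delta>. app f \<gamma> = I \<gamma>" for \<delta> f y
  proof -
    obtain B where B: "B \<in> M" "elts B = elts x - I ` elts \<delta>" using rest[OF \<delta> f agree] by blast
    have B_iff: "(\<forall>z\<in>M. z \<in> elts B' \<longleftrightarrow> z \<in> elts x \<and> (\<forall>\<gamma>\<in>elts \<delta>. app f \<gamma> \<noteq> z)) \<longleftrightarrow> B' = B" if "B' \<in> M" for B'
    proof -
      have "(\<forall>z\<in>M. z \<in> elts B' \<longleftrightarrow> z \<in> elts x \<and> (\<forall>\<gamma>\<in>elts \<delta>. app f \<gamma> \<noteq> z)) \<longleftrightarrow>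
          (\<forall>z\<in>M. z \<in> elts B' \<longleftrightarrow> z \<in> elts B)"
        unfolding B(2) using agree by auto
      also have "\<dots> \<longleftrightarrow> elts B' = elts B" using M_trans[OF that] M_trans[OF B(1)] by blast
      finally show ?thesis by (simp add: elts_eq_iff)
    qed
    have "I \<delta> = app ch B" unfolding I[of \<delta>] B(2)[symmetric] mk_eq[OF refl] ..
    then show ?thesis using B_iff B(1) by auto
  qed
  have IM: "I \<delta> \<in> M" if \<delta>: "\<delta> \<in> M" and f: "f \<in> M" and agree: "\<forall>\<gamma>\<in>elts \<delta>. app f \<gamma> = I \<gamma>" for \<delta> f
  proof -
    obtain B where B: "B \<in> M" "elts B = elts x - I ` elts \<delta>" using rest[OF \<delta> f agree] by blast
    have "I \<delta> = app ch B" unfolding I[of \<delta>] B(2)[symmetric] mk_eq[OF refl] ..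
    then show ?thesis using app_closed[OF ch(1) B(1)] by simp
  qed
  have approx: "Ord \<alpha> \<Longrightarrow> \<alpha> \<in> M \<Longrightarrow> \<exists>f\<in>M. \<forall>\<delta>\<in>elts \<alpha>. app f \<delta> = I \<delta>" for \<alpha>
  proof (induction \<alpha> rule: elts_induct)
    case (step \<alpha>)
    show ?case
    proof (rule recursion[where R = ?R and I = I, OF R step.prems(2,1)])
      fix \<delta> assume \<delta>: "\<delta> \<in> elts \<alpha>"
      obtain f where "f \<in> M" "\<forall>\<gamma>\<in>elts \<delta>. app f \<gamma> = I \<gamma>"
        using step.IH[OF \<delta> Ord_in[OF step.prems(1) \<delta>] M_trans[OF step.prems(2) \<delta>]] by blast
      then show "I \<delta> \<in> M" using IM M_trans[OF step.prems(2) \<delta>] by blast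
    next
      fix \<delta> f y assume "\<delta> \<in> elts \<alpha>" "f \<in> M" "\<forall>\<gamma>\<in>elts \<delta>. app f \<gamma> = I \<gamma>"
      then show "?R \<delta> f y \<longleftrightarrow> y = I \<delta>" using RI M_trans[OF step.prems(2)] by blast
    qed
  qed
  have new: "I \<delta> \<in> elts x - I ` elts \<delta>"
    if \<delta>: "Ord \<delta>" "\<delta> \<in> M" and ne: "\<not> elts x \<subseteq> I ` elts \<delta>" for \<delta>
  proof -
    obtain f where f: "f \<in> M" "\<forall>\<gamma>\<in>elts \<delta>. app f \<gamma> = I \<gamma>" using approx[OF \<delta>] by blast
    obtain B where B: "B \<in> M" "elts B = elts x - I ` elts \<delta>" using rest[OF \<delta>(2) f] by blast
    have "I \<delta> = app ch B" unfolding I[of \<delta>] B(2)[symmetric] mk_eq[OF refl] ..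
    moreover have "app ch B \<in> elts B" by (rule ch(2)[OF B(1)]) (use B(2) ne in auto)
    ultimately show ?thesis using B(2) by simp
  qed
  have inj: "\<delta> = \<delta>'"
    if "Ord \<delta>" "\<delta> \<in> M" "\<not> elts x \<subseteq> I ` elts \<delta>" "Ord \<delta>'" "\<delta>' \<in> M" "\<not> elts x \<subseteq> I ` elts \<delta>'" "I \<delta> = I \<delta>'" for \<delta> \<delta>'
    using new[OF that(1-3)] new[OF that(4-6)] that(7) Ord_linear[OF that(1,4)]
      imageI[of \<delta> "elts \<delta>'" I] imageI[of \<delta>' "elts \<delta>" I] by auto
  show ?thesis
  proof (cases "\<exists>\<alpha>. Ord \<alpha> \<and> \<alpha> \<in> M \<and> elts x \<subseteq> I ` elts \<alpha>")
    case True
    then obtain \<alpha>0 where "Ord \<alpha>0" "\<alpha>0 \<in> M \<and> elts x \<subseteq> I ` elts \<alpha>0" by blast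
    from Ord_least[where P = "\<lambda>\<alpha>. \<alpha> \<in> M \<and> elts x \<subseteq> I ` elts \<alpha>", OF this]
    obtain \<alpha> where \<alpha>: "Ord \<alpha>" "\<alpha> \<in> M" "elts x \<subseteq> I ` elts \<alpha>"
      and least: "\<And>\<gamma>. \<gamma> \<in> elts \<alpha> \<Longrightarrow> \<not> (\<gamma> \<in> M \<and> elts x \<subseteq> I ` elts \<gamma>)" by metis
    obtain f where f: "f \<in> M" "\<forall>\<gamma>\<in>elts \<alpha>. app f \<gamma> = I \<gamma>" using approx[OF \<alpha>(1,2)] by blast
    have below: "Ord \<delta> \<and> \<delta> \<in> M \<and> \<not> elts x \<subseteq> I ` elts \<delta>" if "\<delta> \<in> elts \<alpha>" for \<delta>
      using least[OF that] Ord_in[OF \<alpha>(1) that] M_trans[OF \<alpha>(2) that] by blast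
    have "I ` elts \<alpha> \<subseteq> elts x" using new below by blast
    moreover have "app f ` elts \<alpha> = I ` elts \<alpha>" using f(2) by simp
    moreover have "inj_on (app f) (elts \<alpha>)"
    proof (rule inj_onI)
      fix \<delta> \<delta>' assume "\<delta> \<in> elts \<alpha>" "\<delta>' \<in> elts \<alpha>" "app f \<delta> = app f \<delta>'"
      then show "\<delta> = \<delta>'" using inj[of \<delta> \<delta>'] below[of \<delta>] below[of \<delta>'] f(2) by simp
    qed
    ultimately show ?thesis using \<alpha> f(1) by (intro bexI[of _ \<alpha>] conjI bexI[of _ f]) auto
  next
    case False
    \<comment> \<open>If \<open>x\<close> is never exhausted, \<open>I\<close> is injective on the
      ordinals of \<open>M\<close>. Replacement along its inverse collects all of them into a set
      \<open>b\<close> of \<open>M\<close>, which is then itself an ordinal and hence its own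
      element.\<close>
    let ?Q = "\<lambda>\<delta> y. \<exists>f\<in>M. (\<forall>\<epsilon>\<in>elts \<delta>. ?R \<epsilon> f (app f \<epsilon>)) \<and> ?R \<delta> f y"
    have Q: "?Q \<delta> y \<longleftrightarrow> y = I \<delta>" if \<delta>: "Ord \<delta>" "\<delta> \<in> M" and y: "y \<in> M" for \<delta> y
    proof -
      obtain f where f: "f \<in> M" "\<forall>\<gamma>\<in>elts \<delta>. app f \<gamma> = I \<gamma>" using approx[OF \<delta>] by blast
      show ?thesis
      proof (rule recursion_graph[OF \<delta>(2,1) _ _ f y])
        fix \<epsilon> assume \<epsilon>: "\<epsilon> \<in> elts \<delta>"
        then show "I \<epsilon> \<in> M"
          using new[OF Ord_in[OF \<delta>(1) \<epsilon>] M_trans[OF \<delta>(2) \<epsilon>]] False M_trans[OF x]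
            Ord_in[OF \<delta>(1) \<epsilon>] M_trans[OF \<delta>(2) \<epsilon>] by blast
      next
        fix \<epsilon> f y assume "\<epsilon> = \<delta> \<or> \<epsilon> \<in> elts \<delta>" "f \<in> M" "\<forall>\<gamma>\<in>elts \<epsilon>. app f \<gamma> = I \<gamma>"
        then show "?R \<epsilon> f y \<longleftrightarrow> y = I \<epsilon>" using RI \<delta>(2) M_trans[OF \<delta>(2)] by blast
      qed
    qed
    have "dfb (\<lambda>_ s. \<exists>\<delta>\<in>M. Ord \<delta> \<and> ?Q \<delta> (s 0))" by (intro dfb_rules) (simp_all add: x ch)
    from separation[OF this x] obtain d where
      d: "d \<in> M" "elts d = {y \<in> elts x. \<exists>\<delta>\<in>M. Ord \<delta> \<and> ?Q \<delta> y}" by blast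
    have d_iff: "y \<in> elts d \<longleftrightarrow> (\<exists>\<delta>\<in>M. Ord \<delta> \<and> y = I \<delta>)" for y
    proof
      assume "y \<in> elts d"
      then obtain \<delta> where "\<delta> \<in> M" "Ord \<delta>" "?Q \<delta> y" and y: "y \<in> elts x" unfolding d(2) by blast
      then show "\<exists>\<delta>\<in>M. Ord \<delta> \<and> y = I \<delta>" using Q[of \<delta> y] M_trans[OF x y] by blast
    next
      assume "\<exists>\<delta>\<in>M. Ord \<delta> \<and> y = I \<delta>"
      then obtain \<delta> where \<delta>: "\<delta> \<in> M" "Ord \<delta>" "y = I \<delta>" by blast
      then have y: "y \<in> elts x" using new[OF \<delta>(2,1)] False by blast
      then have "?Q \<delta> y" using Q[OF \<delta>(2,1) M_trans[OF x y]] \<delta>(3) by blast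
      then show "y \<in> elts d" unfolding d(2) using y \<delta>(1,2) by blast
    qed
    have "dfb (\<lambda>_ s. Ord (s 1) \<and> ?Q (s 1) (s 0))" by (intro dfb_rules) (simp_all add: x ch)
    moreover have "\<exists>!\<delta>. \<delta> \<in> M \<and> Ord \<delta> \<and> ?Q \<delta> y" if y: "y \<in> elts d" for y
    proof -
      obtain \<delta> where \<delta>: "\<delta> \<in> M" "Ord \<delta>" "y = I \<delta>" using y d_iff by blast
      have yM: "y \<in> M" using M_trans[OF d(1) y] .
      show ?thesis
      proof (rule ex1I[of _ \<delta>])
        show "\<delta> \<in> M \<and> Ord \<delta> \<and> ?Q \<delta> y" using \<delta> Q[OF \<delta>(2,1) yM] by blast
        fix \<delta>' assume \<delta>': "\<delta>' \<in> M \<and> Ord \<delta>' \<and> ?Q \<delta>' y"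
        then have "y = I \<delta>'" using Q[of \<delta>' y] yM by blast
        then show "\<delta>' = \<delta>" using inj[of \<delta>' \<delta>] \<delta> \<delta>' False by blast
      qed
    qed
    ultimately have "\<exists>b\<in>M. elts b = {\<delta> \<in> M. \<exists>y\<in>elts d. Ord \<delta> \<and> ?Q \<delta> y}"
      by (rule replacement[where P = "\<lambda>y \<delta>. Ord \<delta> \<and> ?Q \<delta> y", OF _ d(1)])
    then obtain b where b: "b \<in> M" "elts b = {\<delta> \<in> M. \<exists>y\<in>elts d. Ord \<delta> \<and> ?Q \<delta> y}"
      by (rule bexE)
    have b_iff: "\<delta> \<in> elts b \<longleftrightarrow> \<delta> \<in> M \<and> Ord \<delta>" for \<delta>
    proof
      assume \<delta>: "\<delta> \<in> M \<and> Ord \<delta>"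
      then have y: "I \<delta> \<in> elts d" using d_iff by blast
      then have "?Q \<delta> (I \<delta>)" using Q[of \<delta> "I \<delta>"] M_trans[OF d(1) y] \<delta> by blast
      then show "\<delta> \<in> elts b" unfolding b(2) using \<delta> y by blast
    qed (use b(2) in blast)
    have "Ord b"
    proof (rule OrdI)
      show "\<gamma> \<in> elts b" if "\<beta> \<in> elts b" "\<gamma> \<in> elts \<beta>" for \<beta> \<gamma>
        using that M_trans[of \<beta> \<gamma>] Ord_in[of \<beta> \<gamma>] by (simp add: b_iff)
    qed (simp add: b_iff)
    then show ?thesis using mem_irrefl[of b] b(1) by (simp add: b_iff)
  qed
qed

text \<open>Closing under pairs in \<omega> steps gives a set whose elements code the pairs of its
  elements. This stands in for the cardinal arithmetic of the product of an infinite set with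
  itself.\<close>

lemma pair_closure:
  assumes l: "l \<in> M"
  shows "\<exists>A\<in>M. elts l \<subseteq> elts A \<and> (\<forall>x\<in>elts A. \<forall>y\<in>elts A. \<forall>p. is_pair p x y \<longrightarrow> p \<in> elts A)"
proof -
  let ?next = "\<lambda>x. elts x \<union> {p. \<exists>a\<in>elts x. \<exists>b\<in>elts x. is_pair p a b}"
  define i where "i = rec_nat l (\<lambda>_ x. mk (?next x))"
  have next_ex: "\<exists>y\<in>M. elts y = ?next x" if x: "x \<in> M" for x
  proof -
    obtain c where c: "c \<in> M" "\<And>p. p \<in> elts c \<longleftrightarrow> (\<exists>a\<in>elts x. \<exists>b\<in>elts x. is_pair p a b)"
      using product[OF x x] by blast
    obtain y where "y \<in> M" "elts y = elts x \<union> elts c" using union2[OF x c(1)] by blast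
    then show ?thesis using c(2) by blast
  qed
  have i: "i n \<in> M \<and> elts (i (Suc n)) = ?next (i n)" for n
  proof (induction n)
    case 0
    obtain y where "y \<in> M" "elts y = ?next l" using next_ex[OF l] by blast
    then show ?case using mk_eq[of y "?next l"] l by (simp add: i_def)
  next
    case (Suc n)
    have *: "mk (?next (i n)) = y \<Longrightarrow> i (Suc n) = y" for n y by (simp add: i_def)
    obtain y where y: "y \<in> M" "elts y = ?next (i n)" using next_ex Suc by blast
    have "i (Suc n) = y" by (rule *[OF mk_eq[OF y(2)]])
    with y(1) have "i (Suc n) \<in> M" by simp
    obtain z where z: "z \<in> M" "elts z = ?next (i (Suc n))" using next_ex[OF \<open>i (Suc n) \<in> M\<close>] by blast
    have "i (Suc (Suc n)) = z" by (rule *[OF mk_eq[OF z(2)]])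
    with z(2) \<open>i (Suc n) \<in> M\<close> show ?case by simp
  qed
  let ?R = "\<lambda>x y. \<forall>p\<in>M. p \<in> elts y \<longleftrightarrow> p \<in> elts x \<or> (\<exists>a\<in>elts x. \<exists>b\<in>elts x. is_pair p a b)"
  have "\<exists>f\<in>M. \<forall>n. app f (nn n) = i n"
  proof (rule iteration[where R = ?R])
    show "dfb (\<lambda>_ s. ?R (s 0) (s 1))" by (intro dfb_rules)
    show "i n \<in> M" for n using i by blast
    fix n y assume y: "y \<in> M"
    have "?R (i n) y \<longleftrightarrow> (\<forall>p\<in>M. p \<in> elts y \<longleftrightarrow> p \<in> elts (i (Suc n)))" using i by simp
    also have "\<dots> \<longleftrightarrow> elts y = elts (i (Suc n))"
      using M_trans[OF y] M_trans[OF conjunct1[OF i[of "Suc n"]]] by blast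
    finally show "?R (i n) y \<longleftrightarrow> y = i (Suc n)" by (simp add: elts_eq_iff)
  qed
  then obtain f where f: "f \<in> M" "\<And>n. app f (nn n) = i n" by blast
  obtain b where b: "b \<in> M" "elts b = app f ` elts omega" using image_ex[OF f(1) omega_in] by blast
  obtain A where A: "A \<in> M" "elts A = (\<Union>y\<in>elts b. elts y)" using union[OF b(1)] by blast
  have "elts b = range i" unfolding b(2) elts_omega using f(2) by (simp add: image_image)
  then have eA: "elts A = (\<Union>n. elts (i n))" using A(2) by simp
  have mono: "elts (i m) \<subseteq> elts (i n)" if "m \<le> n" for m n
    by (rule lift_Suc_mono_le[of "\<lambda>n. elts (i n)", OF _ that]) (simp add: i)
  have "p \<in> elts A" if xy: "x \<in> elts A" "y \<in> elts A" and p: "is_pair p x y" for x y p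
  proof -
    obtain m n where "x \<in> elts (i m)" "y \<in> elts (i n)" using xy unfolding eA by blast
    then have "x \<in> elts (i (max m n))" "y \<in> elts (i (max m n))"
      using mono[of m "max m n"] mono[of n "max m n"] by auto
    then have "p \<in> elts (i (Suc (max m n)))" using i p by blast
    then show ?thesis unfolding eA by blast
  qed
  moreover have "elts l \<subseteq> elts A" unfolding eA using UN_upper[of 0 UNIV "\<lambda>n. elts (i n)"] by (simp add: i_def)
  ultimately show ?thesis using A(1) by blast
qed

text \<open>Cantor's diagonal set, formed by separation in \<open>M\<close>.\<close>

lemma not_onto_power:
  assumes x: "x \<in> M" and p: "p \<in> M" "elts p = {z \<in> M. elts z \<subseteq> elts x}"
  shows "\<not> onto M x p"
proof
  assume "onto M x p"
  then obtain e where e: "e \<in> M" "\<forall>B\<in>elts p. \<exists>a\<in>elts x. app e a = B" unfolding onto_def by blast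
  have "dfb (\<lambda>_ s. s 0 \<notin> elts (app e (s 0)))" by (intro dfb_rules) (simp add: e)
  from separation[OF this x] obtain D where D: "D \<in> M" "elts D = {a \<in> elts x. a \<notin> elts (app e a)}" by blast
  then obtain a where "a \<in> elts x" "app e a = D" using e(2) p(2) by blast
  then show False using D(2) by blast
qed

lemma onto_trans:
  assumes "a \<in> M" "onto M a b" "onto M b c"
  shows "onto M a c"
proof -
  obtain e where e: "e \<in> M" "\<forall>y\<in>elts b. \<exists>x\<in>elts a. app e x = y" using assms(2) unfolding onto_def by blast
  obtain h where h: "h \<in> M" "\<forall>y\<in>elts c. \<exists>x\<in>elts b. app h x = y" using assms(3) unfolding onto_def by blast
  have "dfb (\<lambda>_ s. s 1 = app h (app e (s 0)))" by (intro dfb_rules) (simp_all add: e h)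
  from function_replacement[where P = "\<lambda>x y. y = app h (app e x)" and F = "\<lambda>x. app h (app e x)", OF this assms(1)]
  obtain k where "k \<in> M" "\<forall>x\<in>elts a. app k x = app h (app e x)"
    using app_closed[OF h(1) app_closed[OF e(1) M_trans[OF assms(1)]]] by blast
  then have "\<forall>y\<in>elts c. \<exists>x\<in>elts a. app k x = y" using e(2) h(2) by metis
  then show ?thesis unfolding onto_def using \<open>k \<in> M\<close> by blast
qed

lemma onto_superset:
  assumes a: "a \<in> M" and sub: "elts b \<subseteq> elts a"
  shows "onto M a b"
proof -
  have "dfb (\<lambda>_ s. s 1 = s 0)" by (intro dfb_rules)
  from function_replacement[where P = "\<lambda>x y. y = x" and F = "\<lambda>x. x", OF this a M_trans[OF a]]
  obtain k where "k \<in> M" "\<forall>x\<in>elts a. app k x = x" by blast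
  then show ?thesis unfolding onto_def using sub by blast
qed

text \<open>An ordinal enumerating the power set of \<open>A\<close> works: were \<open>A\<close>
  mapped onto it, composition would map \<open>A\<close> onto its power set.\<close>

lemma ex_not_onto:
  assumes A: "A \<in> M"
  shows "\<exists>\<alpha>\<in>M. Ord \<alpha> \<and> \<not> onto M A \<alpha>"
proof -
  obtain p where p: "p \<in> M" "elts p = {z \<in> M. elts z \<subseteq> elts A}" using power[OF A] by blast
  obtain \<alpha> h where \<alpha>: "\<alpha> \<in> M" "Ord \<alpha>" and h: "h \<in> M" "app h ` elts \<alpha> = elts p"
    using well_ordering[OF p(1)] by blast
  have "onto M \<alpha> p" unfolding onto_def using h by (metis imageE)
  then show ?thesis using onto_trans[OF A] not_onto_power[OF A p] \<alpha> by blast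
qed

end

section \<open>Regular ordinals, ladder systems and a pressing-down argument\<close>

definition ladder :: "'v::set_universe set \<Rightarrow> 'v \<Rightarrow> 'v \<Rightarrow> bool" where
  "ladder M \<theta> a \<longleftrightarrow> (\<forall>\<xi>\<in>elts \<theta>. cof M omega \<xi> \<longrightarrow> (\<forall>n\<in>elts omega. app (app a \<xi>) n \<in> elts \<xi>) \<and>
     (\<forall>\<gamma>\<in>elts \<xi>. \<exists>n\<in>elts omega. \<gamma> \<in> elts (app (app a \<xi>) n)))"

text \<open>
  \<open>pos M \<theta> a \<gamma>\<close> says that \<open>{\<xi> < \<theta>. \<gamma> \<in> ran (a \<xi>)}\<close> is stationary in the points of cofinality \<open>\<omega>\<close>; clubs
  are represented by the functions under which their elements are closed.
\<close>

definition pos :: "'v::set_universe set \<Rightarrow> 'v \<Rightarrow> 'v \<Rightarrow> 'v \<Rightarrow> bool" where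
  "pos M \<theta> a \<gamma> \<longleftrightarrow> (\<forall>g\<in>M. (\<forall>x\<in>elts \<theta>. app g x \<in> elts \<theta>) \<longrightarrow>
     (\<exists>\<xi>\<in>elts \<theta>. cof M omega \<xi> \<and> (\<forall>x\<in>elts \<xi>. app g x \<in> elts \<xi>) \<and>
        (\<exists>n\<in>elts omega. app (app a \<xi>) n = \<gamma>)))"

lemma (in models) dfb_pos [dfb_rules]:
  "tm t \<Longrightarrow> tm u \<Longrightarrow> tm v \<Longrightarrow> dfb (\<lambda>i s. pos (Mod i) (t i s) (u i s) (v i s))"
proof (rule dfb_rel3[where P = "\<lambda>i. pos (Mod i)"])
  show "dfb (\<lambda>i s. pos (Mod i) (s 0) (s 1) (s 2))"
    unfolding pos_def by (intro dfb_rules)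
qed

context tmodel
begin

text \<open>Choose the witnesses by a function of \<open>M\<close>; regularity bounds its values
  below \<theta>.\<close>

lemma reg_collection:
  assumes \<theta>: "reg M \<theta>" "\<theta> \<in> M" and \<beta>: "\<beta> \<in> elts \<theta>" and P: "dfb (\<lambda>_ s. P (s 0) (s 1))"
    and ex: "\<And>x. x \<in> elts \<beta> \<Longrightarrow> \<exists>y\<in>elts \<theta>. P x y"
  shows "\<exists>\<nu>\<in>elts \<theta>. \<forall>x\<in>elts \<beta>. \<exists>y\<in>elts \<nu>. P x y"
proof -
  obtain f where f: "f \<in> M" "\<forall>x\<in>elts \<beta>. app f x \<in> elts \<theta> \<and> P x (app f x)"
    using choice[where P = P, OF P M_trans[OF \<theta>(2) \<beta>] \<theta>(2) ex] by blast
  have "Limit \<theta>" "\<not> cof M \<beta> \<theta>" using \<theta>(1) \<beta> unfolding reg_def by auto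
  from not_cof_bounded[OF Limit_Ord[OF this(1)] this(2) f(1) _ this(1)] f(2)
  show ?thesis by blast
qed

text \<open>Choosing one covering function for each \<xi> at once requires a set of candidates, for
  which \<open>function_space\<close> is used; the functions must first be made to take values in
  \<theta>.\<close>

lemma onto_enumeration:
  assumes A: "A \<in> M" and \<theta>: "\<theta> \<in> M" and onto: "\<And>\<xi>. \<xi> \<in> elts \<theta> \<Longrightarrow> onto M A \<xi>"
    and ord: "Ord \<theta>"
  shows "\<exists>E\<in>M. \<forall>\<xi>\<in>elts \<theta>. \<forall>y\<in>elts \<xi>. \<exists>x\<in>elts A. app (app E \<xi>) x = y"
proof -
  obtain F where F: "F \<in> M"
    "\<forall>f\<in>M. (\<forall>x\<in>elts A. app f x \<in> elts \<theta>) \<longrightarrow> (\<exists>f'\<in>elts F. \<forall>x\<in>elts A. app f' x = app f x)"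
    using function_space[OF A \<theta>] by blast
  let ?P = "\<lambda>\<xi> e. \<forall>y\<in>elts \<xi>. \<exists>x\<in>elts A. app e x = y"
  have "dfb (\<lambda>_ s. ?P (s 0) (s 1))" by (intro dfb_rules) (simp add: A)
  moreover have "\<exists>e\<in>elts F. ?P \<xi> e" if \<xi>: "\<xi> \<in> elts \<theta>" for \<xi>
  proof -
    obtain e where e: "e \<in> M" "\<forall>y\<in>elts \<xi>. \<exists>x\<in>elts A. app e x = y"
      using onto[OF \<xi>] unfolding onto_def by blast
    \<comment> \<open>Stray values outside \<theta> are replaced by \<xi>, a convenient element of
      \<theta>. Values below \<xi> are unchanged, so \<xi> is still covered.\<close>
    let ?F = "\<lambda>x. if app e x \<in> elts \<theta> then app e x else \<xi>"
    have "dfb (\<lambda>_ s. (app e (s 0) \<in> elts \<theta> \<and> s 1 = app e (s 0)) \<or> (app e (s 0) \<notin> elts \<theta> \<and> s 1 = \<xi>))"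
      by (intro dfb_rules) (simp_all add: e \<theta> M_trans[OF \<theta> \<xi>])
    from function_replacement[where P = "\<lambda>x y. (app e x \<in> elts \<theta> \<and> y = app e x) \<or> (app e x \<notin> elts \<theta> \<and> y = \<xi>)"
        and F = ?F, OF this A] M_trans[OF \<theta>] \<xi>
    have "\<exists>f\<in>M. \<forall>x\<in>elts A. app f x = ?F x" by simp
    then obtain e' where e': "e' \<in> M" "\<forall>x\<in>elts A. app e' x = ?F x" by (rule bexE)
    then obtain e'' where e'': "e'' \<in> elts F" "\<forall>x\<in>elts A. app e'' x = app e' x"
      using F(2) \<xi> by auto
    have "\<exists>x\<in>elts A. app e'' x = y" if y: "y \<in> elts \<xi>" for y
    proof -
      obtain x where x: "x \<in> elts A" "app e x = y" using bspec[OF e(2) y] by (rule bexE)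
      moreover have "y \<in> elts \<theta>" using Ord_trans[OF ord \<xi> y] .
      ultimately show ?thesis using e'(2) e''(2) by (intro bexI[of _ x]) simp_all
    qed
    then show ?thesis using e''(1) by blast
  qed
  ultimately have "\<exists>E\<in>M. \<forall>\<xi>\<in>elts \<theta>. app E \<xi> \<in> elts F \<and> ?P \<xi> (app E \<xi>)"
    by (rule choice[where P = ?P, OF _ \<theta> F(1)])
  then show ?thesis by blast
qed

text \<open>
  The ordinals that are images of a set closed under pairs form a successor cardinal, which is regular
  by choice.
\<close>

lemma regular_above:
  assumes l: "l \<in> M" "Ord l" "omega \<in> elts l"
  shows "\<exists>\<theta>\<in>M. l \<in> elts \<theta> \<and> reg M \<theta>"
proof -
  obtain A where A: "A \<in> M" "elts l \<subseteq> elts A"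
    "\<And>x y p. x \<in> elts A \<Longrightarrow> y \<in> elts A \<Longrightarrow> is_pair p x y \<Longrightarrow> p \<in> elts A"
    using pair_closure[OF l(1)] by blast
  \<comment> \<open>The numbers 0 and 1 will serve as tags in coded pairs.\<close>
  have nnA: "nn n \<in> elts A" for n using A(2) Ord_trans[OF l(2,3) nn_in_omega] by blast
  obtain \<alpha> where \<alpha>: "Ord \<alpha>" "\<alpha> \<in> M \<and> \<not> onto M A \<alpha>" using ex_not_onto[OF A(1)] by blast
  obtain \<theta> where ord: "Ord \<theta>" and \<theta>: "\<theta> \<in> M" "\<not> onto M A \<theta>"
    and least: "\<And>\<xi>. \<xi> \<in> elts \<theta> \<Longrightarrow> onto M A \<xi>"
    using Ord_least[where P = "\<lambda>\<alpha>. \<alpha> \<in> M \<and> \<not> onto M A \<alpha>", OF \<alpha>] M_trans by metis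
  have l\<theta>: "l \<in> elts \<theta>"
  proof (rule ccontr)
    assume "l \<notin> elts \<theta>"
    then have "\<theta> = l \<or> \<theta> \<in> elts l" using Ord_linear[OF ord l(2)] by blast
    then have "elts \<theta> \<subseteq> elts A" using A(2) Ord_trans[OF l(2)] by blast
    then show False using onto_superset[OF A(1)] \<theta>(2) by blast
  qed
  have lim: "Limit \<theta>"
    unfolding Limit_def
  proof (intro conjI ballI)
    fix \<xi> assume \<xi>: "\<xi> \<in> elts \<theta>"
    have \<xi>M: "\<xi> \<in> M" using M_trans[OF \<theta>(1) \<xi>] .
    obtain e where e: "e \<in> M" "\<forall>y\<in>elts \<xi>. \<exists>x\<in>elts A. app e x = y"
      using least[OF \<xi>] unfolding onto_def by blast
    show "\<exists>\<gamma>\<in>elts \<theta>. \<xi> \<in> elts \<gamma>"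
    proof (rule ccontr)
      assume "\<not> ?thesis"
      then have "\<gamma> \<in> elts \<xi> \<or> \<gamma> = \<xi>" if "\<gamma> \<in> elts \<theta>" for \<gamma>
        using Ord_linear[OF Ord_in[OF ord that] Ord_in[OF ord \<xi>]] that by blast
      then have \<theta>\<xi>: "elts \<theta> = insert \<xi> (elts \<xi>)" using Ord_trans[OF ord \<xi>] \<xi> by blast
      \<comment> \<open>If \<xi> were the last element of \<theta>, then \<open>A\<close> would
        cover \<theta>: pairs tagged 0 are decoded by \<open>e\<close> and cover \<xi>, and all
        other elements of \<open>A\<close> go to \<xi> itself. The pair of 1 with 1 shows that the
        second case occurs.\<close>
      let ?P = "\<lambda>x y. (\<exists>b\<in>elts A. is_pair x (nn 0) b \<and> y = app e b) \<or>
        (\<not> (\<exists>b\<in>elts A. is_pair x (nn 0) b) \<and> y = \<xi>)"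
      have dP: "dfb (\<lambda>_ s. ?P (s 0) (s 1))" by (intro dfb_rules) (simp_all add: A e \<xi>M nn_in del: nn.simps)
      have single: "\<forall>x\<in>elts A. \<forall>y\<in>elts \<theta>. \<forall>y'\<in>elts \<theta>. ?P x y \<longrightarrow> ?P x y' \<longrightarrow> y' = y"
        using is_pair_inj by blast
      obtain k where k: "k \<in> M" "\<forall>x\<in>elts A. \<forall>y\<in>elts \<theta>. ?P x y \<longrightarrow> app k x = y"
        using function_ex[where P = ?P, OF dP A(1) \<theta>(1) single] by blast
      have "\<exists>x\<in>elts A. app k x = y" if y: "y \<in> elts \<theta>" for y
      proof (cases "y = \<xi>")
        case True
        obtain p where p: "is_pair p (nn 1) (nn 1 :: 'v)" using is_pair_ex[OF nn_in[of 1] nn_in[of 1]] by blast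
        have "nn 0 \<noteq> (nn 1 :: 'v)" using nn_inj[of 0 1] zero_neq_one by blast
        then have "\<not> (\<exists>b\<in>elts A. is_pair p (nn 0) b)" using is_pair_inj[OF p] by metis
        then have "app k p = y" using k(2) y A(3)[OF nnA nnA p] True by simp
        then show ?thesis using A(3)[OF nnA nnA p] by blast
      next
        case False
        then have "y \<in> elts \<xi>" using y \<theta>\<xi> by blast
        then obtain b where b: "b \<in> elts A" "app e b = y" using e(2) by blast
        obtain p where p: "is_pair p (nn 0) b" using is_pair_ex[OF nn_in M_trans[OF A(1) b(1)]] by blast
        then have "?P p y" using b by blast
        from mp[OF bspec[OF bspec[OF k(2) A(3)[OF nnA b(1) p]] y] this] have "app k p = y" .
        then show ?thesis using A(3)[OF nnA b(1) p] by blast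
      qed
      then show False using \<theta>(2) k(1) unfolding onto_def by blast
    qed
  qed (use ord l\<theta> in auto)
  have "\<not> cof M \<beta> \<theta>" if \<beta>: "\<beta> \<in> elts \<theta>" for \<beta>
  proof
    assume "cof M \<beta> \<theta>"
    then obtain f where f: "f \<in> M" "\<forall>x\<in>elts \<beta>. app f x \<in> elts \<theta>"
      "\<forall>\<gamma>\<in>elts \<theta>. \<exists>x\<in>elts \<beta>. \<gamma> \<in> elts (app f x)" unfolding cof_def by blast
    obtain d where d: "d \<in> M" "\<forall>y\<in>elts \<beta>. \<exists>x\<in>elts A. app d x = y"
      using least[OF \<beta>] unfolding onto_def by blast
    obtain E where E: "E \<in> M" "\<forall>\<xi>\<in>elts \<theta>. \<forall>y\<in>elts \<xi>. \<exists>x\<in>elts A. app (app E \<xi>) x = y"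
      using onto_enumeration[OF A(1) \<theta>(1) least ord] by blast
    \<comment> \<open>A coded pair is decoded twice: its first coordinate names a point of \<beta>
      through \<open>d\<close>, the second an element of the value of \<open>f\<close> there through
      \<open>E\<close>. A cofinal \<open>f\<close> would thus let \<open>A\<close> cover
      \<theta>.\<close>
    let ?P = "\<lambda>x y. \<exists>a\<in>elts A. \<exists>b\<in>elts A. is_pair x a b \<and> y = app (app E (app f (app d a))) b"
    have dP: "dfb (\<lambda>_ s. ?P (s 0) (s 1))" by (intro dfb_rules) (simp_all add: A E f d)
    have single: "\<forall>x\<in>elts A. \<forall>y\<in>elts \<theta>. \<forall>y'\<in>elts \<theta>. ?P x y \<longrightarrow> ?P x y' \<longrightarrow> y' = y"
      using is_pair_inj by blast
    obtain k where k: "k \<in> M" "\<forall>x\<in>elts A. \<forall>y\<in>elts \<theta>. ?P x y \<longrightarrow> app k x = y"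
      using function_ex[where P = ?P, OF dP A(1) \<theta>(1) single] by blast
    have "\<exists>x\<in>elts A. app k x = y" if y: "y \<in> elts \<theta>" for y
    proof -
      obtain z where z: "z \<in> elts \<beta>" "y \<in> elts (app f z)" using f(3) y by blast
      obtain a where a: "a \<in> elts A" "app d a = z" using d(2) z(1) by blast
      obtain b where b: "b \<in> elts A" "app (app E (app f z)) b = y" using E(2) f(2) z by blast
      obtain p where p: "is_pair p a b"
        using is_pair_ex[OF M_trans[OF A(1) a(1)] M_trans[OF A(1) b(1)]] by blast
      have "?P p y" using a b p by blast
      from mp[OF bspec[OF bspec[OF k(2) A(3)[OF a(1) b(1) p]] y] this] have "app k p = y" .
      then show ?thesis using A(3)[OF a(1) b(1) p] by blast
    qed
    then show False using \<theta>(2) k(1) unfolding onto_def by blast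
  qed
  then show ?thesis using \<theta>(1) l\<theta> lim unfolding reg_def by blast
qed

lemma ladder_ex:
  assumes \<theta>: "\<theta> \<in> M" "Ord \<theta>"
  shows "\<exists>a\<in>M. ladder M \<theta> a"
proof -
  have "dfb (\<lambda>_ s. cof M omega (s 0))" by (intro dfb_rules)
  from separation[OF this \<theta>(1)] obtain S where
    S: "S \<in> M" "elts S = {\<xi> \<in> elts \<theta>. cof M omega \<xi>}" by blast
  obtain F where F: "F \<in> M"
    "\<forall>f\<in>M. (\<forall>x\<in>elts omega. app f x \<in> elts \<theta>) \<longrightarrow> (\<exists>f'\<in>elts F. \<forall>x\<in>elts omega. app f' x = app f x)"
    using function_space[OF omega_in \<theta>(1)] by blast
  let ?P = "\<lambda>\<xi> f. (\<forall>n\<in>elts omega. app f n \<in> elts \<xi>) \<and> (\<forall>\<gamma>\<in>elts \<xi>. \<exists>n\<in>elts omega. \<gamma> \<in> elts (app f n))"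
  have "dfb (\<lambda>_ s. ?P (s 0) (s 1))" by (intro dfb_rules)
  moreover have "\<exists>f\<in>elts F. ?P \<xi> f" if "\<xi> \<in> elts S" for \<xi>
  proof -
    have \<xi>: "\<xi> \<in> elts \<theta>" "cof M omega \<xi>" using that S(2) by auto
    then obtain f where f: "f \<in> M" "?P \<xi> f" unfolding cof_def by blast
    then have "\<forall>x\<in>elts omega. app f x \<in> elts \<theta>" using Ord_trans[OF \<theta>(2) \<xi>(1)] by blast
    then obtain f' where "f' \<in> elts F" "\<forall>x\<in>elts omega. app f' x = app f x" using F(2) f(1) by blast
    then show ?thesis using f(2) by (intro bexI[of _ f']) simp_all
  qed
  ultimately have "\<exists>a\<in>M. \<forall>\<xi>\<in>elts S. app a \<xi> \<in> elts F \<and> ?P \<xi> (app a \<xi>)"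
    by (rule choice[where P = ?P, OF _ S(1) F(1)])
  then show ?thesis unfolding ladder_def S(2) by blast
qed

text \<open>If no \<gamma> from \<eta> on were positive, each would have a function whose closure
  points of cofinality \<omega> avoid it. An \<omega>-iteration starting at \<eta> reaches a point
  \<xi> of their diagonal intersection. Some rung \<gamma> of the ladder at \<xi> exceeds \<eta>,
  yet \<xi> is closed under the function that belongs to \<gamma>.\<close>

lemma pos_unbounded:
  assumes \<theta>: "\<theta> \<in> M" "reg M \<theta>" "omega \<in> elts \<theta>" and a: "a \<in> M" "ladder M \<theta> a"
    and \<eta>: "\<eta> \<in> elts \<theta>"
  shows "\<exists>\<gamma>\<in>elts \<theta>. pos M \<theta> a \<gamma> \<and> \<gamma> \<notin> elts \<eta>"
proof (rule ccontr)
  assume neg: "\<not> ?thesis"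
  have lim: "Limit \<theta>" using \<theta>(2) by (simp add: reg_def)
  note ord = Limit_Ord[OF lim]
  have \<eta>M: "\<eta> \<in> M" using M_trans[OF \<theta>(1) \<eta>] .
  obtain F where F: "F \<in> M"
    "\<forall>f\<in>M. (\<forall>x\<in>elts \<theta>. app f x \<in> elts \<theta>) \<longrightarrow> (\<exists>f'\<in>elts F. \<forall>x\<in>elts \<theta>. app f' x = app f x)"
    using function_space[OF \<theta>(1) \<theta>(1)] by blast
  let ?hits = "\<lambda>g \<gamma>. \<exists>\<xi>\<in>elts \<theta>. cof M omega \<xi> \<and> (\<forall>x\<in>elts \<xi>. app g x \<in> elts \<xi>) \<and>
        (\<exists>n\<in>elts omega. app (app a \<xi>) n = \<gamma>)"
  \<comment> \<open>For \<gamma> below \<eta> any map of \<theta> into itself is accepted, so that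
    \<open>choice\<close> can be applied on all of \<theta>.\<close>
  let ?P = "\<lambda>\<gamma> g. (\<forall>x\<in>elts \<theta>. app g x \<in> elts \<theta>) \<and> (\<gamma> \<in> elts \<eta> \<or> \<not> ?hits g \<gamma>)"
  have "dfb (\<lambda>_ s. ?P (s 0) (s 1))" by (intro dfb_rules) (simp_all add: \<theta> a \<eta>M)
  moreover have "\<exists>g\<in>elts F. ?P \<gamma> g" if \<gamma>: "\<gamma> \<in> elts \<theta>" for \<gamma>
  proof -
    have "\<exists>g\<in>M. ?P \<gamma> g"
    proof (cases "\<gamma> \<in> elts \<eta>")
      case True
      have "dfb (\<lambda>_ s. s 1 = s 0)" by (intro dfb_rules)
      from function_replacement[where P = "\<lambda>x y. y = x" and F = "\<lambda>x. x", OF this \<theta>(1) M_trans[OF \<theta>(1)]]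
      obtain g where "g \<in> M" "\<forall>x\<in>elts \<theta>. app g x = x" by blast
      then show ?thesis using True by (intro bexI[of _ g]) simp_all
    next
      case False
      then have "\<not> pos M \<theta> a \<gamma>" using neg \<gamma> by blast
      then show ?thesis unfolding pos_def by blast
    qed
    then obtain g where g: "g \<in> M" "?P \<gamma> g" by (rule bexE)
    then obtain g' where g': "g' \<in> elts F" "\<forall>x\<in>elts \<theta>. app g' x = app g x" using F(2) by blast
    have closed: "(\<forall>x\<in>elts \<xi>. app g' x \<in> elts \<xi>) \<longleftrightarrow> (\<forall>x\<in>elts \<xi>. app g x \<in> elts \<xi>)" if "\<xi> \<in> elts \<theta>" for \<xi>
      using g'(2) Ord_trans[OF ord that] by auto
    have "?P \<gamma> g'" using g(2) g'(2) closed by auto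
    then show ?thesis using g'(1) by (rule bexI)
  qed
  ultimately have "\<exists>gg\<in>M. \<forall>\<gamma>\<in>elts \<theta>. app gg \<gamma> \<in> elts F \<and> ?P \<gamma> (app gg \<gamma>)"
    by (rule choice[where P = ?P, OF _ \<theta>(1) F(1)])
  then obtain gg where gg: "gg \<in> M" "\<forall>\<gamma>\<in>elts \<theta>. app gg \<gamma> \<in> elts F \<and> ?P \<gamma> (app gg \<gamma>)" by (rule bexE)
  \<comment> \<open>One step of diagonal closure: \<open>y\<close> exceeds \<open>x\<close> and
    every value at a point below \<open>x\<close> of a function with index below \<open>x\<close>.
    Regularity is used twice to bound these values, for a fixed index and then over all
    indices.\<close>
  let ?Q = "\<lambda>x y. x \<in> elts y \<and> (\<forall>\<gamma>\<in>elts x. \<forall>u\<in>elts x. app (app gg \<gamma>) u \<in> elts y)"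
  have Q_ex: "\<exists>y\<in>elts \<theta>. ?Q x y" if x: "x \<in> elts \<theta>" for x
  proof -
    have xM: "x \<in> M" using M_trans[OF \<theta>(1) x] .
    have sub: "u \<in> elts \<theta>" if "u \<in> elts x" for u using Ord_trans[OF ord x that] .
    have inner: "\<exists>\<nu>\<in>elts \<theta>. \<forall>u\<in>elts x. app (app gg \<gamma>) u \<in> elts \<nu>" if \<gamma>: "\<gamma> \<in> elts x" for \<gamma>
    proof -
      have "dfb (\<lambda>_ s. s 1 = app (app gg \<gamma>) (s 0))"
        by (intro dfb_rules) (simp add: app_closed gg(1) M_trans[OF xM \<gamma>])
      from reg_collection[where P = "\<lambda>u y. y = app (app gg \<gamma>) u", OF \<theta>(2,1) x this]
      show ?thesis using gg(2) sub[OF \<gamma>] sub by auto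
    qed
    have "dfb (\<lambda>_ s. \<forall>u\<in>elts x. app (app gg (s 0)) u \<in> elts (s 1))"
      by (intro dfb_rules) (simp_all add: gg(1) xM)
    from reg_collection[where P = "\<lambda>\<gamma> \<nu>. \<forall>u\<in>elts x. app (app gg \<gamma>) u \<in> elts \<nu>", OF \<theta>(2,1) x this inner]
    obtain \<nu> where \<nu>: "\<nu> \<in> elts \<theta>" "\<forall>\<gamma>\<in>elts x. \<exists>y\<in>elts \<nu>. \<forall>u\<in>elts x. app (app gg \<gamma>) u \<in> elts y" by blast
    have *: "app (app gg \<gamma>) u \<in> elts \<nu>" if "\<gamma> \<in> elts x" "u \<in> elts x" for \<gamma> u
      using \<nu>(2) that Ord_trans[OF Ord_in[OF ord \<nu>(1)]] by blast
    obtain y where y: "y \<in> elts \<theta>" "x \<in> elts y" "\<nu> \<in> elts y"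
      using Limit_upper[OF lim x \<nu>(1)] by blast
    then show ?thesis using * Ord_trans[OF Ord_in[OF ord y(1)] y(3)] by blast
  qed
  \<comment> \<open>Taking the least such \<open>y\<close> makes the step a definable function, as
    \<open>iteration\<close> requires.\<close>
  let ?R = "\<lambda>x y. y \<in> elts \<theta> \<and> ?Q x y \<and> (\<forall>z\<in>elts y. \<not> ?Q x z)"
  have R_ex: "\<exists>y. ?R x y" if x: "x \<in> elts \<theta>" for x
  proof -
    obtain y where y: "y \<in> elts \<theta>" "?Q x y" using Q_ex[OF x] by (rule bexE)
    from Ord_least[where P = "?Q x", OF Ord_in[OF ord y(1)] y(2)]
    obtain z where z: "?Q x z" "\<And>w. w \<in> elts z \<Longrightarrow> \<not> ?Q x w" "z = y \<or> z \<in> elts y" by metis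
    then have "z \<in> elts \<theta>" using y(1) Ord_trans[OF ord y(1)] by blast
    then show ?thesis using z(1,2) by blast
  qed
  have R_unique: "y = z" if "?R x y" "?R x z" for x y z
    using that Ord_linear[OF Ord_in[OF ord] Ord_in[OF ord], of y z] by blast
  define i where "i = rec_nat \<eta> (\<lambda>_ x. SOME y. ?R x y)"
  have i_Suc: "i (Suc n) = (SOME y. ?R (i n) y)" for n by (simp add: i_def)
  have i\<theta>: "i n \<in> elts \<theta>" for n
  proof (induction n)
    case 0
    show ?case by (simp add: i_def \<eta>)
  next
    case (Suc n)
    show ?case unfolding i_Suc using someI_ex[OF R_ex[OF Suc]] by (rule conjunct1)
  qed
  have Ri: "?R (i n) (i (Suc n))" for n unfolding i_Suc by (rule someI_ex[OF R_ex[OF i\<theta>]])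
  have "\<exists>f\<in>M. \<forall>n. app f (nn n) = i n"
  proof (rule iteration[where R = ?R])
    show "dfb (\<lambda>_ s. ?R (s 0) (s 1))" by (intro dfb_rules) (simp_all add: \<theta> gg)
    show "i n \<in> M" for n by (rule M_trans[OF \<theta>(1) i\<theta>])
    show "?R (i n) y \<longleftrightarrow> y = i (Suc n)" for n y
    proof
      show "?R (i n) y \<Longrightarrow> y = i (Suc n)" by (rule R_unique[OF _ Ri])
    qed (simp add: Ri)
  qed
  then obtain f where f: "f \<in> M" "\<And>n. app f (nn n) = i n" by blast
  have "\<not> cof M omega \<theta>" using \<theta>(2,3) by (simp add: reg_def)
  from not_cof_bounded[OF ord this f(1) _ lim] obtain \<nu> where
    \<nu>: "\<nu> \<in> elts \<theta>" "\<forall>n. i n \<in> elts \<nu>" using f(2) i\<theta> by (auto simp: elts_omega)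
  from Ord_least[where P = "\<lambda>\<nu>. \<forall>n. i n \<in> elts \<nu>", OF Ord_in[OF ord \<nu>(1)] \<nu>(2)]
  obtain \<xi> where \<xi>: "Ord \<xi>" "\<And>n. i n \<in> elts \<xi>" "\<And>y. y \<in> elts \<xi> \<Longrightarrow> \<exists>n. i n \<notin> elts y" "\<xi> = \<nu> \<or> \<xi> \<in> elts \<nu>"
    by metis
  have \<xi>\<theta>: "\<xi> \<in> elts \<theta>" using \<xi>(4) \<nu>(1) Ord_trans[OF ord \<nu>(1)] by blast
  have inc: "i n \<in> elts (i (Suc n))" for n using Ri[of n] by blast
  have Ord_i: "Ord (i n)" for n using Ord_in[OF ord i\<theta>] .
  have cofinal: "\<exists>n. y \<in> elts (i n)" if y: "y \<in> elts \<xi>" for y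
  proof -
    obtain n where "i n \<notin> elts y" using \<xi>(3)[OF y] by blast
    then have "y \<in> elts (i n) \<or> y = i n" using Ord_linear[OF Ord_i Ord_in[OF \<xi>(1) y]] by blast
    then show ?thesis using inc[of n] by blast
  qed
  have mono: "elts (i m) \<subseteq> elts (i n)" if "m \<le> n" for m n
  proof (rule lift_Suc_mono_le[of "\<lambda>n. elts (i n)", OF _ that])
    show "elts (i n) \<subseteq> elts (i (Suc n))" for n using Ord_trans[OF Ord_i inc] by blast
  qed
  have "cof M omega \<xi>"
    unfolding cof_def
  proof (intro bexI[OF _ f(1)] conjI ballI)
    show "app f x \<in> elts \<xi>" if "x \<in> elts omega" for x using that f(2) \<xi>(2) by (auto simp: elts_omega)
    show "\<exists>x\<in>elts omega. \<gamma> \<in> elts (app f x)" if "\<gamma> \<in> elts \<xi>" for \<gamma>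
      using cofinal[OF that] f(2) nn_in_omega by metis
  qed
  then have ladder: "\<forall>n\<in>elts omega. app (app a \<xi>) n \<in> elts \<xi>"
    "\<forall>\<gamma>\<in>elts \<xi>. \<exists>n\<in>elts omega. \<gamma> \<in> elts (app (app a \<xi>) n)"
    using a(2) \<xi>\<theta> unfolding ladder_def by blast+
  have "\<eta> \<in> elts \<xi>" using \<xi>(2)[of 0] by (simp add: i_def)
  then obtain n where n: "n \<in> elts omega" "\<eta> \<in> elts (app (app a \<xi>) n)" using ladder(2) by blast
  \<comment> \<open>This rung lies above \<eta> and below \<xi>, so its index is among those for
    which \<xi> is closed.\<close>
  define \<gamma> where "\<gamma> = app (app a \<xi>) n"
  have \<gamma>: "\<gamma> \<in> elts \<xi>" "\<gamma> \<notin> elts \<eta>"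
    using ladder(1) n mem_asym[of \<eta> \<gamma>] by (simp_all add: \<gamma>_def)
  have "app (app gg \<gamma>) u \<in> elts \<xi>" if u: "u \<in> elts \<xi>" for u
  proof -
    obtain k m where km: "\<gamma> \<in> elts (i k)" "u \<in> elts (i m)" using cofinal[OF \<gamma>(1)] cofinal[OF u] by blast
    then have "\<gamma> \<in> elts (i (max k m))" "u \<in> elts (i (max k m))"
      using mono[of k "max k m"] mono[of m "max k m"] by auto
    then have "app (app gg \<gamma>) u \<in> elts (i (Suc (max k m)))" using Ri[of "max k m"] by blast
    then show ?thesis using Ord_trans[OF \<xi>(1) \<xi>(2)] by blast
  qed
  then have "?hits (app gg \<gamma>) \<gamma>" using \<xi>\<theta> \<open>cof M omega \<xi>\<close> n(1) \<gamma>_def by blast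
  moreover have "\<gamma> \<in> elts \<theta>" using Ord_trans[OF ord \<xi>\<theta> \<gamma>(1)] .
  ultimately show False using gg(2) \<gamma>(2) by blast
qed

end

lemma (in tmodel) Limit_not_in_omega: "Limit \<alpha> \<Longrightarrow> (\<alpha> :: 'v) \<notin> elts omega"
proof
  assume lim: "Limit \<alpha>" and "\<alpha> \<in> elts omega"
  then obtain n where n: "\<alpha> = nn n" by (auto simp: elts_omega)
  show False
  proof (cases n)
    case 0
    then have "elts \<alpha> = {}" by (simp add: n elts_nn del: nn.simps)
    then show False using lim by (simp add: Limit_def)
  next
    case (Suc k)
    then have "nn k \<in> elts \<alpha>" unfolding n by (simp add: nn_mem_iff del: nn.simps)
    from Limit_next[OF lim this] obtain m where m: "m \<in> elts \<alpha>" "nn k \<in> elts m" by blast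
    then obtain l where "m = nn l" "l < Suc k" using elts_nn[of n] unfolding n Suc by auto
    then show False using m(2) by (simp add: nn_mem_iff)
  qed
qed

section \<open>Elementary embeddings\<close>

locale embedding =
  fixes M N :: "'v::set_universe set" and j :: "'v \<Rightarrow> 'v"
  assumes M: "transitive_model M" and N: "transitive_model N"
    and emb: "elementary_embedding j M N"
    and same_Ord: "Ord \<alpha> \<Longrightarrow> \<alpha> \<in> M \<longleftrightarrow> \<alpha> \<in> N"
begin

definition Mb :: "bool \<Rightarrow> 'v set" where
  "Mb i = (if i then M else N)"

definition par :: "'v \<Rightarrow> bool \<Rightarrow> 'v" where
  "par c i = (if i then c else j c)"

lemma Mb_simps [simp]: "Mb True = M" "Mb False = N"
  by (simp_all add: Mb_def)

lemma par_simps [simp]: "par c True = c" "par c False = j c"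
  by (simp_all add: par_def)

lemma j_in: "x \<in> M \<Longrightarrow> j x \<in> N"
  using emb by (auto simp: elementary_embedding_def)

end

sublocale embedding \<subseteq> A: tmodel M
  by unfold_locales (rule M)

sublocale embedding \<subseteq> B: tmodel N
  by unfold_locales (rule N)

sublocale embedding \<subseteq> E: models Mb "par ` M"
proof
  show "transitive_model (Mb i)" for i by (cases i) (simp_all add: M N)
  show "c i \<in> Mb i" if "c \<in> par ` M" for c i
    using that by (cases i) (auto simp: j_in)
  show "par ` M \<noteq> {}" using A.omega_in by blast
qed

context embedding
begin

text \<open>A single formula expresses \<open>P True\<close> in \<open>M\<close> and
  \<open>P False\<close> in \<open>N\<close>, and \<open>par\<close> makes the parameters in
  \<open>N\<close> the images of those in \<open>M\<close>. The assignment of variables is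
  arbitrary, as \<open>P\<close> does not depend on it.\<close>

lemma elementary:
  assumes "E.dfb (\<lambda>i s. P i)"
  shows "P True \<longleftrightarrow> P False"
proof -
  obtain \<phi> p where p: "\<And>n. p n \<in> par ` M"
    and \<phi>: "\<And>i s. range s \<subseteq> Mb i \<Longrightarrow> P i = sat (Mb i) (mix s (\<lambda>n. p n i)) \<phi>"
    using assms unfolding E.dfb_def by blast
  have p': "p n True \<in> M" "p n False = j (p n True)" for n using p[of n] by auto
  let ?t = "mix (\<lambda>_. omega) (\<lambda>n. p n True)"
  have "range ?t \<subseteq> M" using p' A.omega_in by (simp add: mix_def image_subset_iff)
  then have "sat M ?t \<phi> \<longleftrightarrow> sat N (j \<circ> ?t) \<phi>" using emb unfolding elementary_embedding_def by blast
  moreover have "j \<circ> ?t = mix (\<lambda>_. j omega) (\<lambda>n. p n False)" using p' by (auto simp: mix_def fun_eq_iff)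
  ultimately show ?thesis
    using \<phi>[of "\<lambda>_. omega" True] \<phi>[of "\<lambda>_. j omega" False] A.omega_in j_in by auto
qed

lemma tm_par: "c \<in> M \<Longrightarrow> E.tm (\<lambda>i s. par c i)"
  by (rule E.tm_const) blast

lemma j_mem: "x \<in> M \<Longrightarrow> y \<in> M \<Longrightarrow> j x \<in> elts (j y) \<longleftrightarrow> x \<in> elts y"
  using elementary[of "\<lambda>i. par x i \<in> elts (par y i)"] by (simp add: E.dfb_mem tm_par)

lemma j_eq: "x \<in> M \<Longrightarrow> y \<in> M \<Longrightarrow> j x = j y \<longleftrightarrow> x = y"
  using elementary[of "\<lambda>i. par x i = par y i"] by (simp add: E.dfb_eq tm_par)

lemma j_app: "f \<in> M \<Longrightarrow> x \<in> M \<Longrightarrow> j (app f x) = app (j f) (j x)"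
  using elementary[of "\<lambda>i. par (app f x) i = app (par f i) (par x i)"]
  by (simp add: E.dfb_eq tm_par E.tm_app A.app_closed)

lemma j_omega: "j omega = omega"
  using elementary[of "\<lambda>i. par omega i = omega"]
  by (simp add: E.dfb_eq tm_par E.tm_omega A.omega_in)

lemma j_Ord: "x \<in> M \<Longrightarrow> Ord (j x) \<longleftrightarrow> Ord x"
  using elementary[of "\<lambda>i. Ord (par x i)"] by (simp add: E.dfb_Ord tm_par)

text \<open>Sharing the ordinals puts the image back into \<open>M\<close>, so \<open>j\<close> can
  be applied to it again.\<close>

lemma j_Ord_in: "Ord \<alpha> \<Longrightarrow> \<alpha> \<in> M \<Longrightarrow> Ord (j \<alpha>) \<and> j \<alpha> \<in> M \<and> j \<alpha> \<in> N"
  using j_Ord same_Ord j_in by blast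

lemma j_nn: "j (nn n) = (nn n :: 'v)"
proof (induction n)
  case 0
  have "E.dfb (\<lambda>i s. \<forall>z\<in>elts (par (nn 0) i). z \<noteq> z)"
    by (intro dfb_rules tm_par A.nn_in)
  from elementary[OF this] have "elts (j (nn 0)) = elts (nn 0)"
    by (simp add: A.elts_nn del: nn.simps)
  then show ?case by (rule elts_inject)
next
  case (Suc n)
  have "E.dfb (\<lambda>i s. \<forall>z\<in>Mb i. z \<in> elts (par (nn (Suc n)) i) \<longleftrightarrow> z \<in> elts (par (nn n) i) \<or> z = par (nn n) i)"
    by (intro dfb_rules tm_par A.nn_in)
  from elementary[OF this] Suc
  have *: "\<forall>z\<in>N. z \<in> elts (j (nn (Suc n))) \<longleftrightarrow> z \<in> elts (nn n) \<or> z = nn n"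
    by (auto simp: A.elts_nn_Suc simp del: nn.simps)
  have "z \<in> elts (j (nn (Suc n))) \<longleftrightarrow> z \<in> elts (nn (Suc n))" for z
    unfolding A.elts_nn_Suc using * B.M_trans[OF j_in[OF A.nn_in]] B.M_trans[OF B.nn_in] B.nn_in by blast
  then show ?case by (rule elts_eqI)
qed

text \<open>If \<open>j\<close> moved an ordinal down, its image would be moved down as well, by
  elementarity; a descent results.\<close>

lemma j_not_less: "Ord \<alpha> \<Longrightarrow> \<alpha> \<in> M \<Longrightarrow> j \<alpha> \<notin> elts \<alpha>"
proof (induction \<alpha> rule: elts_induct)
  case (step \<alpha>)
  show ?case
  proof
    assume less: "j \<alpha> \<in> elts \<alpha>"
    have M: "j \<alpha> \<in> M" using A.M_trans[OF step.prems(2) less] .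
    then have "j (j \<alpha>) \<in> elts (j \<alpha>)" using j_mem step.prems(2) less by blast
    then show False using step.IH[OF less Ord_in[OF step.prems(1) less] M] by blast
  qed
qed

text \<open>If all ordinals are fixed, so is every set, by membership induction: for an enumeration
  \<open>h\<close> of \<open>y\<close> along \<alpha>, the elements of \<open>j y\<close> are the
  values of \<open>j h\<close> on \<alpha>, and these are the images of elements of
  \<open>y\<close>.\<close>

lemma moves_ordinal:
  assumes "x \<in> M" "j x \<noteq> x"
  obtains \<alpha> where "Ord \<alpha>" "\<alpha> \<in> M" "j \<alpha> \<noteq> \<alpha>"
proof (rule ccontr)
  assume neg: "\<not> thesis"
  note fixed = that
  have fix_Ord: "j \<alpha> = \<alpha>" if "Ord \<alpha>" "\<alpha> \<in> M" for \<alpha> using fixed[OF that] neg by blast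
  have "y \<in> M \<Longrightarrow> j y = y" for y
  proof (induction y rule: elts_induct)
    case (step y)
    obtain \<alpha> h where \<alpha>: "\<alpha> \<in> M" "Ord \<alpha>" and h: "h \<in> M" "app h ` elts \<alpha> = elts y"
      using A.well_ordering[OF step.prems] by blast
    have def_onto: "E.dfb (\<lambda>i s. \<forall>z\<in>elts (par y i). \<exists>\<beta>\<in>elts (par \<alpha> i). app (par h i) \<beta> = z)"
      by (intro dfb_rules tm_par \<alpha> h step.prems)
    have "\<forall>z\<in>elts y. \<exists>\<beta>\<in>elts \<alpha>. app h \<beta> = z" using h(2) by (metis imageE)
    then have onto: "\<forall>z\<in>elts (j y). \<exists>\<beta>\<in>elts (j \<alpha>). app (j h) \<beta> = z"
      using elementary[OF def_onto] by simp
    have "z \<in> elts (j y) \<longleftrightarrow> z \<in> elts y" for z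
    proof
      assume "z \<in> elts (j y)"
      then obtain \<beta> where \<beta>: "\<beta> \<in> elts \<alpha>" "app (j h) \<beta> = z"
        using onto fix_Ord[OF \<alpha>(2,1)] by auto
      have \<beta>M: "\<beta> \<in> M" using A.M_trans[OF \<alpha>(1) \<beta>(1)] .
      have hb: "app h \<beta> \<in> elts y" using h(2) \<beta>(1) by blast
      have "z = j (app h \<beta>)"
        using \<beta>(2) j_app[OF h(1) \<beta>M] fix_Ord[OF Ord_in[OF \<alpha>(2) \<beta>(1)] \<beta>M] by simp
      then show "z \<in> elts y" using step.IH[OF hb A.M_trans[OF step.prems hb]] hb by simp
    next
      assume z: "z \<in> elts y"
      have "z \<in> M" using A.M_trans[OF step.prems z] .
      then show "z \<in> elts (j y)" using j_mem[OF \<open>z \<in> M\<close> step.prems] step.IH[OF z] z by simp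
    qed
    then show ?case by (rule elts_eqI)
  qed
  then show False using assms by blast
qed

lemma crit:
  assumes "nontrivial_on M j"
  shows "Ord (crit M j) \<and> crit M j \<in> M \<and> j (crit M j) \<noteq> crit M j \<and> (\<forall>\<beta>\<in>elts (crit M j). j \<beta> = \<beta>)"
proof -
  obtain x where "x \<in> M" "j x \<noteq> x" using assms unfolding nontrivial_on_def by blast
  then obtain \<alpha> where \<alpha>: "Ord \<alpha>" "\<alpha> \<in> M \<and> j \<alpha> \<noteq> \<alpha>" by (rule moves_ordinal) blast
  obtain \<kappa> where \<kappa>: "Ord \<kappa>" "\<kappa> \<in> M" "j \<kappa> \<noteq> \<kappa>"
    and least: "\<And>\<gamma>. \<gamma> \<in> elts \<kappa> \<Longrightarrow> \<not> (\<gamma> \<in> M \<and> j \<gamma> \<noteq> \<gamma>)"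
    using Ord_least[where P = "\<lambda>\<alpha>. \<alpha> \<in> M \<and> j \<alpha> \<noteq> \<alpha>", OF \<alpha>] by metis
  let ?P = "\<lambda>\<kappa>. \<kappa> \<in> ordinals_of M \<and> j \<kappa> \<noteq> \<kappa> \<and> (\<forall>\<beta>\<in>elts \<kappa>. j \<beta> = \<beta>)"
  have "?P (crit M j)"
    unfolding crit_def
  proof (rule theI)
    show "?P \<kappa>" using \<kappa> least A.M_trans[OF \<kappa>(2)] by (auto simp: ordinals_of_def)
    show "\<kappa>' = \<kappa>" if "?P \<kappa>'" for \<kappa>'
      using that \<open>?P \<kappa>\<close> Ord_linear[of \<kappa>' \<kappa>] \<kappa>(1) by (auto simp: ordinals_of_def)
  qed
  then show ?thesis by (simp add: ordinals_of_def)
qed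

end

section \<open>The joint failure of the three alternatives, and its refutation\<close>

locale bounded_embedding = embedding M N j
  for M N :: "'v::set_universe set" and j +
  fixes \<kappa> \<mu> :: 'v
  assumes \<kappa>: "Ord \<kappa>" "\<kappa> \<in> M" "j \<kappa> \<noteq> \<kappa>" and below_\<kappa>: "\<beta> \<in> elts \<kappa> \<Longrightarrow> j \<beta> = \<beta>"
    and \<mu>: "Ord \<mu>" "\<mu> \<in> M" "(j ^^ n) \<kappa> \<in> elts \<mu>"
    and images: "Ord \<alpha> \<Longrightarrow> \<alpha> \<in> M \<Longrightarrow> \<exists>x\<in>N. elts x = j ` elts \<alpha>"
    and reg_N: "\<alpha> \<in> M \<Longrightarrow> reg M \<alpha> \<Longrightarrow> reg N \<alpha>"
begin

text \<open>\<open>j\<close> preserves the order of ordinals, so its restriction to \<alpha> is the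
  increasing enumeration of the image, which lies in \<open>N\<close>. There the value at \<delta>
  is recognized as the least element of \<open>X\<close> not taken before \<delta>.\<close>

lemma j_restrict:
  assumes \<alpha>: "Ord \<alpha>" "\<alpha> \<in> M"
  shows "\<exists>J\<in>N. \<forall>\<beta>\<in>elts \<alpha>. app J \<beta> = j \<beta>"
proof -
  obtain X where X: "X \<in> N" "elts X = j ` elts \<alpha>" using images[OF \<alpha>] by blast
  have \<alpha>N: "\<alpha> \<in> N" using \<alpha> same_Ord by blast
  let ?R = "\<lambda>\<delta> f y. y \<in> elts X \<and> (\<forall>\<gamma>\<in>elts \<delta>. app f \<gamma> \<noteq> y) \<and>
    (\<forall>z\<in>elts y. z \<in> elts X \<longrightarrow> (\<exists>\<gamma>\<in>elts \<delta>. app f \<gamma> = z))"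
  have R: "B.dfb (\<lambda>_ s. ?R (s 0) (s 1) (s 2))" by (intro dfb_rules) (simp_all add: X)
  show ?thesis
  proof (rule B.recursion[where R = ?R and I = j, OF R \<alpha>N \<alpha>(1)])
    show "j \<delta> \<in> N" if "\<delta> \<in> elts \<alpha>" for \<delta> using j_in A.M_trans[OF \<alpha>(2) that] by blast
    fix \<delta> f y
    assume \<delta>: "\<delta> \<in> elts \<alpha>" and f: "\<forall>\<gamma>\<in>elts \<delta>. app f \<gamma> = j \<gamma>" and y: "y \<in> N"
    have \<delta>M: "\<delta> \<in> M" using A.M_trans[OF \<alpha>(2) \<delta>] .
    have in_\<alpha>: "\<gamma> \<in> elts \<alpha>" if "\<gamma> \<in> elts \<delta>" for \<gamma> using Ord_trans[OF \<alpha>(1) \<delta> that] .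
    have R_iff: "?R \<delta> f y \<longleftrightarrow> y \<in> j ` elts \<alpha> \<and> y \<notin> j ` elts \<delta> \<and> (\<forall>z\<in>elts y. z \<in> j ` elts \<alpha> \<longrightarrow> z \<in> j ` elts \<delta>)"
    proof -
      have "(\<exists>\<gamma>\<in>elts \<delta>. app f \<gamma> = z) \<longleftrightarrow> z \<in> j ` elts \<delta>" for z using f by force
      moreover from this have "(\<forall>\<gamma>\<in>elts \<delta>. app f \<gamma> \<noteq> z) \<longleftrightarrow> z \<notin> j ` elts \<delta>" for z by blast
      ultimately show ?thesis using X(2) by simp
    qed
    show "?R \<delta> f y \<longleftrightarrow> y = j \<delta>"
    proof
      assume "?R \<delta> f y"
      then have R: "y \<in> j ` elts \<alpha>" "y \<notin> j ` elts \<delta>" "\<And>z. z \<in> elts y \<Longrightarrow> z \<in> j ` elts \<alpha> \<Longrightarrow> z \<in> j ` elts \<delta>"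
        unfolding R_iff by auto
      obtain \<epsilon> where \<epsilon>: "\<epsilon> \<in> elts \<alpha>" "y = j \<epsilon>" using R(1) by blast
      have "\<epsilon> \<notin> elts \<delta>" using R(2) \<epsilon>(2) by blast
      moreover have "\<delta> \<notin> elts \<epsilon>"
      proof
        assume "\<delta> \<in> elts \<epsilon>"
        then have "j \<delta> \<in> elts y" using j_mem[OF \<delta>M A.M_trans[OF \<alpha>(2) \<epsilon>(1)]] \<epsilon>(2) by simp
        then obtain \<gamma> where \<gamma>: "\<gamma> \<in> elts \<delta>" "j \<delta> = j \<gamma>" using R(3) \<delta> by blast
        then have "\<delta> = \<gamma>" using j_eq[OF \<delta>M A.M_trans[OF \<delta>M \<gamma>(1)]] by blast
        then show False using \<gamma>(1) mem_irrefl by blast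
      qed
      ultimately show "y = j \<delta>"
        using Ord_linear[OF Ord_in[OF \<alpha>(1) \<epsilon>(1)] Ord_in[OF \<alpha>(1) \<delta>]] \<epsilon>(2) by blast
    next
      assume y: "y = j \<delta>"
      have "j \<delta> \<notin> j ` elts \<delta>"
      proof
        assume "j \<delta> \<in> j ` elts \<delta>"
        then obtain \<gamma> where \<gamma>: "\<gamma> \<in> elts \<delta>" "j \<delta> = j \<gamma>" by blast
        then have "\<delta> = \<gamma>" using j_eq[OF \<delta>M A.M_trans[OF \<delta>M \<gamma>(1)]] by blast
        then show False using \<gamma>(1) mem_irrefl by blast
      qed
      moreover have "z \<in> j ` elts \<delta>" if "z \<in> elts (j \<delta>)" "z \<in> j ` elts \<alpha>" for z
      proof -
        obtain \<gamma> where \<gamma>: "\<gamma> \<in> elts \<alpha>" "z = j \<gamma>" using \<open>z \<in> j ` elts \<alpha>\<close> by blast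
        then have "\<gamma> \<in> elts \<delta>" using that(1) j_mem[OF A.M_trans[OF \<alpha>(2) \<gamma>(1)] \<delta>M] by blast
        then show ?thesis using \<gamma>(2) by blast
      qed
      ultimately show "?R \<delta> f y" unfolding R_iff unfolding y using \<delta> by blast
    qed
  qed
qed

text \<open>\<open>h\<close> itself may be missing from \<open>N\<close>, but \<open>j h\<close> is
  there. The value of \<open>h\<close> at \<open>x\<close> is recovered as the \<open>y\<close>
  whose image under \<open>j\<close> is the value of \<open>j h\<close> at \<open>j x\<close>, using
  restrictions of \<open>j\<close> to both ordinals.\<close>

lemma ordinal_function_in_N:
  assumes \<alpha>: "Ord \<alpha>" "\<alpha> \<in> M" and \<mu>: "Ord \<mu>'" "\<mu>' \<in> M" and h: "h \<in> M" "\<forall>x\<in>elts \<alpha>. app h x \<in> elts \<mu>'"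
  shows "\<exists>h'\<in>N. \<forall>x\<in>elts \<alpha>. app h' x = app h x"
proof -
  obtain J1 where J1: "J1 \<in> N" "\<forall>\<beta>\<in>elts \<alpha>. app J1 \<beta> = j \<beta>" using j_restrict[OF \<alpha>] by blast
  obtain J2 where J2: "J2 \<in> N" "\<forall>\<beta>\<in>elts \<mu>'. app J2 \<beta> = j \<beta>" using j_restrict[OF \<mu>] by blast
  have \<alpha>N: "\<alpha> \<in> N" and \<mu>N: "\<mu>' \<in> N" using \<alpha> \<mu> same_Ord by blast+
  let ?P = "\<lambda>x y. y \<in> elts \<mu>' \<and> app J2 y = app (j h) (app J1 x)"
  have P: "B.dfb (\<lambda>_ s. ?P (s 0) (s 1))"
    by (intro dfb_rules) (simp_all add: \<mu>N J1 J2 j_in h)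
  show ?thesis
  proof (rule B.function_replacement[where P = ?P and F = "app h", OF P \<alpha>N])
    fix x assume x: "x \<in> elts \<alpha>"
    then have hx: "app h x \<in> elts \<mu>'" using h(2) by blast
    then show "app h x \<in> N" using B.M_trans[OF \<mu>N] by blast
    fix y
    have "app (j h) (app J1 x) = j (app h x)"
      using J1(2) x j_app[OF h(1) A.M_trans[OF \<alpha>(2) x]] by simp
    moreover have "j y = j (app h x) \<longleftrightarrow> y = app h x" if "y \<in> elts \<mu>'"
      using j_eq[OF A.M_trans[OF \<mu>(2) that] A.M_trans[OF \<mu>(2) hx]] .
    ultimately show "?P x y \<longleftrightarrow> y = app h x" using J2(2) hx by auto
  qed
qed

text \<open>
  The cofinality of \<open>\<xi>\<close> in \<open>M\<close> is regular in \<open>M\<close>, hence in \<open>N\<close>, and it has cofinality \<open>\<omega>\<close> in \<open>N\<close>.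
\<close>

lemma cof_omega_M:
  assumes cofN: "cof N omega \<xi>" and \<xi>: "Ord \<xi>" "\<xi> \<in> M"
  shows "cof M omega \<xi>"
proof -
  have lim: "Limit \<xi>" using B.cof_Limit[OF cofN \<xi>(1)] A.nn_in_omega by blast
  have "cof M \<xi> \<xi>"
  proof -
    have "A.dfb (\<lambda>_ s. s 1 = s 0)" by (intro dfb_rules)
    from A.function_replacement[where P = "\<lambda>x y. y = x" and F = "\<lambda>x. x", OF this \<xi>(2) A.M_trans[OF \<xi>(2)]]
    obtain f where "f \<in> M" "\<forall>x\<in>elts \<xi>. app f x = x" by blast
    then show ?thesis unfolding cof_def using Limit_next[OF lim] by (intro bexI[of _ f]) simp_all
  qed
  from Ord_least[where P = "\<lambda>\<delta>. cof M \<delta> \<xi>", OF \<xi>(1) this]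
  obtain \<delta> where \<delta>: "Ord \<delta>" "cof M \<delta> \<xi>" "\<And>\<beta>. \<beta> \<in> elts \<delta> \<Longrightarrow> \<not> cof M \<beta> \<xi>" "\<delta> = \<xi> \<or> \<delta> \<in> elts \<xi>"
    by metis
  have \<delta>M: "\<delta> \<in> M" using \<delta>(4) \<xi>(2) A.M_trans by blast
  have \<delta>N: "\<delta> \<in> N" and \<xi>N: "\<xi> \<in> N" using \<delta>M \<delta>(1) \<xi> same_Ord by blast+
  obtain h where h: "h \<in> M" "\<forall>x\<in>elts \<delta>. app h x \<in> elts \<xi>"
    "\<forall>\<gamma>\<in>elts \<xi>. \<exists>x\<in>elts \<delta>. \<gamma> \<in> elts (app h x)" using \<delta>(2) unfolding cof_def by blast
  have small: "\<exists>\<nu>\<in>elts \<xi>. \<forall>x\<in>elts \<beta>. app h x \<in> elts \<nu>" if \<beta>: "\<beta> \<in> elts \<delta>" for \<beta>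
    using A.not_cof_bounded[OF \<xi>(1) \<delta>(3)[OF \<beta>] h(1) _ lim] h(2) Ord_trans[OF \<delta>(1) \<beta>] by blast
  have h_ord: "Ord (app h x)" if "x \<in> elts \<delta>" for x using h(2) Ord_in[OF \<xi>(1)] that by blast
  have "Limit \<delta>"
    unfolding Limit_def
  proof (intro conjI ballI)
    show "elts \<delta> \<noteq> {}" using h(3) lim unfolding Limit_def by blast
    fix x assume x: "x \<in> elts \<delta>"
    show "\<exists>\<gamma>\<in>elts \<delta>. x \<in> elts \<gamma>"
    proof (rule ccontr)
      \<comment> \<open>If \<open>x\<close> were the last element of \<delta>, all values of
        \<open>h\<close> would lie below one \<gamma> in \<xi>: those below \<open>x\<close> by
        \<open>small\<close>, and the value at \<open>x\<close> by choice of \<gamma>.\<close>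
      assume max: "\<not> ?thesis"
      obtain \<nu> where \<nu>: "\<nu> \<in> elts \<xi>" "\<forall>z\<in>elts x. app h z \<in> elts \<nu>" using small[OF x] by blast
      obtain \<gamma> where \<gamma>: "\<gamma> \<in> elts \<xi>" "\<nu> \<in> elts \<gamma>" "app h x \<in> elts \<gamma>"
        using Limit_upper[OF lim \<nu>(1)] h(2) x by blast
      obtain z where z: "z \<in> elts \<delta>" "\<gamma> \<in> elts (app h z)" using h(3) \<gamma>(1) by blast
      have "z \<in> elts x \<or> z = x"
        using Ord_linear[OF Ord_in[OF \<delta>(1) z(1)] Ord_in[OF \<delta>(1) x]] max z(1) by blast
      then show False
      proof
        assume "z \<in> elts x"
        then have "\<gamma> \<in> elts \<nu>" using \<nu>(2) z(2) Ord_trans[OF Ord_in[OF \<xi>(1) \<nu>(1)]] by blast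
        then show False using mem_asym[OF \<gamma>(2)] by blast
      next
        assume "z = x"
        then show False using z(2) mem_asym[OF \<gamma>(3)] by blast
      qed
    qed
  qed (rule \<delta>(1))
  moreover have "\<not> cof M \<beta> \<delta>" if \<beta>: "\<beta> \<in> elts \<delta>" for \<beta>
  proof
    assume "cof M \<beta> \<delta>"
    then obtain k where k: "k \<in> M" "\<forall>y\<in>elts \<beta>. app k y \<in> elts \<delta>"
      "\<forall>\<gamma>\<in>elts \<delta>. \<exists>y\<in>elts \<beta>. \<gamma> \<in> elts (app k y)" unfolding cof_def by blast
    \<comment> \<open>Bounds for \<open>h\<close> on the initial segments given by \<open>k\<close>
      would form a shorter cofinal function into \<xi>, against the minimality of \<delta>.\<close>
    let ?P = "\<lambda>y \<nu>. \<forall>x\<in>elts (app k y). app h x \<in> elts \<nu>"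
    have P: "A.dfb (\<lambda>_ s. ?P (s 0) (s 1))" by (intro dfb_rules) (simp_all add: k h)
    have "\<exists>\<nu>\<in>elts \<xi>. ?P y \<nu>" if "y \<in> elts \<beta>" for y using small k(2) that by blast
    from A.choice[where P = ?P, OF P A.M_trans[OF \<delta>M \<beta>] \<xi>(2) this]
    obtain v where v: "v \<in> M" "\<forall>y\<in>elts \<beta>. app v y \<in> elts \<xi> \<and> ?P y (app v y)" by blast
    have "\<exists>y\<in>elts \<beta>. \<gamma> \<in> elts (app v y)" if \<gamma>: "\<gamma> \<in> elts \<xi>" for \<gamma>
    proof -
      obtain x where x: "x \<in> elts \<delta>" "\<gamma> \<in> elts (app h x)" using h(3) \<gamma> by blast
      obtain y where y: "y \<in> elts \<beta>" "x \<in> elts (app k y)" using k(3) x(1) by blast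
      have "app v y \<in> elts \<xi>" "app h x \<in> elts (app v y)" using v(2) y by blast+
      then show ?thesis using Ord_trans[OF Ord_in[OF \<xi>(1)]] x(2) y(1) by blast
    qed
    then have "cof M \<beta> \<xi>" unfolding cof_def using v by blast
    then show False using \<delta>(3)[OF \<beta>] by blast
  qed
  ultimately have "reg M \<delta>" by (simp add: reg_def)
  then have regN: "reg N \<delta>" by (rule reg_N[OF \<delta>M])
  obtain h' where h': "h' \<in> N" "\<forall>x\<in>elts \<delta>. app h' x = app h x"
    using ordinal_function_in_N[OF \<delta>(1) \<delta>M \<xi> h(1,2)] by blast
  obtain f where f: "f \<in> N" "\<forall>n\<in>elts omega. app f n \<in> elts \<xi>"
    "\<forall>\<gamma>\<in>elts \<xi>. \<exists>n\<in>elts omega. \<gamma> \<in> elts (app f n)" using cofN unfolding cof_def by blast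
  \<comment> \<open>The sequence \<open>f\<close> is pulled back along \<open>h\<close>: for each
    \<open>n\<close> an index where \<open>h\<close> exceeds \<open>f n\<close>. These indices are
    cofinal in \<delta>, because \<open>h\<close> is bounded in \<xi> on each proper initial
    segment.\<close>
  let ?P = "\<lambda>n x. app f n \<in> elts (app h' x)"
  have P: "B.dfb (\<lambda>_ s. ?P (s 0) (s 1))" by (intro dfb_rules) (simp_all add: f h')
  have "\<exists>x\<in>elts \<delta>. ?P n x" if n: "n \<in> elts omega" for n
  proof -
    obtain x where "x \<in> elts \<delta>" "app f n \<in> elts (app h x)" using h(3) f(2) n by blast
    then show ?thesis using h'(2) by (intro bexI[of _ x]) simp_all
  qed
  from B.choice[where P = ?P, OF P B.omega_in \<delta>N this]
  obtain k where k: "k \<in> N" "\<forall>n\<in>elts omega. app k n \<in> elts \<delta> \<and> ?P n (app k n)" by blast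
  have "\<exists>n\<in>elts omega. x \<in> elts (app k n)" if x: "x \<in> elts \<delta>" for x
  proof -
    obtain x' where x': "x' \<in> elts \<delta>" "x \<in> elts x'" using Limit_next[OF \<open>Limit \<delta>\<close> x] by blast
    obtain \<nu> where \<nu>: "\<nu> \<in> elts \<xi>" "\<forall>z\<in>elts x'. app h z \<in> elts \<nu>" using small[OF x'(1)] by blast
    obtain n where n: "n \<in> elts omega" "\<nu> \<in> elts (app f n)" using f(3) \<nu>(1) by blast
    have kn: "app k n \<in> elts \<delta>" "app f n \<in> elts (app h (app k n))" using k(2) h'(2) n(1) by auto
    have "\<nu> \<in> elts (app h (app k n))" using Ord_trans[OF h_ord[OF kn(1)] kn(2) n(2)] .
    then have "app k n \<notin> elts x'" using \<nu>(2) mem_asym by blast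
    then have "x' = app k n \<or> x' \<in> elts (app k n)"
      using Ord_linear[OF Ord_in[OF \<delta>(1) kn(1)] Ord_in[OF \<delta>(1) x'(1)]] by blast
    then have "x \<in> elts (app k n)" using x'(2) Ord_trans[OF Ord_in[OF \<delta>(1) kn(1)]] by blast
    then show ?thesis using n(1) by blast
  qed
  then have "cof N omega \<delta>" unfolding cof_def using k by blast
  \<comment> \<open>A regular ordinal of \<open>N\<close> above \<omega> cannot have cofinality
    \<omega> there, and no limit ordinal is below \<omega>; so the cofinality \<delta> computed in
    \<open>M\<close> is \<omega>.\<close>
  then have "omega \<notin> elts \<delta>" using regN unfolding reg_def by blast
  then have "\<delta> = omega"
    using Ord_linear[OF A.Ord_omega \<delta>(1)] A.Limit_not_in_omega[OF \<open>Limit \<delta>\<close>] by blast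
  then show ?thesis using \<delta>(2) by simp
qed

text \<open>Continuity at cofinality \<omega>: the image of a cofinal sequence is cofinal in
  \<open>j \<xi>\<close>, and as \<open>j\<close> fixes the indices, its terms are the images of the
  old terms. Closure keeps them below \<xi>, so \<open>j \<xi>\<close> cannot exceed \<xi>.\<close>

lemma j_fixed:
  assumes cof: "cof M omega \<xi>" and \<xi>: "Ord \<xi>" "\<xi> \<in> M" and closed: "\<forall>\<beta>\<in>elts \<xi>. j \<beta> \<in> elts \<xi>"
  shows "j \<xi> = \<xi>"
proof -
  obtain f where f: "f \<in> M" "\<forall>n\<in>elts omega. app f n \<in> elts \<xi>"
    "\<forall>\<gamma>\<in>elts \<xi>. \<exists>n\<in>elts omega. \<gamma> \<in> elts (app f n)" using cof unfolding cof_def by blast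
  have "E.dfb (\<lambda>i s. \<forall>\<gamma>\<in>elts (par \<xi> i). \<exists>n\<in>elts omega. \<gamma> \<in> elts (app (par f i) n))"
    by (intro dfb_rules tm_par f \<xi>)
  from elementary[OF this] f(3) have jf: "\<forall>\<gamma>\<in>elts (j \<xi>). \<exists>n\<in>elts omega. \<gamma> \<in> elts (app (j f) n)" by simp
  have "\<gamma> \<in> elts \<xi>" if \<gamma>: "\<gamma> \<in> elts (j \<xi>)" for \<gamma>
  proof -
    obtain n where n: "\<gamma> \<in> elts (app (j f) (nn n))" using jf \<gamma> by (auto simp: A.elts_omega)
    have "app (j f) (nn n) = j (app f (nn n))" using j_app[OF f(1) A.nn_in, of n] j_nn by metis
    moreover have "j (app f (nn n)) \<in> elts \<xi>" using closed f(2) A.nn_in_omega by blast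
    ultimately show ?thesis using n Ord_trans[OF \<xi>(1)] by metis
  qed
  then have "j \<xi> \<in> elts \<xi> \<or> j \<xi> = \<xi>" using Ord_subset j_Ord_in[OF \<xi>] \<xi>(1) by blast
  then show ?thesis using j_not_less[OF \<xi>] by blast
qed

lemma omega_less_\<kappa>: "omega \<in> elts \<kappa>"
proof -
  have "\<kappa> \<noteq> omega" using j_omega \<kappa>(3) by metis
  moreover have "\<kappa> \<notin> elts omega" using j_nn \<kappa>(3) by (auto simp: A.elts_omega)
  ultimately show ?thesis using Ord_linear[OF \<kappa>(1) A.Ord_omega] by blast
qed

lemma \<kappa>_less: "\<kappa> \<in> elts (j \<kappa>)"
  using Ord_linear[OF \<kappa>(1)] j_Ord_in[OF \<kappa>(1,2)] j_not_less[OF \<kappa>(1,2)] \<kappa>(3) by metis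

lemma critical_sequence: "Ord ((j ^^ n) \<kappa>) \<and> (j ^^ n) \<kappa> \<in> M \<and> (j ^^ n) \<kappa> \<in> elts ((j ^^ Suc n) \<kappa>)"
proof (induction n)
  case 0
  show ?case using \<kappa> \<kappa>_less by simp
next
  case (Suc n)
  then have "Ord ((j ^^ Suc n) \<kappa>)" "(j ^^ Suc n) \<kappa> \<in> M" using j_Ord_in by auto
  moreover have "(j ^^ Suc n) \<kappa> \<in> elts ((j ^^ Suc (Suc n)) \<kappa>)"
    using Suc j_mem[of "(j ^^ n) \<kappa>" "(j ^^ Suc n) \<kappa>"] calculation by simp
  ultimately show ?case by blast
qed

text \<open>The bound \<mu> ensures that the supremum \<open>l\<close> exists in \<open>M\<close>.
  The sequence itself is formed in \<open>N\<close>, by iterating a restriction of \<open>j\<close>,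
  and only its consequence for the cofinality of \<open>l\<close> is carried back to
  \<open>M\<close>.\<close>

lemma critical_limit:
  obtains l where "Ord l" "l \<in> M" "\<kappa> \<in> elts l" "j l = l"
proof -
  from Ord_least[where P = "\<lambda>l. \<forall>n. (j ^^ n) \<kappa> \<in> elts l", OF \<mu>(1)] \<mu>(3)
  obtain l where l: "Ord l" "\<And>n. (j ^^ n) \<kappa> \<in> elts l" "\<And>\<gamma>. \<gamma> \<in> elts l \<Longrightarrow> \<exists>n. (j ^^ n) \<kappa> \<notin> elts \<gamma>"
    "l = \<mu> \<or> l \<in> elts \<mu>" by metis
  have lM: "l \<in> M" using l(4) \<mu>(2) A.M_trans by blast
  then have lN: "l \<in> N" using l(1) same_Ord by blast
  have cofinal: "\<exists>n. y \<in> elts ((j ^^ n) \<kappa>)" if y: "y \<in> elts l" for y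
  proof -
    obtain n where "(j ^^ n) \<kappa> \<notin> elts y" using l(3)[OF y] by blast
    then have "y \<in> elts ((j ^^ n) \<kappa>) \<or> y = (j ^^ n) \<kappa>"
      using Ord_linear[OF conjunct1[OF critical_sequence[of n]] Ord_in[OF l(1) y]] by blast
    then show ?thesis using critical_sequence[of n] by metis
  qed
  obtain J where J: "J \<in> N" "\<forall>\<beta>\<in>elts l. app J \<beta> = j \<beta>" using j_restrict[OF l(1) lM] by blast
  have "\<exists>f\<in>N. \<forall>n. app f (nn n) = (j ^^ n) \<kappa>"
  proof (rule B.iteration[where R = "\<lambda>x y. y = app J x"])
    show "B.dfb (\<lambda>_ s. s 1 = app J (s 0))" by (intro dfb_rules) (simp add: J)
    show "(j ^^ n) \<kappa> \<in> N" for n using critical_sequence[of n] same_Ord by blast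
    show "y = app J ((j ^^ n) \<kappa>) \<longleftrightarrow> y = (j ^^ Suc n) \<kappa>" for n y using J(2) l(2)[of n] by simp
  qed
  then obtain f where f: "f \<in> N" "\<And>n. app f (nn n) = (j ^^ n) \<kappa>" by blast
  have "cof N omega l"
    unfolding cof_def
  proof (intro bexI[OF _ f(1)] conjI ballI)
    show "app f x \<in> elts l" if "x \<in> elts omega" for x using that f(2) l(2) by (auto simp: A.elts_omega)
    show "\<exists>x\<in>elts omega. \<gamma> \<in> elts (app f x)" if "\<gamma> \<in> elts l" for \<gamma>
      using cofinal[OF that] f(2) A.nn_in_omega by metis
  qed
  then have "cof M omega l" by (rule cof_omega_M[OF _ l(1) lM])
  moreover have "j \<beta> \<in> elts l" if \<beta>: "\<beta> \<in> elts l" for \<beta>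
  proof -
    obtain n where "\<beta> \<in> elts ((j ^^ n) \<kappa>)" using cofinal[OF \<beta>] by blast
    then have "j \<beta> \<in> elts ((j ^^ Suc n) \<kappa>)"
      using j_mem[OF A.M_trans[OF lM \<beta>]] critical_sequence[of n] by simp
    then show ?thesis using Ord_trans[OF l(1) l(2)] by blast
  qed
  ultimately have "j l = l" using j_fixed[OF _ l(1) lM] by blast
  then show thesis using that[OF l(1) lM] l(2)[of 0] by simp
qed

lemma contradiction: False
proof -
  obtain l where l: "Ord l" "l \<in> M" "\<kappa> \<in> elts l" "j l = l" by (rule critical_limit)
  have \<omega>l: "omega \<in> elts l" using Ord_trans[OF l(1,3) omega_less_\<kappa>] .
  obtain \<theta>0 where \<theta>0: "\<theta>0 \<in> M" "l \<in> elts \<theta>0 \<and> reg M \<theta>0" using A.regular_above[OF l(2,1) \<omega>l] by blast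
  then have "Ord \<theta>0" by (simp add: reg_def Limit_Ord)
  from Ord_least[where P = "\<lambda>\<theta>. l \<in> elts \<theta> \<and> reg M \<theta>", OF this \<theta>0(2)]
  obtain \<theta> where \<theta>: "Ord \<theta>" "l \<in> elts \<theta>" "reg M \<theta>"
    and least: "\<And>\<gamma>. \<gamma> \<in> elts \<theta> \<Longrightarrow> \<not> (l \<in> elts \<gamma> \<and> reg M \<gamma>)" and "\<theta> = \<theta>0 \<or> \<theta> \<in> elts \<theta>0" by metis
  then have \<theta>M: "\<theta> \<in> M" using \<theta>0(1) A.M_trans by blast
  then have \<theta>N: "\<theta> \<in> N" using \<theta>(1) same_Ord by blast
  have lim: "Limit \<theta>" using \<theta>(3) by (simp add: reg_def)
  have \<kappa>\<theta>: "\<kappa> \<in> elts \<theta>" using Ord_trans[OF \<theta>(1,2) l(3)] .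
  have \<omega>\<theta>: "omega \<in> elts \<theta>" using Ord_trans[OF \<theta>(1,2) \<omega>l] .
  \<comment> \<open>By elementarity no ordinal of \<open>j \<theta>\<close> above \<open>l\<close>
    is regular in \<open>N\<close>. Since \<theta> is regular there, it cannot be below
    \<open>j \<theta>\<close>.\<close>
  have j\<theta>: "j \<theta> = \<theta>"
  proof -
    have "E.dfb (\<lambda>i s. \<forall>\<gamma>\<in>elts (par \<theta> i). \<not> (par l i \<in> elts \<gamma> \<and> reg (Mb i) \<gamma>))"
      by (intro dfb_rules tm_par \<theta>M l)
    from elementary[OF this] least l(4) have "\<forall>\<gamma>\<in>elts (j \<theta>). \<not> (l \<in> elts \<gamma> \<and> reg N \<gamma>)" by simp
    then have "\<theta> \<notin> elts (j \<theta>)" using \<theta>(2) reg_N[OF \<theta>M \<theta>(3)] by blast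
    then show ?thesis
      using Ord_linear[OF \<theta>(1)] j_Ord_in[OF \<theta>(1) \<theta>M] j_not_less[OF \<theta>(1) \<theta>M] by metis
  qed
  obtain a where a: "a \<in> M" "ladder M \<theta> a" using A.ladder_ex[OF \<theta>M \<theta>(1)] by blast
  have "A.dfb (\<lambda>_ s. pos M \<theta> a (s 0))" by (intro dfb_rules) (simp_all add: \<theta>M a)
  from A.separation[OF this \<theta>M] obtain S where
    S: "S \<in> M" "elts S = {\<gamma> \<in> elts \<theta>. pos M \<theta> a \<gamma>}" by blast
  have "E.dfb (\<lambda>i s. \<forall>\<gamma>\<in>elts (par S i). pos (Mb i) (par \<theta> i) (par a i) \<gamma>)"
    by (intro dfb_rules tm_par \<theta>M a S)
  from elementary[OF this] S(2) j\<theta> have pos_N: "\<forall>\<gamma>\<in>elts (j S). pos N \<theta> (j a) \<gamma>" by simp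
  obtain J where J: "J \<in> N" "\<forall>\<beta>\<in>elts \<theta>. app J \<beta> = j \<beta>" using j_restrict[OF \<theta>(1) \<theta>M] by blast
  have J_\<theta>: "\<forall>\<beta>\<in>elts \<theta>. app J \<beta> \<in> elts \<theta>"
    using J(2) j_mem[OF A.M_trans[OF \<theta>M] \<theta>M] j\<theta> by simp
  \<comment> \<open>The restriction \<open>J\<close> is the test function for positivity in
    \<open>N\<close>. At the resulting \<xi>, elementarity also puts the preimage of \<gamma> into
    \<open>S\<close>.\<close>
  have jS: "\<exists>\<gamma>'\<in>elts S. \<gamma> = j \<gamma>'" if \<gamma>: "\<gamma> \<in> elts (j S)" for \<gamma>
  proof -
    obtain \<xi> n where \<xi>: "\<xi> \<in> elts \<theta>" "cof N omega \<xi>" "\<forall>x\<in>elts \<xi>. app J x \<in> elts \<xi>"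
      and n: "n \<in> elts omega" "app (app (j a) \<xi>) n = \<gamma>"
      using pos_N \<gamma> J(1) J_\<theta> unfolding pos_def by blast
    obtain k where k: "n = nn k" using n(1) by (auto simp: A.elts_omega)
    have \<xi>M: "\<xi> \<in> M" using A.M_trans[OF \<theta>M \<xi>(1)] .
    have ord: "Ord \<xi>" using Ord_in[OF \<theta>(1) \<xi>(1)] .
    have "j \<beta> \<in> elts \<xi>" if "\<beta> \<in> elts \<xi>" for \<beta>
      using \<xi>(3) J(2) Ord_trans[OF \<theta>(1) \<xi>(1) that] that by fastforce
    then have "j \<xi> = \<xi>" using j_fixed[OF cof_omega_M[OF \<xi>(2) ord \<xi>M] ord \<xi>M] by blast
    then have "\<gamma> = app (app (j a) (j \<xi>)) (j (nn k))" using n(2) k j_nn by metis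
    also have "\<dots> = j (app (app a \<xi>) (nn k))" using j_app a(1) \<xi>M A.app_closed A.nn_in by metis
    finally have eq: "\<gamma> = j (app (app a \<xi>) (nn k))" .
    then have "app (app a \<xi>) (nn k) \<in> elts S"
      using j_mem[OF A.app_closed[OF A.app_closed[OF a(1) \<xi>M] A.nn_in] S(1)] \<gamma> by metis
    then show ?thesis using eq by blast
  qed
  obtain \<alpha> h where \<alpha>: "\<alpha> \<in> M" "Ord \<alpha>" and h: "h \<in> M" "app h ` elts \<alpha> = elts S" "inj_on (app h) (elts \<alpha>)"
    using A.well_ordering[OF S(1)] by blast
  \<comment> \<open>An enumeration of \<open>S\<close> shorter than \<theta> would be bounded by
    regularity, while \<open>S\<close> is unbounded. So the enumeration is defined and injective on
    all of \<kappa>.\<close>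
  have "\<alpha> \<notin> elts \<theta>"
  proof
    assume "\<alpha> \<in> elts \<theta>"
    then have "\<not> cof M \<alpha> \<theta>" using \<theta>(3) by (simp add: reg_def)
    moreover have "\<forall>x\<in>elts \<alpha>. app h x \<in> elts \<theta>" using h(2) S(2) by blast
    ultimately obtain \<nu> where \<nu>: "\<nu> \<in> elts \<theta>" "\<forall>x\<in>elts \<alpha>. app h x \<in> elts \<nu>"
      using A.not_cof_bounded[OF \<theta>(1) _ h(1) _ lim] by blast
    obtain \<gamma> where "\<gamma> \<in> elts S" "\<gamma> \<notin> elts \<nu>"
      using A.pos_unbounded[OF \<theta>M \<theta>(3) \<omega>\<theta> a \<nu>(1)] S(2) by blast
    then show False using h(2) \<nu>(2) by (metis imageE)
  qed
  then have "\<alpha> = \<theta> \<or> \<theta> \<in> elts \<alpha>" using Ord_linear[OF \<alpha>(2) \<theta>(1)] by blast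
  then have sub: "elts \<kappa> \<subseteq> elts \<alpha>"
    using Ord_trans[OF \<alpha>(2)] Ord_trans[OF \<theta>(1) \<kappa>\<theta>] by blast
  have "E.dfb (\<lambda>i s. \<forall>x\<in>elts (par \<kappa> i). app (par h i) x \<in> elts (par S i))"
    by (intro dfb_rules tm_par \<kappa> h S)
  from elementary[OF this] h(2) sub have "\<forall>x\<in>elts (j \<kappa>). app (j h) x \<in> elts (j S)" by auto
  then obtain \<gamma> where \<gamma>: "\<gamma> \<in> elts S" "app (j h) \<kappa> = j \<gamma>" using jS \<kappa>_less by blast
  have \<gamma>M: "\<gamma> \<in> M" using A.M_trans[OF S(1) \<gamma>(1)] .
  \<comment> \<open>As \<kappa> is below \<open>j \<kappa>\<close>, the image of \<gamma> is a value
    of \<open>j h\<close> on \<open>j \<kappa>\<close>. Elementarity makes \<gamma> a value of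
    \<open>h\<close> at some \<delta> below \<kappa>, and \<open>j\<close> fixes \<delta>;
    injectivity of \<open>j h\<close> then identifies \<delta> with \<kappa>.\<close>
  have "E.dfb (\<lambda>i s. \<exists>x\<in>elts (par \<kappa> i). app (par h i) x = par \<gamma> i)"
    by (intro dfb_rules tm_par \<kappa> h \<gamma>M)
  from elementary[OF this] \<gamma>(2) \<kappa>_less obtain \<delta> where \<delta>: "\<delta> \<in> elts \<kappa>" "app h \<delta> = \<gamma>" by auto
  have "app (j h) \<delta> = j \<gamma>"
    using j_app[OF h(1) A.M_trans[OF \<kappa>(2) \<delta>(1)]] below_\<kappa>[OF \<delta>(1)] \<delta>(2) by simp
  moreover have "E.dfb (\<lambda>i s. \<forall>x\<in>elts (par \<kappa> i). \<forall>y\<in>elts (par \<kappa> i). app (par h i) x = app (par h i) y \<longrightarrow> x = y)"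
    by (intro dfb_rules tm_par \<kappa> h)
  from elementary[OF this] have "\<forall>x\<in>elts (j \<kappa>). \<forall>y\<in>elts (j \<kappa>). app (j h) x = app (j h) y \<longrightarrow> x = y"
    using h(3) sub by (simp add: inj_on_def subset_eq)
  moreover have "\<delta> \<in> elts (j \<kappa>)"
    using Ord_trans[OF _ \<kappa>_less \<delta>(1)] j_Ord_in[OF \<kappa>(1,2)] by blast
  ultimately have "\<delta> = \<kappa>" using \<gamma>(2) \<kappa>_less by simp
  then show False using \<delta>(1) mem_irrefl by blast
qed

end

theorem theorem1p1:
  fixes M N \<Omega> :: "'v::set_universe set" and j :: "'v \<Rightarrow> 'v" and \<kappa> :: 'v
  assumes "transitive_class M" and "models_ZFC M"
    and "transitive_class N" and "models_ZFC N"
    and "ordinals_of M = \<Omega>" and "ordinals_of N = \<Omega>"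
    and "elementary_embedding j M N" and "nontrivial_on M j"
    and "\<kappa> = crit M j"
  shows "cofinal_sequence (\<lambda>n. (j ^^ n) \<kappa>) \<Omega>
    \<or> (\<exists>\<alpha>\<in>\<Omega>. j ` elts \<alpha> \<notin> elts ` N)
    \<or> (\<exists>\<alpha>\<in>\<Omega>. regular_in M \<alpha> \<and> singular_in N \<alpha>)"
proof (rule ccontr)
  assume neg: "\<not> ?thesis"
  have \<Omega>: "\<alpha> \<in> \<Omega> \<longleftrightarrow> Ord \<alpha> \<and> \<alpha> \<in> M" "\<alpha> \<in> \<Omega> \<longleftrightarrow> Ord \<alpha> \<and> \<alpha> \<in> N" for \<alpha>
    using assms(5,6) by (auto simp: ordinals_of_def)
  interpret embedding M N j
  proof
    show "transitive_model M" "transitive_model N"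
      using assms(1-4) by (simp_all add: transitive_model_def)
    show "\<alpha> \<in> M \<longleftrightarrow> \<alpha> \<in> N" if "Ord \<alpha>" for \<alpha> using \<Omega>[of \<alpha>] that by blast
  qed (rule assms(7))
  have \<kappa>: "Ord \<kappa>" "\<kappa> \<in> M" "j \<kappa> \<noteq> \<kappa>" "\<forall>\<beta>\<in>elts \<kappa>. j \<beta> = \<beta>"
    using crit[OF assms(8)] assms(9) by auto
  have seq: "(j ^^ n) \<kappa> \<in> \<Omega>" for n
    by (induction n) (use \<kappa> \<Omega> j_Ord_in in auto)
  have "\<not> cofinal_sequence (\<lambda>n. (j ^^ n) \<kappa>) \<Omega>" using neg by blast
  then obtain \<mu> where \<mu>: "\<mu> \<in> \<Omega>" "\<And>n. \<mu> \<noteq> (j ^^ n) \<kappa> \<and> \<mu> \<notin> elts ((j ^^ n) \<kappa>)"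
    unfolding cofinal_sequence_def using seq by blast
  have bounded: "(j ^^ n) \<kappa> \<in> elts \<mu>" for n
    using Ord_linear[of \<mu> "(j ^^ n) \<kappa>"] \<mu> seq[of n] \<Omega>(1) by blast
  have images: "\<exists>x\<in>N. elts x = j ` elts \<alpha>" if "Ord \<alpha>" "\<alpha> \<in> M" for \<alpha>
  proof -
    have "j ` elts \<alpha> \<in> elts ` N" using neg \<Omega>(1) that by blast
    then show ?thesis by (metis imageE)
  qed
  \<comment> \<open>Being a limit ordinal does not depend on the model, and a limit ordinal of
    \<open>N\<close> is either regular or singular there.\<close>
  have reg: "reg N \<alpha>" if "\<alpha> \<in> M" "reg M \<alpha>" for \<alpha>
  proof -
    have lim: "Limit \<alpha>" using that(2) by (simp add: reg_def)
    then have "\<alpha> \<in> \<Omega>" using \<Omega>(1) Limit_Ord that(1) by blast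
    then have "\<not> singular_in N \<alpha>" "\<alpha> \<in> N" using neg A.regular_in_iff that \<Omega>(2) by blast+
    then show ?thesis using B.singular_in_iff lim by blast
  qed
  interpret bounded_embedding M N j \<kappa> \<mu>
    by unfold_locales (use \<kappa> \<mu>(1) \<Omega>(1) bounded images reg in auto)
  show False by (rule contradiction)
qed

end
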